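(* Let $n\ge 2$, $K\in\mathbb{R}$, and let $\mathbb{M}^n_K$ be the $n$-dimensional space form of constant sectional curvature $K$. Let $p\in\mathbb{M}^n_K$, let $R>0$, with $R<\pi/\sqrt{K}$ when $K>0$, and let $B_p(R)$ be the geodesic ball of radius $R$ centered at $p$. Let $u$ be a positive solution on $B_p(R)$ of the conformal Laplacian equation $$\Box_{\mathbb{M}^n_K}u:=-\Delta_{\mathbb{M}^n_K}u+\frac{n(n-2)K}{4}u=0 .$$ Put $r(x)=d(p,x)$. Then for every $x\in B_p(R)$, $$\left\|\nabla\ln\left(\mathrm{cs}_K^{\,n-2}\left(\tfrac{r}{2}\right)u\right)\right\|(x)\le \frac{\mathrm{cs}_K\left(\frac{R}{2}\right)}{\mathrm{cs}_K\left(\frac{r(x)}{2}\right)}\left(\frac{n-1}{2\,\mathrm{sn}_K\left(\frac{R-r(x)}{2}\right)}+\frac{1}{2\,\mathrm{sn}_K\left(\frac{R+r(x)}{2}\right)}\right).$$ Moreover, equality holds at some point of $B_p(R)$ if and only if $u$ is a positive multiple of the Poisson kernel of $\Box_{\mathbb{M}^n_K}$ for $B_p(R)$ with respect to some point of $\partial B_p(R)$. In particular, when $n=2$ (so that $u$ is a positive harmonic function), $$\|\nabla\ln u\|(x)\le\frac{\mathrm{sn}_K(R)}{2\,\mathrm{sn}_K\left(\frac{R+r(x)}{2}\right)\mathrm{sn}_K\left(\frac{R-r(x)}{2}\right)}\qquad\text{for all }x\in B_p(R),$$ and equality holds at some point of $B_p(R)$ if and only if $u$ is a positive multiple of the Poisson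 kernel for $B_p(R)$ with respect to some point of $\partial B_p(R)$.
   Context: For a real constant $K$: $\mathrm{sn}_K(r)=\frac{\sin(\sqrt{K}r)}{\sqrt{K}}$ if $K>0$, $\mathrm{sn}_0(r)=r$, and $\mathrm{sn}_K(r)=\frac{\sinh(\sqrt{-K}r)}{\sqrt{-K}}$ if $K<0$; $\mathrm{cs}_K=\mathrm{sn}_K'$, i.e. $\mathrm{cs}_K(r)=\cos(\sqrt{K}r)$, $1$, $\cosh(\sqrt{-K}r)$ for $K>0$, $K=0$, $K<0$ respectively. The space form $\mathbb{M}^n_K$ is the simply connected complete model: the round sphere of curvature $K$ if $K>0$, Euclidean space if $K=0$, hyperbolic space of curvature $K$ if $K<0$. $\Delta$ is the Laplace--Beltrami operator (with the sign $\Delta=\operatorname{div}\nabla$), $d$ is the Riemannian distance, and $\|\cdot\|$ is the Riemannian norm. The Poisson kernel $P(\cdot,y)$, $y\in\partial B_p(R)$, of $\Box_{\mathbb{M}^n_K}$ for $B_p(R)$ is the kernel such that for every continuous $\varphi$ on $\partial B_p(R)$ the solution of $\Box_{\mathbb{M}^n_K}w=0$ in $B_p(R)$, $w=\varphi$ on $\partial B_p(R)$, is $w(x)=\int_{\partial B_p(R)}P(x,y)\varphi(y)\,dA(y)$, where $dA$ is the induced surface measure; "the Poisson kernel with respect to the point $y$" is the function $x\mapsto P(x,y)$. For $n=2$, $\Box=-\Delta$ and this is the usual Poisson kernel for harmonic functions. For $K=0$ and $p=0$ it is $P(x,y)=\frac{R^2-|x|^2}{n\omega_nR|y-x|^n}$,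 with $\omega_n$ the volume of the unit ball in $\mathbb{R}^n$. *)

theory Defs
  imports "HOL-Analysis.Analysis"
begin

definition sn :: "real \<Rightarrow> real \<Rightarrow> real" where
  "sn K r = (if K > 0 then sin (sqrt K * r) / sqrt K
             else if K = 0 then r
             else sinh (sqrt (- K) * r) / sqrt (- K))"

definition cs :: "real \<Rightarrow> real \<Rightarrow> real" where
  "cs K r = (if K > 0 then cos (sqrt K * r)
             else if K = 0 then 1
             else cosh (sqrt (- K) * r))"


section \<open>The space form as a Riemannian manifold\<close>

text \<open>
  The three models are written uniformly as hypersurfaces of \<open>real \<times> 'a\<close>, where the dimension
  of the space form is \<open>n = DIM('a)\<close>. Substituting \<open>s = t / sqrt \<bar>K\<bar>\<close> gives the usual pictures:
  for \<open>K > 0\<close> the round sphere \<open>s\<^sup>2 + \<bar>x\<bar>\<^sup>2 = 1 / K\<close> with the metric induced by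
  \<open>ds\<^sup>2 + \<bar>dx\<bar>\<^sup>2\<close>; for \<open>K < 0\<close> the upper sheet of the hyperboloid
  \<open>s\<^sup>2 - \<bar>x\<bar>\<^sup>2 = 1 / \<bar>K\<bar>\<close> with the metric induced by \<open>\<bar>dx\<bar>\<^sup>2 - ds\<^sup>2\<close>. For \<open>K = 0\<close> one gets the
  affine hyperplane \<open>t = 1\<close>, a copy of the Euclidean space \<open>'a\<close>.
\<close>

definition space_form :: "real \<Rightarrow> (real \<times> 'a::euclidean_space) set" where
  "space_form K = {(t, x). t\<^sup>2 + K * (norm x)\<^sup>2 = 1 \<and> (K \<le> 0 \<longrightarrow> t > 0)}"

definition tangent :: "real \<Rightarrow> real \<times> 'a::euclidean_space \<Rightarrow> (real \<times> 'a) set" where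
  "tangent K p = {v. fst p * fst v + K * (snd p \<bullet> snd v) = 0}"

text \<open>
  For \<open>K = 0\<close> tangent vectors have first component 0 (and \<open>x / 0 = 0\<close> besides), so the first
  term vanishes.
\<close>

definition riem :: "real \<Rightarrow> real \<times> 'a::euclidean_space \<Rightarrow> real \<times> 'a \<Rightarrow> real" where
  "riem K v w = fst v * fst w / K + snd v \<bullet> snd w"

definition riem_norm :: "real \<Rightarrow> real \<times> 'a::euclidean_space \<Rightarrow> real" where
  "riem_norm K v = sqrt (riem K v v)"

definition curve_length :: "real \<Rightarrow> (real \<Rightarrow> real \<times> 'a::euclidean_space) \<Rightarrow> real" where
  "curve_length K \<gamma> = integral {0..1} (\<lambda>s. riem_norm K (vector_derivative \<gamma> (at s)))"

text \<open>
  The curves are \<open>C\<^sup>1\<close> up to the end points. The weaker \<^const>\<open>valid_path\<close> would not do: it allows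
  curves of infinite length, to which \<^const>\<open>integral\<close> assigns the value 0.
\<close>

definition riem_dist :: "real \<Rightarrow> real \<times> 'a::euclidean_space \<Rightarrow> real \<times> 'a \<Rightarrow> real" where
  "riem_dist K p q = Inf {curve_length K \<gamma> | \<gamma>.
     \<gamma> C1_differentiable_on {0..1} \<and> \<gamma> ` {0..1} \<subseteq> space_form K \<and>
     pathstart \<gamma> = p \<and> pathfinish \<gamma> = q}"

definition geodesic_ball :: "real \<Rightarrow> real \<times> 'a::euclidean_space \<Rightarrow> real \<Rightarrow> (real \<times> 'a) set" where
  "geodesic_ball K p R = {x \<in> space_form K. riem_dist K p x < R}"

definition geodesic_sphere :: "real \<Rightarrow> real \<times> 'a::euclidean_space \<Rightarrow> real \<Rightarrow> (real \<times> 'a) set" where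
  "geodesic_sphere K p R = {x \<in> space_form K. riem_dist K p x = R}"


section \<open>Differential operators\<close>

text \<open>
  The derivative of a map on the hypersurface, taken within the hypersurface, is determined by the
  map only on tangent vectors; it is applied to nothing else below.
\<close>

definition deriv_along ::
  "real \<Rightarrow> (real \<times> 'a::euclidean_space \<Rightarrow> 'b::real_normed_vector) \<Rightarrow> real \<times> 'a \<Rightarrow> real \<times> 'a \<Rightarrow> 'b" where
  "deriv_along K f x v = frechet_derivative f (at x within space_form K) v"

definition grad ::
  "real \<Rightarrow> (real \<times> 'a::euclidean_space \<Rightarrow> real) \<Rightarrow> real \<times> 'a \<Rightarrow> real \<times> 'a" where
  "grad K f x = (THE w. w \<in> tangent K x \<and> (\<forall>v \<in> tangent K x. riem K w v = deriv_along K f x v))"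

definition orthonormal_basis ::
  "real \<Rightarrow> real \<times> 'a::euclidean_space \<Rightarrow> (real \<times> 'a) set \<Rightarrow> bool" where
  "orthonormal_basis K x B \<longleftrightarrow> span B = tangent K x \<and>
     (\<forall>e \<in> B. \<forall>f \<in> B. riem K e f = (if e = f then 1 else 0))"

text \<open>
  The Levi-Civita derivative \<open>\<nabla>\<^sub>eX\<close> of a tangent field is the tangential part of the ambient
  derivative; since the normal part is orthogonal to \<open>e\<close>, it need not be removed in the trace.
  The sum does not depend on the chosen orthonormal basis.
\<close>

definition divergence ::
  "real \<Rightarrow> (real \<times> 'a::euclidean_space \<Rightarrow> real \<times> 'a) \<Rightarrow> real \<times> 'a \<Rightarrow> real" where
  "divergence K X x = (\<Sum>e \<in> (SOME B. orthonormal_basis K x B). riem K (deriv_along K X x e) e)"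

definition laplace_beltrami ::
  "real \<Rightarrow> (real \<times> 'a::euclidean_space \<Rightarrow> real) \<Rightarrow> real \<times> 'a \<Rightarrow> real" where
  "laplace_beltrami K f = divergence K (grad K f)"

definition conformal_laplacian ::
  "real \<Rightarrow> (real \<times> 'a::euclidean_space \<Rightarrow> real) \<Rightarrow> real \<times> 'a \<Rightarrow> real" where
  "conformal_laplacian K f x =
     - laplace_beltrami K f x + real DIM('a) * (real DIM('a) - 2) * K / 4 * f x"

text \<open>
  A function on (a relatively open subset of) the hypersurface is \<open>C\<^sup>2\<close> if locally it is the
  restriction of a \<open>C\<^sup>2\<close> function on an open set of the ambient space.
\<close>

definition C2_on_open :: "'b::real_normed_vector set \<Rightarrow> ('b \<Rightarrow> real) \<Rightarrow> bool" where
  "C2_on_open U F \<longleftrightarrow> (\<exists>(F' :: 'b \<Rightarrow> 'b \<Rightarrow>\<^sub>L real) (F'' :: 'b \<Rightarrow> 'b \<Rightarrow>\<^sub>L 'b \<Rightarrow>\<^sub>L real).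
     (\<forall>y \<in> U. (F has_derivative blinfun_apply (F' y)) (at y)) \<and>
     (\<forall>y \<in> U. (F' has_derivative blinfun_apply (F'' y)) (at y)) \<and>
     continuous_on U F'')"

definition C2_on :: "'b::real_normed_vector set \<Rightarrow> ('b \<Rightarrow> real) \<Rightarrow> bool" where
  "C2_on S f \<longleftrightarrow> (\<forall>x \<in> S. \<exists>U F. open U \<and> x \<in> U \<and> C2_on_open U F \<and> (\<forall>y \<in> U \<inter> S. F y = f y))"

definition conformal_solution ::
  "real \<Rightarrow> (real \<times> 'a::euclidean_space) set \<Rightarrow> (real \<times> 'a \<Rightarrow> real) \<Rightarrow> bool" where
  "conformal_solution K B u \<longleftrightarrow> C2_on B u \<and> (\<forall>x \<in> B. conformal_laplacian K u x = 0)"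


section \<open>The Poisson kernel\<close>

text \<open>
  The surface measure of the Euclidean sphere of radius \<open>\<rho>\<close> about the origin, as a Borel measure on
  the whole space: it gives a Borel part \<open>E\<close> of the sphere the mass \<open>n / \<rho>\<close> times the volume of the
  cone \<open>{t *\<^sub>R y | 0 < t < 1, y \<in> E}\<close>.
\<close>

definition euclidean_sphere_measure :: "real \<Rightarrow> 'a::euclidean_space measure" where
  "euclidean_sphere_measure \<rho> = scale_measure (ennreal (real DIM('a) / \<rho>))
     (distr (density lborel (indicator (ball 0 \<rho>))) borel (\<lambda>x. (\<rho> / norm x) *\<^sub>R x))"

definition tangent_isometry ::
  "real \<Rightarrow> real \<times> 'a::euclidean_space \<Rightarrow> ('a \<Rightarrow> real \<times> 'a) \<Rightarrow> bool" where
  "tangent_isometry K p L \<longleftrightarrow> linear L \<and> range L = tangent K p \<and>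
     (\<forall>v w. riem K (L v) (L w) = v \<bullet> w)"

text \<open>
  Since \<open>exp\<^sub>p (R v) = cs\<^sub>K(R) p + sn\<^sub>K(R) v\<close> for unit tangent vectors \<open>v\<close> at \<open>p\<close>, the geodesic sphere
  is the sphere of radius \<open>sn\<^sub>K(R)\<close> about the point \<open>cs\<^sub>K(R) p\<close> in the affine space
  \<open>cs\<^sub>K(R) p + T\<^sub>p\<close>, on which the metric is Euclidean. So its induced surface measure is the Euclidean
  one, carried over by any linear isometry onto the tangent space \<open>T\<^sub>p\<close>.
\<close>

definition surface_measure ::
  "real \<Rightarrow> real \<times> 'a::euclidean_space \<Rightarrow> real \<Rightarrow> (real \<times> 'a) measure" where
  "surface_measure K p R = distr (euclidean_sphere_measure (sn K R)) borel
     (\<lambda>v. cs K R *\<^sub>R p + (SOME L. tangent_isometry K p L) v)"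

definition dirichlet_solution ::
  "real \<Rightarrow> real \<times> 'a::euclidean_space \<Rightarrow> real \<Rightarrow> (real \<times> 'a \<Rightarrow> real) \<Rightarrow> (real \<times> 'a \<Rightarrow> real) \<Rightarrow> bool" where
  "dirichlet_solution K p R \<phi> w \<longleftrightarrow>
     conformal_solution K (geodesic_ball K p R) w \<and>
     continuous_on (geodesic_ball K p R \<union> geodesic_sphere K p R) w \<and>
     (\<forall>y \<in> geodesic_sphere K p R. w y = \<phi> y)"

text \<open>
  The equivalence says that the Dirichlet problem has exactly one solution and that it is given by
  the integral. Continuity of \<open>P x\<close> singles out one kernel among those that agree almost everywhere
  on the sphere, so that the kernel with respect to a single boundary point is meaningful.
\<close>

definition poisson_kernel ::
  "real \<Rightarrow> real \<times> 'a::euclidean_space \<Rightarrow> real \<Rightarrow> (real \<times> 'a \<Rightarrow> real \<times> 'a \<Rightarrow> real) \<Rightarrow> bool" where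
  "poisson_kernel K p R P \<longleftrightarrow>
     (\<forall>x \<in> geodesic_ball K p R. continuous_on (geodesic_sphere K p R) (P x)) \<and>
     (\<forall>\<phi> w. continuous_on (geodesic_sphere K p R) \<phi> \<longrightarrow>
        (dirichlet_solution K p R \<phi> w \<longleftrightarrow>
           (\<forall>x \<in> geodesic_ball K p R.
              w x = (LINT y : geodesic_sphere K p R | surface_measure K p R. P x y * \<phi> y)) \<and>
           (\<forall>y \<in> geodesic_sphere K p R. w y = \<phi> y)))"

definition multiple_of_poisson_kernel ::
  "real \<Rightarrow> real \<times> 'a::euclidean_space \<Rightarrow> real \<Rightarrow> (real \<times> 'a \<Rightarrow> real) \<Rightarrow> bool" where
  "multiple_of_poisson_kernel K p R u \<longleftrightarrow>
     (\<exists>P. poisson_kernel K p R P \<and>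
        (\<exists>y \<in> geodesic_sphere K p R. \<exists>c > 0. \<forall>x \<in> geodesic_ball K p R. u x = c * P x y))"

end

theory Submission
  imports Defs
begin

text \<open>
  With \<open>m = (n - 2) / 2\<close>, the radial solution \<open>h = cs K (r / 2) powr (- 2 * m)\<close> turns the quantity to be estimated
  into the gradient of \<open>ln (u / h)\<close>. In terms of the squared ambient chord length \<open>q y x\<close> the Poisson kernel
  is a constant times \<open>P y x = (Q - q p x) * q y x powr (- n / 2)\<close>, where \<open>Q\<close> is the value of \<open>q p\<close> on the
  boundary, and \<open>\<parallel>grad (ln (P y / h))\<parallel>\<^sup>2\<close> is a nondecreasing affine function of \<open>1 / q y x\<close>. Hence it is maximal
  for the boundary point nearest to \<open>x\<close>, where it gives the right-hand side. A positive solution on the ball is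
  represented by the Poisson kernels of the smaller balls of radius \<open>s < R\<close>; integrating the pointwise
  estimate and letting \<open>s\<close> tend to \<open>R\<close> yields the inequality. If equality holds at \<open>x\<close> in the direction
  \<open>e\<close>, the representing measures must concentrate at the boundary points whose kernel attains the bound in
  this direction, and there is only one such point.
\<close>

section \<open>Generalised trigonometric functions\<close>

text \<open>The hypersurface model lets one argument cover all signs of K: distances enter through
  squared chords, and derivatives, inner products and Laplacians become polynomials in K and these
  chords, times powers. The price is that for K = 0 the position vector is not orthogonal to the
  tangent space; identities involving it are stated after multiplication by K, where they hold for
  every K. The Poisson kernel is given only through the Dirichlet problem, so existence and
  uniqueness for that problem belong to the proof. For K < 0 and n > 2 the zero-order term has the
  wrong sign for the maximum principle; passing to the quotient by \<open>h\<close> removes it. The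
  normalising constant of the kernel is never evaluated: rotations and uniqueness show that the
  integral of the kernel is a multiple of \<open>h\<close>. No limit measure is formed in the case
  of equality. A bound f <= \<epsilon> + M \<psi> on a compact set, valid when f <= 0 wherever
  \<psi> = 0, controls the mass away from the extremal boundary point; the same bound yields the
  boundary values of the Poisson integral.\<close>

lemma sn_0 [simp]: "sn K 0 = 0" and cs_0 [simp]: "cs K 0 = 1"
  by (auto simp: sn_def cs_def)

lemma cs_sn_square: "(cs K r)\<^sup>2 + K * (sn K r)\<^sup>2 = 1"
proof -
  have "K < 0 \<Longrightarrow> (cosh (sqrt (-K) * r))\<^sup>2 = 1 + (sinh (sqrt (-K) * r))\<^sup>2"
    using cosh_square_eq[of "sqrt (-K) * r"] by simp
  then show ?thesis
    by (auto simp: sn_def cs_def power_divide)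
qed

lemma sn_add: "sn K (a + b) = sn K a * cs K b + cs K a * sn K b"
  by (auto simp: sn_def cs_def sin_add sinh_add distrib_left add_divide_distrib)

lemma cs_add: "cs K (a + b) = cs K a * cs K b - K * sn K a * sn K b"
proof -
  have "K < 0 \<Longrightarrow> K / (sqrt (-K) * sqrt (-K)) = -1"
    by (simp add: real_sqrt_mult_self)
  then show ?thesis
    by (auto simp: sn_def cs_def cos_add cosh_add distrib_left real_sqrt_mult_self)
qed

lemma sn_minus [simp]: "sn K (- a) = - sn K a" and cs_minus [simp]: "cs K (- a) = cs K a"
  by (auto simp: sn_def cs_def)

lemma sn_diff: "sn K (a - b) = sn K a * cs K b - cs K a * sn K b"
  using sn_add[of K a "-b"] by simp

lemma sn_half: "sn K r = 2 * sn K (r/2) * cs K (r/2)"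
  using sn_add[of K "r/2" "r/2"] by simp

lemma cs_half: "cs K r = 1 - 2 * K * (sn K (r/2))\<^sup>2"
  using cs_add[of K "r/2" "r/2"] cs_sn_square[of K "r/2"] by (simp add: power2_eq_square)

lemma has_derivative_sn [derivative_intros]:
  "(sn K has_real_derivative cs K r) (at r within S)"
proof -
  consider "K > 0" | "K = 0" | "K < 0" by linarith
  then show ?thesis
  proof cases
    case 1
    have "((\<lambda>r. sin (sqrt K * r) / sqrt K) has_real_derivative (cos (sqrt K * r) * sqrt K) / sqrt K) (at r within S)"
      by (rule DERIV_cdivide) (auto intro!: derivative_eq_intros)
    then show ?thesis using 1 by (simp add: sn_def[abs_def] cs_def)
  next
    case 3
    have "((\<lambda>r. sinh (sqrt (-K) * r) / sqrt (-K)) has_real_derivative (cosh (sqrt (-K) * r) * sqrt (-K)) / sqrt (-K)) (at r within S)"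
      by (rule DERIV_cdivide) (auto intro!: derivative_eq_intros)
    then show ?thesis using 3 by (simp add: sn_def[abs_def] cs_def)
  qed (simp add: sn_def[abs_def] cs_def)
qed

lemma has_derivative_cs [derivative_intros]:
  "(cs K has_real_derivative - K * sn K r) (at r within S)"
proof -
  have "K < 0 \<Longrightarrow> - (K / sqrt (-K)) = sqrt (-K)"
    using real_div_sqrt[of "-K"] by simp
  moreover have "K > 0 \<Longrightarrow> K / sqrt K = sqrt K"
    using real_div_sqrt[of K] by simp
  moreover have "K < 0 \<Longrightarrow> - (K * sinh (r * sqrt (-K)) / sqrt (-K)) = - (K / sqrt (-K)) * sinh (r * sqrt (-K))"
    by simp
  moreover have "K > 0 \<Longrightarrow> K * sin (r * sqrt K) / sqrt K = (K / sqrt K) * sin (r * sqrt K)"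
    by simp
  ultimately show ?thesis
    unfolding sn_def cs_def by (auto intro!: derivative_eq_intros simp: mult.commute)
qed

lemma continuous_on_sn [continuous_intros]:
  "continuous_on S f \<Longrightarrow> continuous_on S (\<lambda>x. sn K (f x))"
  by (metis DERIV_continuous_on continuous_on_compose2 has_derivative_sn subset_UNIV)

lemma continuous_on_cs [continuous_intros]:
  "continuous_on S f \<Longrightarrow> continuous_on S (\<lambda>x. cs K (f x))"
  by (metis DERIV_continuous_on continuous_on_compose2 has_derivative_cs subset_UNIV)

lemma sn_pos:
  assumes "0 < r" "K > 0 \<longrightarrow> r < pi / sqrt K"
  shows "sn K r > 0"
  using assms by (auto simp: sn_def field_simps intro!: sin_gt_zero)

lemma sn_nonneg:
  assumes "0 \<le> r" "K > 0 \<longrightarrow> r \<le> pi / sqrt K"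
  shows "sn K r \<ge> 0"
  using assms by (auto simp: sn_def field_simps intro!: sin_ge_zero)

lemma cs_half_pos:
  assumes "0 \<le> r" "K > 0 \<longrightarrow> r < pi / sqrt K"
  shows "cs K (r/2) > 0"
proof (cases "K > 0")
  case True
  have "0 \<le> sqrt K * r" using True assms by simp
  moreover have "sqrt K * r < pi" using True assms by (simp add: field_simps)
  ultimately have "cos (sqrt K * r / 2) > 0"
    by (intro cos_gt_zero_pi) auto
  then show ?thesis using True by (simp add: cs_def)
qed (auto simp: cs_def)

text \<open>The analogue of sin^2 b - sin^2 a = sin (b + a) sin (b - a). Up to a factor 4 it turns
  \<open>Q - chord2 K x p\<close> into the product of the two \<open>sn\<close> factors occurring in
  the gradient bound.\<close>

lemma sn_half_square_diff:
  "(sn K (b/2))\<^sup>2 - (sn K (a/2))\<^sup>2 = sn K ((b+a)/2) * sn K ((b-a)/2)"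
proof -
  have "sn K ((b+a)/2) * sn K ((b-a)/2)
      = (sn K (b/2))\<^sup>2 * (cs K (a/2))\<^sup>2 - (cs K (b/2))\<^sup>2 * (sn K (a/2))\<^sup>2"
    by (simp add: add_divide_distrib diff_divide_distrib sn_add sn_diff algebra_simps power2_eq_square)
  also have "\<dots> = (sn K (b/2))\<^sup>2 * (1 - K * (sn K (a/2))\<^sup>2) - (1 - K * (sn K (b/2))\<^sup>2) * (sn K (a/2))\<^sup>2"
    by (metis cs_sn_square add_diff_cancel_right')
  also have "\<dots> = (sn K (b/2))\<^sup>2 - (sn K (a/2))\<^sup>2" by (simp add: algebra_simps)
  finally show ?thesis by simp
qed

text \<open>For K > 0 the function \<open>sn K\<close> is not monotone up to pi / sqrt K, but its
  values at half the argument are: both factors in \<open>sn_half_square_diff\<close> have arguments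
  strictly between 0 and b. This lets squared chords replace distances.\<close>

lemma sn_half_square_less:
  assumes "0 \<le> a" "a < b" "K > 0 \<longrightarrow> b \<le> pi / sqrt K"
  shows "(sn K (a/2))\<^sup>2 < (sn K (b/2))\<^sup>2"
proof -
  have *: "(b+a)/2 < b" using assms by simp
  have "K > 0 \<longrightarrow> (b+a)/2 < pi / sqrt K" using * assms(3) by linarith
  then have "sn K ((b+a)/2) > 0" using assms by (intro sn_pos) auto
  moreover have "(b-a)/2 < b" using assms(1,2) by simp
  then have "K > 0 \<longrightarrow> (b-a)/2 < pi / sqrt K" using assms(3) by linarith
  then have "sn K ((b-a)/2) > 0" using assms(2) by (intro sn_pos) auto
  ultimately have "sn K ((b+a)/2) * sn K ((b-a)/2) > 0" by simp
  then show ?thesis using sn_half_square_diff[of K b a] by simp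
qed

section \<open>Tangent spaces\<close>

text \<open>The form whose level set 1 contains the hypersurface: K times \<open>riem K\<close> for
  K \<noteq> 0, and the product of the first components for K = 0. Its values on two points are
  \<open>cs K\<close> of their distance, and it stays meaningful where \<open>riem K\<close> divides
  by 0.\<close>

definition ip :: "real \<Rightarrow> real \<times> 'a::euclidean_space \<Rightarrow> real \<times> 'a \<Rightarrow> real" where
  "ip K x y = fst x * fst y + K * (snd x \<bullet> snd y)"

text \<open>Makes \<open>riem K\<close> a Euclidean inner product with a linear image of one
  argument, so that ambient gradients and Hessians can be written as vectors.\<close>

definition riem_dual :: "real \<Rightarrow> real \<times> 'a::euclidean_space \<Rightarrow> real \<times> 'a" where
  "riem_dual K v = (fst v / K, snd v)"

lemma riem_eq_inner: "riem K v w = riem_dual K v \<bullet> w"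
  by (simp add: riem_def riem_dual_def inner_prod_def)

lemma bounded_linear_riem_dual: "bounded_linear (riem_dual K)"
  unfolding riem_dual_def
  by (intro bounded_linear_Pair bounded_linear_snd)
     (use bounded_linear_compose[OF bounded_linear_divide[of K] bounded_linear_fst] in simp)

lemma bounded_bilinear_riem: "bounded_bilinear (riem K)"
proof -
  have "bounded_bilinear (\<lambda>v w. riem_dual K v \<bullet> w)"
    by (rule bounded_bilinear.comp1[OF bounded_bilinear_inner bounded_linear_riem_dual])
  then show ?thesis by (simp add: riem_eq_inner[symmetric])
qed

interpretation riem: bounded_bilinear "riem K" for K
  by (rule bounded_bilinear_riem)

lemma riem_sym: "riem K v w = riem K w v"
  by (simp add: riem_def inner_commute)

lemma riem_simps [simp]: "riem K (a *\<^sub>R v) w = a * riem K v w" "riem K v (a *\<^sub>R w) = a * riem K v w"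
  by (simp_all add: riem.scaleR_left riem.scaleR_right)

lemmas riem_algebra = riem.add_left riem.add_right riem.diff_left riem.diff_right

lemma ip_self: "x \<in> space_form K \<Longrightarrow> ip K x x = 1"
  by (auto simp: space_form_def ip_def power2_eq_square dot_square_norm)

lemma ip_eq_riem: "K \<noteq> 0 \<Longrightarrow> ip K v w = K * riem K v w"
  by (simp add: ip_def riem_def field_simps)

lemma tangent_iff: "v \<in> tangent K x \<longleftrightarrow> ip K x v = 0"
  by (simp add: tangent_def ip_def)

lemma fst_space_form_0: "x \<in> space_form 0 \<Longrightarrow> fst x = 1"
  by (auto simp: space_form_def power2_eq_1_iff)

lemma subspace_tangent: "subspace (tangent K x)"
  by (auto simp: subspace_def tangent_def inner_right_distrib algebra_simps)
     (metis (no_types, opaque_lifting) distrib_left mult.left_commute mult_zero_right)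

text \<open>The factor K makes the orthogonality of position vector and tangent space true also for
  K = 0, where the position vector itself need not be orthogonal. Later statements pairing a vector
  with the base point carry the same factor.\<close>

lemma K_riem_tangent: "x \<in> space_form K \<Longrightarrow> v \<in> tangent K x \<Longrightarrow> K * riem K x v = 0"
  by (metis ip_eq_riem mult_zero_left tangent_iff)

lemma fst_tangent_0: "x \<in> space_form 0 \<Longrightarrow> v \<in> tangent 0 x \<Longrightarrow> fst v = 0"
  using fst_space_form_0[of x] by (simp add: tangent_def)

lemma ip_tangent: "x \<in> space_form K \<Longrightarrow> v \<in> tangent K x \<Longrightarrow> w \<in> tangent K x \<Longrightarrow> ip K v w = K * riem K v w"
  by (cases "K = 0") (auto simp: ip_eq_riem, auto simp: ip_def dest: fst_tangent_0)

section \<open>Squared chords and tangential projection\<close>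

definition chord2 :: "real \<Rightarrow> real \<times> 'a::euclidean_space \<Rightarrow> real \<times> 'a \<Rightarrow> real" where
  "chord2 K x y = riem K (x - y) (x - y)"

lemma chord2_sym: "chord2 K x y = chord2 K y x"
  by (simp add: chord2_def riem_algebra)

lemma chord2_self [simp]: "chord2 K x x = 0"
  by (simp add: chord2_def riem.zero_left)

lemma K_chord2:
  assumes "x \<in> space_form K" "y \<in> space_form K"
  shows "K * chord2 K x y = 2 * (1 - ip K x y)"
proof (cases "K = 0")
  case True
  then show ?thesis using assms fst_space_form_0[of x] fst_space_form_0[of y] by (auto simp: ip_def)
next
  case False
  have "K * chord2 K x y = ip K (x - y) (x - y)"
    using False by (simp add: chord2_def ip_eq_riem)
  also have "\<dots> = ip K x x - 2 * ip K x y + ip K y y"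
    by (simp add: ip_def inner_diff_left inner_diff_right inner_commute algebra_simps)
  finally show ?thesis using assms by (simp add: ip_self)
qed

lemma K_riem_diff:
  assumes "x \<in> space_form K" "y \<in> space_form K"
  shows "K * riem K (x - y) x = K * chord2 K x y / 2"
proof (cases "K = 0")
  case False
  have "K * riem K (x - y) x = ip K x x - ip K x y"
    using False by (simp add: ip_eq_riem riem_algebra riem_sym[of K y x] algebra_simps)
  then show ?thesis using K_chord2[OF assms] assms by (simp add: ip_self)
qed auto

text \<open>For K \<noteq> 0 the orthogonal projection along the normal x, whose square is 1 / K;
  for K = 0 the coefficient makes it the identity. Applied to x - y it gives half the gradient of
  \<open>chord2 K _ y\<close> at x.\<close>

definition tproj :: "real \<Rightarrow> real \<times> 'a::euclidean_space \<Rightarrow> real \<times> 'a \<Rightarrow> real \<times> 'a" where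
  "tproj K x v = v - (K * riem K v x) *\<^sub>R x"

lemma tproj_tangent:
  assumes "x \<in> space_form K" "K = 0 \<longrightarrow> fst v = 0"
  shows "tproj K x v \<in> tangent K x"
proof (cases "K = 0")
  case True
  then show ?thesis using assms by (simp add: tproj_def tangent_def)
next
  case False
  have "ip K x (tproj K x v) = ip K x v - ip K v x * ip K x x"
    using False by (simp add: tproj_def ip_def ip_eq_riem[symmetric] inner_diff_right algebra_simps)
  then have "ip K x (tproj K x v) = ip K x v - ip K v x" by (simp add: ip_self[OF assms(1)])
  also have "\<dots> = 0" by (simp add: ip_def inner_commute mult.commute)
  finally show ?thesis by (simp add: tangent_iff)
qed

lemma riem_tproj:
  assumes "x \<in> space_form K" "e \<in> tangent K x"
  shows "riem K (tproj K x v) e = riem K v e"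
  using K_riem_tangent[OF assms] by (auto simp: tproj_def riem_algebra)

lemma riem_tproj_tproj:
  assumes "x \<in> space_form K"
  shows "riem K (tproj K x v) (tproj K x w) = riem K v w - K * riem K v x * riem K w x"
proof (cases "K = 0")
  case True
  then show ?thesis by (simp add: tproj_def)
next
  case False
  have "K * riem K x x = 1" using assms False by (metis ip_eq_riem ip_self)
  then have "K * (K * riem K v x * riem K w x * riem K x x) = K * (riem K v x * riem K w x)"
    by (metis mult.commute mult.left_commute mult_1)
  then show ?thesis
    by (simp add: tproj_def riem_algebra riem_sym[of K x w] algebra_simps)
qed

lemma tproj_diff:
  assumes "x \<in> space_form K" "y \<in> space_form K"
  shows "tproj K x (x - y) = (x - y) - (K * chord2 K x y / 2) *\<^sub>R x"
  by (simp add: tproj_def K_riem_diff[OF assms])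

lemma fst_diff_space_form: "x \<in> space_form K \<Longrightarrow> y \<in> space_form K \<Longrightarrow> K = 0 \<longrightarrow> fst (x - y) = 0"
  using fst_space_form_0[of x] fst_space_form_0[of y] by auto

text \<open>The law of cosines for gradients of squared chords: the first part is polarisation in
  the ambient space, the correction comes from the normal components, known up to the factor K from
  \<open>K_riem_diff\<close>. The Laplacians and the norm of the logarithmic gradient both rest on
  it.\<close>

lemma riem_tproj_diff_diff:
  assumes "x \<in> space_form K" "y \<in> space_form K" "z \<in> space_form K"
  shows "riem K (tproj K x (x - y)) (tproj K x (x - z))
    = (chord2 K x y + chord2 K x z - chord2 K y z) / 2 - K * chord2 K x y * chord2 K x z / 4"
proof -
  have 1: "riem K (x - y) (x - z) = (chord2 K x y + chord2 K x z - chord2 K y z) / 2"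
    by (simp add: chord2_def riem_algebra riem_sym[of K y x] riem_sym[of K z x] riem_sym[of K z y] field_simps)
  have 2: "K * riem K (x - y) x * riem K (x - z) x = K * chord2 K x y * chord2 K x z / 4"
  proof (cases "K = 0")
    case False
    have "K * riem K (x - y) x * (K * riem K (x - z) x) = (K * chord2 K x y / 2) * (K * chord2 K x z / 2)"
      by (simp only: K_riem_diff[OF assms(1,2)] K_riem_diff[OF assms(1,3)])
    then show ?thesis using False by (simp add: field_simps)
  qed auto
  show ?thesis by (simp add: riem_tproj_tproj[OF assms(1)] 1 2)
qed

text \<open>The map is parallel transport along the geodesic from (s, 0) to p: for K = 1 a rotation
  in the plane of these two points, for K = 0 the identity on second components. Since
  \<open>riem K\<close> is indefinite on the ambient space for K < 0, positivity, Cauchy-Schwarz and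
  orthonormal bases are pulled back from Euclidean space through it.\<close>

lemma ex_tangent_isometry:
  fixes p :: "real \<times> 'a::euclidean_space"
  assumes "p \<in> space_form K"
  shows "\<exists>L. tangent_isometry K p L"
proof -
  define t where "t = fst p"
  define x where "x = snd p"
  \<comment> \<open>the sign avoids the pole of the stereographic formula\<close>
  define s :: real where "s = (if t \<ge> 0 then 1 else -1)"
  have s2: "s * s = 1" by (simp add: s_def)
  have st: "1 + s * t > 0" by (simp add: s_def)
  have tx: "K * (x \<bullet> x) = 1 - t\<^sup>2"
    using assms by (auto simp: space_form_def t_def x_def dot_square_norm)
  have tx': "K * (x \<bullet> x) = (1 + s * t) * (1 - s * t)"
  proof -
    have "(1 + s * t) * (1 - s * t) = 1 - (s * s) * t\<^sup>2" by algebra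
    then show ?thesis using tx s2 by simp
  qed
  define \<beta> where "\<beta> = K / (1 + s * t)"
  have \<beta>x: "\<beta> * (x \<bullet> x) = 1 - s * t" using tx' st by (simp add: \<beta>_def)
  have \<beta>K: "\<beta> * (1 + s * t) = K" using st by (simp add: \<beta>_def)
  define L where "L v = (- s * K * (x \<bullet> v), v - (\<beta> * (x \<bullet> v)) *\<^sub>R x)" for v :: 'a
  have lin: "linear L"
    by (rule linearI) (auto simp: L_def inner_right_distrib algebra_simps)
  have tan: "L v \<in> tangent K p" for v
  proof -
    have "t * (- s * K * (x \<bullet> v)) + K * (x \<bullet> v - \<beta> * (x \<bullet> v) * (x \<bullet> x))
        = K * (x \<bullet> v) * (1 - s * t - \<beta> * (x \<bullet> x))" by (simp add: algebra_simps)
    also have "\<dots> = 0" using \<beta>x by simp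
    finally show ?thesis by (simp add: tangent_def L_def t_def[symmetric] x_def[symmetric] inner_diff_right)
  qed
  have surj: "\<exists>v. L v = w" if "w \<in> tangent K p" for w
  proof -
    define \<tau> where "\<tau> = fst w"
    define v where "v = snd w - (s * \<tau> / (1 + s * t)) *\<^sub>R x"
    have "t * \<tau> + K * (x \<bullet> snd w) = 0" using that by (simp add: tangent_def \<tau>_def t_def x_def)
    then have "K * (x \<bullet> v) = - t * \<tau> - (s * \<tau> / (1 + s * t)) * (K * (x \<bullet> x))"
      by (simp add: v_def inner_diff_right algebra_simps)
    also have "\<dots> = - t * \<tau> - s * \<tau> * (1 - s * t)" using tx' st by simp
    also have "\<dots> = - s * \<tau>" using s2 by (simp add: algebra_simps)
    finally have Kx: "K * (x \<bullet> v) = - s * \<tau>" .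
    have "\<beta> * (x \<bullet> v) = - (s * \<tau> / (1 + s * t))" using Kx by (simp add: \<beta>_def)
    then have "snd (L v) = snd w" by (simp add: L_def v_def)
    moreover have "fst (L v) = - s * (K * (x \<bullet> v))" by (simp add: L_def)
    then have "fst (L v) = s * s * \<tau>" unfolding Kx by simp
    then have "fst (L v) = fst w" using s2 by (simp add: \<tau>_def)
    ultimately show ?thesis by (intro exI[of _ v]) (simp add: prod_eq_iff)
  qed
  have iso: "riem K (L v) (L w) = v \<bullet> w" for v w
  proof -
    have "K * K * (x \<bullet> v) * (x \<bullet> w) / K = K * (x \<bullet> v) * (x \<bullet> w)" by (cases "K = 0") auto
    moreover have "s * K * (x \<bullet> v) * (s * K * (x \<bullet> w)) = s * s * (K * K * (x \<bullet> v) * (x \<bullet> w))" by algebra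
    ultimately have "riem K (L v) (L w) = K * (x \<bullet> v) * (x \<bullet> w) + (v \<bullet> w - 2 * \<beta> * (x \<bullet> v) * (x \<bullet> w) + \<beta> * (x \<bullet> v) * (x \<bullet> w) * (\<beta> * (x \<bullet> x)))"
      using s2 by (simp add: riem_def L_def inner_diff_left inner_diff_right inner_commute[of v x] algebra_simps)
    also have "\<dots> = v \<bullet> w + (x \<bullet> v) * (x \<bullet> w) * (K - \<beta> * (1 + s * t))" unfolding \<beta>x by (simp add: algebra_simps)
    finally show ?thesis using \<beta>K by simp
  qed
  have "tangent_isometry K p L"
    unfolding tangent_isometry_def using lin tan surj iso by (auto simp: image_iff set_eq_iff) metis
  then show ?thesis by blast
qed

lemma tangent_isometry_surj: "tangent_isometry K x L \<Longrightarrow> v \<in> tangent K x \<Longrightarrow> \<exists>w. v = L w"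
  unfolding tangent_isometry_def by (metis imageE)

lemma riem_pos:
  assumes "x \<in> space_form K" "v \<in> tangent K x" "v \<noteq> 0"
  shows "riem K v v > 0"
proof -
  obtain L where L: "tangent_isometry K x L" using ex_tangent_isometry[OF assms(1)] by blast
  then obtain w where w: "v = L w" using assms(2) tangent_isometry_surj by blast
  then have "w \<noteq> 0" using assms(3) L linear_0 by (auto simp: tangent_isometry_def)
  then show ?thesis using L w by (simp add: tangent_isometry_def)
qed

lemma riem_nonneg: "x \<in> space_form K \<Longrightarrow> v \<in> tangent K x \<Longrightarrow> riem K v v \<ge> 0"
  using riem_pos[of x K v] by (cases "v = 0") (auto simp: riem.zero_left)

lemma riem_Cauchy_Schwarz:
  assumes "x \<in> space_form K" "v \<in> tangent K x" "w \<in> tangent K x"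
  shows "(riem K v w)\<^sup>2 \<le> riem K v v * riem K w w"
proof -
  obtain L where L: "tangent_isometry K x L" using ex_tangent_isometry[OF assms(1)] by blast
  then obtain v' w' where w: "v = L v'" "w = L w'" using assms tangent_isometry_surj by meson
  then show ?thesis using L Cauchy_Schwarz_ineq[of v' w'] by (simp add: tangent_isometry_def)
qed

text \<open>For K < 0 an ambient vector with zero square may be nonzero. The tangential projection
  of x - y also has zero square, hence vanishes, and it differs from x - y by a multiple of the
  chord.\<close>

lemma chord2_eq_0_iff:
  assumes "x \<in> space_form K" "y \<in> space_form K"
  shows "chord2 K x y = 0 \<longleftrightarrow> x = y"
proof
  assume 0: "chord2 K x y = 0"
  have "riem K (tproj K x (x - y)) (tproj K x (x - y)) = 0"
    using riem_tproj_diff_diff[OF assms(1) assms(2) assms(2)] 0 by simp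
  then have "tproj K x (x - y) = 0"
    using riem_pos[OF assms(1) tproj_tangent[OF assms(1) fst_diff_space_form[OF assms]]] by force
  then show "x = y" using tproj_diff[OF assms] 0 by simp
qed simp

text \<open>Parseval's identity, by pulling the basis back to an orthonormal spanning set of
  Euclidean space; this also yields finiteness and the cardinality.\<close>

lemma orthonormal_basis_sum:
  fixes x :: "real \<times> 'a::euclidean_space"
  assumes "x \<in> space_form K" "orthonormal_basis K x B"
  shows "finite B" "card B = DIM('a)"
    "\<And>v w. v \<in> tangent K x \<Longrightarrow> w \<in> tangent K x \<Longrightarrow> (\<Sum>e\<in>B. riem K v e * riem K w e) = riem K v w"
proof -
  obtain L where L: "tangent_isometry K x L" using ex_tangent_isometry[OF assms(1)] by blast
  have lin: "linear L" and ran: "range L = tangent K x" and iso: "\<And>v w. riem K (L v) (L w) = v \<bullet> w"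
    using L by (auto simp: tangent_isometry_def)
  have inj: "inj L"
    using lin iso by (metis inner_eq_zero_iff linear_injective_0 riem.zero_left)
  define C where "C = L -` B"
  have Bt: "B \<subseteq> tangent K x" using assms(2) span_superset by (auto simp: orthonormal_basis_def)
  have BC: "B = L ` C" using Bt ran by (auto simp: C_def image_iff)
  have on: "b \<bullet> c = (if b = c then 1 else 0)" if "b \<in> C" "c \<in> C" for b c
    using assms(2) that iso[of b c] inj by (auto simp: orthonormal_basis_def C_def inj_eq)
  have "range L = L ` span C"
    using assms(2) ran span_linear_image[OF lin, of C] BC by (simp add: orthonormal_basis_def)
  then have spanC: "span C = UNIV" using inj by (metis inj_image_eq_iff)
  have orth: "pairwise orthogonal C" unfolding pairwise_def orthogonal_def using on by auto
  have "0 \<notin> C" using on[of 0 0] by auto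
  then have ind: "independent C" using orth pairwise_orthogonal_independent by blast
  have finC: "finite C" using ind by (rule independent_imp_finite)
  have "card C = DIM('a)" using ind spanC by (metis dim_UNIV dim_eq_card_independent dim_span)
  then show "finite B" "card B = DIM('a)" using BC finC inj by (auto simp: card_image inj_on_subset)
  fix v w assume "v \<in> tangent K x" "w \<in> tangent K x"
  then obtain v' w' where vw: "v = L v'" "w = L w'" using L tangent_isometry_surj by meson
  have n1: "norm b = 1" if "b \<in> C" for b using on[of b b] that by (simp add: norm_eq_1)
  have "(\<Sum>b\<in>C. (v' \<bullet> b) *\<^sub>R b) = v'"
    by (rule orthonormal_basis_expand[OF orth n1]) (use spanC finC in auto)
  then have "v' \<bullet> w' = (\<Sum>b\<in>C. (v' \<bullet> b) *\<^sub>R b) \<bullet> w'" by simp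
  also have "\<dots> = (\<Sum>b\<in>C. (v' \<bullet> b) * (w' \<bullet> b))" by (simp only: inner_sum_left inner_scaleR_left inner_commute[of w'])
  finally have "v' \<bullet> w' = (\<Sum>b\<in>C. (v' \<bullet> b) * (w' \<bullet> b))" .
  moreover have "(\<Sum>e\<in>B. riem K v e * riem K w e) = (\<Sum>b\<in>C. (v' \<bullet> b) * (w' \<bullet> b))"
    unfolding BC vw using inj by (subst sum.reindex) (auto simp: iso intro: inj_on_subset)
  ultimately show "(\<Sum>e\<in>B. riem K v e * riem K w e) = riem K v w" by (simp add: vw iso)
qed

lemma ex_orthonormal_basis:
  assumes "x \<in> space_form K"
  shows "\<exists>B. orthonormal_basis K x B"
proof -
  obtain L where L: "tangent_isometry K x L" using ex_tangent_isometry[OF assms(1)] by blast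
  then have "inj L"
    by (metis inner_eq_zero_iff linear_injective_0 riem.zero_left tangent_isometry_def)
  with L have "orthonormal_basis K x (L ` Basis)"
    by (auto simp: tangent_isometry_def orthonormal_basis_def span_linear_image inner_Basis inj_eq)
  then show ?thesis ..
qed

section \<open>Unit speed geodesics\<close>

definition geo :: "real \<Rightarrow> real \<times> 'a::euclidean_space \<Rightarrow> real \<times> 'a \<Rightarrow> real \<Rightarrow> real \<times> 'a" where
  "geo K x e s = cs K s *\<^sub>R x + sn K s *\<^sub>R e"

lemma geo_0 [simp]: "geo K x e 0 = x"
  by (simp add: geo_def)

lemma has_vector_derivative_geo:
  "(geo K x e has_vector_derivative (- K * sn K s) *\<^sub>R x + cs K s *\<^sub>R e) (at s within S)"
  unfolding geo_def[abs_def] by (auto intro!: derivative_eq_intros)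

lemma continuous_on_geo: "continuous_on S (geo K x e)"
  unfolding geo_def[abs_def] by (intro continuous_intros)

lemma geo_in_space_form:
  fixes x :: "real \<times> 'a::euclidean_space"
  assumes x: "x \<in> space_form K" and e: "e \<in> tangent K x" "riem K e e = 1"
  shows "geo K x e s \<in> space_form K"
proof -
  define t y \<tau> w where "t = fst x" "y = snd x" "\<tau> = fst e" "w = snd e"
  note defs = this
  have xx: "t\<^sup>2 + K * (y \<bullet> y) = 1" using ip_self[OF x] by (simp add: ip_def defs power2_eq_square)
  have xe: "t * \<tau> + K * (y \<bullet> w) = 0" using e(1) by (simp add: tangent_iff ip_def defs)
  have ee: "\<tau>\<^sup>2 + K * (w \<bullet> w) = K"
    using ip_tangent[OF x e(1) e(1)] e(2) by (simp add: ip_def defs power2_eq_square)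
  let ?c = "cs K s" and ?s = "sn K s"
  have "(?c * t + ?s * \<tau>)\<^sup>2 + K * ((?c *\<^sub>R y + ?s *\<^sub>R w) \<bullet> (?c *\<^sub>R y + ?s *\<^sub>R w))
     = ?c\<^sup>2 * (t\<^sup>2 + K * (y \<bullet> y)) + 2 * ?c * ?s * (t * \<tau> + K * (y \<bullet> w)) + ?s\<^sup>2 * (\<tau>\<^sup>2 + K * (w \<bullet> w))"
    by (simp add: inner_add_left inner_add_right inner_commute[of w y] power2_eq_square algebra_simps)
  also have "\<dots> = 1" unfolding xx xe ee using cs_sn_square[of K s] by (simp add: mult.commute)
  finally have 1: "(?c * t + ?s * \<tau>)\<^sup>2 + K * ((?c *\<^sub>R y + ?s *\<^sub>R w) \<bullet> (?c *\<^sub>R y + ?s *\<^sub>R w)) = 1" .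
  have 2: "?c * t + ?s * \<tau> > 0" if "K \<le> 0"
  proof (cases "K = 0")
    case True
    then show ?thesis using fst_space_form_0[of x] fst_tangent_0[of x e] x e by (simp add: cs_def defs)
  next
    case False
    then have K: "K < 0" using that by simp
    have t: "t > 0" using x K by (auto simp: space_form_def defs)
    have cpos: "?c > 0" using K by (simp add: cs_def)
    \<comment> \<open>Cauchy-Schwarz for the second components bounds the first component of e by
      \<open>\<tau>^2 <= - K * (t^2 - 1)\<close>. This keeps the curve from crossing to the lower
      sheet.\<close>
    have "(K * (y \<bullet> w))\<^sup>2 \<le> (K * (y \<bullet> y)) * (K * (w \<bullet> w))"
    proof -
      have "K\<^sup>2 * (y \<bullet> w)\<^sup>2 \<le> K\<^sup>2 * ((y \<bullet> y) * (w \<bullet> w))"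
        by (intro mult_left_mono Cauchy_Schwarz_ineq) simp
      then show ?thesis by (simp add: power2_eq_square algebra_simps)
    qed
    also have "\<dots> = (1 - t\<^sup>2) * (K - \<tau>\<^sup>2)"
    proof -
      have "K * (y \<bullet> y) = 1 - t\<^sup>2" "K * (w \<bullet> w) = K - \<tau>\<^sup>2" using xx ee by linarith+
      then show ?thesis by simp
    qed
    finally have "(t * \<tau>)\<^sup>2 \<le> (1 - t\<^sup>2) * (K - \<tau>\<^sup>2)" using xe
      by (metis add_eq_0_iff power2_minus)
    then have "\<tau>\<^sup>2 \<le> - K * t\<^sup>2 + K" by (simp add: algebra_simps power_mult_distrib)
    then have "\<tau>\<^sup>2 * ?s\<^sup>2 \<le> (- K * t\<^sup>2 + K) * ?s\<^sup>2" by (intro mult_right_mono) auto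
    also have "\<dots> = t\<^sup>2 * (- K * ?s\<^sup>2) + K * ?s\<^sup>2" by (simp add: algebra_simps)
    also have "\<dots> \<le> t\<^sup>2 * (- K * ?s\<^sup>2)" using K by (simp add: mult_le_0_iff)
    also have "\<dots> = t\<^sup>2 * ?c\<^sup>2 - t\<^sup>2"
    proof -
      have "- K * ?s\<^sup>2 = ?c\<^sup>2 - 1" using cs_sn_square[of K s] by simp
      then show ?thesis by (simp only: right_diff_distrib mult_1_right)
    qed
    also have "\<dots> < t\<^sup>2 * ?c\<^sup>2" using t by simp
    finally have "(?s * \<tau>)\<^sup>2 < (?c * t)\<^sup>2" by (simp add: power_mult_distrib mult.commute)
    moreover have "0 \<le> ?c * t" using cpos t by simp
    ultimately have "\<bar>?s * \<tau>\<bar> < ?c * t" by (metis power2_abs power2_less_imp_less)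
    then show ?thesis by linarith
  qed
  show ?thesis using 1 2
    by (simp add: space_form_def geo_def defs split_beta dot_square_norm)
qed

section \<open>Gradient and Laplacian in ambient coordinates\<close>

text \<open>Within a hypersurface a Frechet derivative is not unique, so
  \<open>frechet_derivative\<close> is an arbitrary choice in the normal direction. Composing with a
  geodesic that stays in the hypersurface gives an ordinary derivative of one variable, whose
  uniqueness identifies the two on unit tangent vectors, and scaling does the rest.\<close>

lemma deriv_along_eq:
  fixes f :: "real \<times> 'a::euclidean_space \<Rightarrow> 'b::real_normed_vector"
  assumes f: "(f has_derivative f') (at x within space_form K)"
    and x: "x \<in> space_form K" and v: "v \<in> tangent K x"
  shows "deriv_along K f x v = f' v"
proof -
  define D where "D = frechet_derivative f (at x within space_form K)"
  have D: "(f has_derivative D) (at x within space_form K)"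
    unfolding D_def using f frechet_derivative_works differentiableI by blast
  have unit: "D e = f' e" if e: "e \<in> tangent K x" "riem K e e = 1" for e
  proof -
    have "(geo K x e has_derivative (\<lambda>h. h *\<^sub>R e)) (at 0)"
      using has_vector_derivative_geo[of K x e 0 UNIV] by (simp add: has_vector_derivative_def)
    moreover have "range (geo K x e) \<subseteq> space_form K" using geo_in_space_form[OF x e] by auto
    ultimately have "((\<lambda>s. f (geo K x e s)) has_derivative (\<lambda>h. g (h *\<^sub>R e))) (at 0)"
      if "(f has_derivative g) (at x within space_form K)" for g
      using has_derivative_in_compose[of "geo K x e" _ 0 UNIV f g] has_derivative_subset[OF that] by simp
    from has_derivative_unique[OF this[OF D] this[OF f]] show ?thesis
      by (metis scaleR_one)
  qed
  interpret D: bounded_linear D using D by (rule has_derivative_bounded_linear)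
  interpret f': bounded_linear f' using f by (rule has_derivative_bounded_linear)
  show ?thesis
  proof (cases "v = 0")
    case False
    define r where "r = sqrt (riem K v v)"
    have r: "r > 0" "r * r = riem K v v" using riem_pos[OF x v False] by (auto simp: r_def)
    have "(1 / r) *\<^sub>R v \<in> tangent K x" using v subspace_scale subspace_tangent by blast
    moreover have "riem K ((1 / r) *\<^sub>R v) ((1 / r) *\<^sub>R v) = 1" using r(1) by (simp add: r(2)[symmetric])
    ultimately have "D ((1 / r) *\<^sub>R v) = f' ((1 / r) *\<^sub>R v)" by (rule unit)
    then have "D v = f' v" using r by (simp add: D.scaleR f'.scaleR)
    then show ?thesis by (simp add: deriv_along_def D_def)
  qed (simp add: deriv_along_def D_def[symmetric] D.zero f'.zero)
qed

lemma grad_eqI: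
  assumes f: "(f has_derivative f') (at x within space_form K)" and x: "x \<in> space_form K"
    and w: "w \<in> tangent K x" "\<And>v. v \<in> tangent K x \<Longrightarrow> riem K w v = f' v"
  shows "grad K f x = w"
  unfolding grad_def
proof (rule the_equality)
  show "w \<in> tangent K x \<and> (\<forall>v\<in>tangent K x. riem K w v = deriv_along K f x v)"
    using w deriv_along_eq[OF f x] by simp
  fix w' assume w': "w' \<in> tangent K x \<and> (\<forall>v\<in>tangent K x. riem K w' v = deriv_along K f x v)"
  have d: "w' - w \<in> tangent K x" using w w' subspace_tangent subspace_diff by blast
  then have "riem K (w' - w) (w' - w) = 0" using w w' deriv_along_eq[OF f x] by (simp add: riem.diff_left)
  then show "w' = w" using riem_pos[OF x d] by force
qed

lemma grad_works:
  fixes x :: "real \<times> 'a::euclidean_space"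
  assumes f: "(f has_derivative f') (at x within space_form K)" and x: "x \<in> space_form K"
  shows "grad K f x \<in> tangent K x" "\<And>v. v \<in> tangent K x \<Longrightarrow> riem K (grad K f x) v = f' v"
proof -
  interpret f': bounded_linear f' using f by (rule has_derivative_bounded_linear)
  obtain L where L: "tangent_isometry K x L" using ex_tangent_isometry[OF x] by blast
  then have lin: "linear L" by (simp add: tangent_isometry_def)
  define a where "a = (\<Sum>b\<in>Basis. f' (L b) *\<^sub>R b)"
  have "L a \<in> tangent K x" using L by (auto simp: tangent_isometry_def)
  moreover have "riem K (L a) v = f' v" if v: "v \<in> tangent K x" for v
  proof -
    obtain w where w: "v = L w" using tangent_isometry_surj[OF L v] by blast
    have "riem K (L a) v = a \<bullet> w" using L w by (simp add: tangent_isometry_def)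
    also have "\<dots> = (\<Sum>b\<in>Basis. (w \<bullet> b) * f' (L b))"
      unfolding a_def inner_sum_left inner_scaleR_left
      by (intro sum.cong refl) (simp add: inner_commute)
    also have "\<dots> = f' (L (\<Sum>b\<in>Basis. (w \<bullet> b) *\<^sub>R b))"
      using lin by (simp add: linear_sum linear_scale f'.sum f'.scaleR del: euclidean_representation)
    finally show ?thesis by (simp add: euclidean_representation w)
  qed
  ultimately show "grad K f x \<in> tangent K x" "\<And>v. v \<in> tangent K x \<Longrightarrow> riem K (grad K f x) v = f' v"
    using grad_eqI[OF f x, of "L a"] by auto
qed

lemma unit_tangent:
  assumes x: "x \<in> space_form K" and v: "v \<in> tangent K x" "v \<noteq> 0"
  shows "(1 / riem_norm K v) *\<^sub>R v \<in> tangent K x"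
    "riem K ((1 / riem_norm K v) *\<^sub>R v) ((1 / riem_norm K v) *\<^sub>R v) = 1" "riem_norm K v > 0"
proof -
  have r: "riem_norm K v > 0" "riem_norm K v * riem_norm K v = riem K v v"
    using riem_pos[OF x v] by (auto simp: riem_norm_def)
  then show "riem_norm K v > 0" "riem K ((1 / riem_norm K v) *\<^sub>R v) ((1 / riem_norm K v) *\<^sub>R v) = 1"
    by (auto simp: field_simps)
  show "(1 / riem_norm K v) *\<^sub>R v \<in> tangent K x" using v subspace_scale subspace_tangent by blast
qed

text \<open>The normalised gradient is the extremal direction. Bounds for the norm of a gradient,
  and the case of equality, thereby become statements about a single directional derivative.\<close>

lemma riem_norm_grad_attained:
  assumes f: "(f has_derivative f') (at x within space_form K)" and x: "x \<in> space_form K"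
    and "riem_norm K (grad K f x) > 0"
  shows "\<exists>e \<in> tangent K x. riem K e e = 1 \<and> f' e = riem_norm K (grad K f x)"
proof -
  let ?g = "grad K f x"
  have g: "?g \<in> tangent K x" "?g \<noteq> 0"
    using grad_works(1)[OF f x] assms(3) by (auto simp: riem_norm_def riem.zero_left)
  note u = unit_tangent[OF x g]
  have "riem K ?g ?g = riem_norm K ?g * riem_norm K ?g"
    using riem_pos[OF x g] by (simp add: riem_norm_def)
  moreover have "f' ((1 / riem_norm K ?g) *\<^sub>R ?g) = riem K ?g ((1 / riem_norm K ?g) *\<^sub>R ?g)"
    using grad_works(2)[OF f x u(1)] by simp
  ultimately have "f' ((1 / riem_norm K ?g) *\<^sub>R ?g) = riem_norm K ?g"
    using u(3) by simp
  then show ?thesis using u by blast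
qed

lemma riem_norm_grad_le:
  assumes f: "(f has_derivative f') (at x within space_form K)" and x: "x \<in> space_form K"
    and b: "b \<ge> 0" "\<And>e. e \<in> tangent K x \<Longrightarrow> riem K e e = 1 \<Longrightarrow> f' e \<le> b"
  shows "riem_norm K (grad K f x) \<le> b"
  using riem_norm_grad_attained[OF f x] b by fastforce

lemma riem_norm_grad_ge:
  assumes f: "(f has_derivative f') (at x within space_form K)" and x: "x \<in> space_form K"
    and e: "e \<in> tangent K x" "riem K e e = 1"
  shows "f' e \<le> riem_norm K (grad K f x)"
proof -
  have "(riem K (grad K f x) e)\<^sup>2 \<le> riem K (grad K f x) (grad K f x)"
    using riem_Cauchy_Schwarz[OF x grad_works(1)[OF f x] e(1)] e(2) by simp
  then show ?thesis using grad_works(2)[OF f x e(1)] by (simp add: riem_norm_def real_le_rsqrt)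
qed

section \<open>Second-order jets and the Laplacian\<close>

text \<open>A \<open>C\<^sup>2\<close> extension to the ambient space, with its first and second derivatives at the point.\<close>

definition has_jet :: "real \<Rightarrow> (real \<times> 'a::euclidean_space \<Rightarrow> real) \<Rightarrow> real \<times> 'a
    \<Rightarrow> (real \<times> 'a \<Rightarrow> real) \<Rightarrow> (real \<times> 'a \<Rightarrow> real \<times> 'a \<Rightarrow> real) \<Rightarrow> bool" where
  "has_jet K f x D D2 \<longleftrightarrow> (\<exists>U F (F' :: real \<times> 'a \<Rightarrow> (real \<times> 'a) \<Rightarrow>\<^sub>L real) F''. open U \<and> x \<in> U \<and>
     (\<forall>y \<in> U. (F has_derivative blinfun_apply (F' y)) (at y)) \<and>
     (\<forall>y \<in> U. (F' has_derivative blinfun_apply (F'' y)) (at y)) \<and>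
     continuous_on U F'' \<and> (\<forall>y \<in> U \<inter> space_form K. F y = f y) \<and>
     D = blinfun_apply (F' x) \<and> D2 = (\<lambda>v. blinfun_apply (blinfun_apply (F'' x) v)))"

text \<open>An extension for \<open>C2_on\<close> agrees with f only inside V, a jet asks for
  agreement on the whole hypersurface near the point; intersecting the neighbourhood with the open
  set V reconciles the two.\<close>

lemma C2_on_iff_has_jet:
  assumes "open V"
  shows "C2_on (space_form K \<inter> V) f \<longleftrightarrow> (\<forall>x \<in> space_form K \<inter> V. \<exists>D D2. has_jet K f x D D2)"
proof
  assume *: "C2_on (space_form K \<inter> V) f"
  show "\<forall>x \<in> space_form K \<inter> V. \<exists>D D2. has_jet K f x D D2"
  proof
    fix x assume x: "x \<in> space_form K \<inter> V"
    obtain U F where U: "open U" "x \<in> U" "C2_on_open U F" "\<forall>y \<in> U \<inter> (space_form K \<inter> V). F y = f y"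
      using * x unfolding C2_on_def by blast
    then obtain F' F'' where F: "\<forall>y \<in> U. (F has_derivative blinfun_apply (F' y)) (at y)"
     "\<forall>y \<in> U. (F' has_derivative blinfun_apply (F'' y)) (at y)" "continuous_on U F''"
      unfolding C2_on_open_def by blast
    have "has_jet K f x (F' x) (\<lambda>v. blinfun_apply (blinfun_apply (F'' x) v))"
      unfolding has_jet_def using U F x assms
      by (intro exI[of _ "U \<inter> V"] exI[of _ F] exI[of _ F'] exI[of _ F''])
        (auto intro: continuous_on_subset)
    then show "\<exists>D D2. has_jet K f x D D2" by blast
  qed
next
  assume *: "\<forall>x \<in> space_form K \<inter> V. \<exists>D D2. has_jet K f x D D2"
  show "C2_on (space_form K \<inter> V) f" unfolding C2_on_def
  proof
    fix x assume x: "x \<in> space_form K \<inter> V"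
    then obtain D D2 where "has_jet K f x D D2" using * by blast
    then show "\<exists>U F. open U \<and> x \<in> U \<and> C2_on_open U F \<and> (\<forall>y\<in>U \<inter> (space_form K \<inter> V). F y = f y)"
      unfolding has_jet_def C2_on_open_def by (elim exE) blast
  qed
qed

lemma has_jet_cong:
  assumes "has_jet K f x D D2" "open V" "x \<in> V" "\<And>y. y \<in> space_form K \<inter> V \<Longrightarrow> f y = g y"
  shows "has_jet K g x D D2"
proof -
  obtain U F and F' :: "real \<times> 'a \<Rightarrow> (real \<times> 'a) \<Rightarrow>\<^sub>L real" and F'' where U: "open U" "x \<in> U"
     "\<forall>y \<in> U. (F has_derivative blinfun_apply (F' y)) (at y)"
     "\<forall>y \<in> U. (F' has_derivative blinfun_apply (F'' y)) (at y)"
     "continuous_on U F''" "\<forall>y \<in> U \<inter> space_form K. F y = f y"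
     "D = blinfun_apply (F' x)" "D2 = (\<lambda>v. blinfun_apply (blinfun_apply (F'' x) v))"
    using assms(1) unfolding has_jet_def by blast
  then show ?thesis unfolding has_jet_def using assms
    by (intro exI[of _ "U \<inter> V"] exI[of _ F] exI[of _ F'] exI[of _ F''])
       (auto intro: continuous_on_subset)
qed

lemma has_jet_lincomb:
  assumes "has_jet K f x D D2" "has_jet K g x E E2"
  shows "has_jet K (\<lambda>y. a * f y + b * g y) x (\<lambda>v. a * D v + b * E v) (\<lambda>v w. a * D2 v w + b * E2 v w)"
proof -
  obtain U F and F' :: "real \<times> 'a \<Rightarrow> (real \<times> 'a) \<Rightarrow>\<^sub>L real" and F'' where U: "open U" "x \<in> U"
     "\<forall>y \<in> U. (F has_derivative blinfun_apply (F' y)) (at y)"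
     "\<forall>y \<in> U. (F' has_derivative blinfun_apply (F'' y)) (at y)"
     "continuous_on U F''" "\<forall>y \<in> U \<inter> space_form K. F y = f y"
     "D = blinfun_apply (F' x)" "D2 = (\<lambda>v. blinfun_apply (blinfun_apply (F'' x) v))"
    using assms(1) unfolding has_jet_def by blast
  obtain V G and G' :: "real \<times> 'a \<Rightarrow> (real \<times> 'a) \<Rightarrow>\<^sub>L real" and G'' where V: "open V" "x \<in> V"
     "\<forall>y \<in> V. (G has_derivative blinfun_apply (G' y)) (at y)"
     "\<forall>y \<in> V. (G' has_derivative blinfun_apply (G'' y)) (at y)"
     "continuous_on V G''" "\<forall>y \<in> V \<inter> space_form K. G y = g y"
     "E = blinfun_apply (G' x)" "E2 = (\<lambda>v. blinfun_apply (blinfun_apply (G'' x) v))"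
    using assms(2) unfolding has_jet_def by blast
  show ?thesis unfolding has_jet_def
  proof (intro exI[of _ "U \<inter> V"] exI[of _ "\<lambda>y. a * F y + b * G y"]
      exI[of _ "\<lambda>y. a *\<^sub>R F' y + b *\<^sub>R G' y"] exI[of _ "\<lambda>y. a *\<^sub>R F'' y + b *\<^sub>R G'' y"] conjI ballI)
    fix y assume y: "y \<in> U \<inter> V"
    have "((\<lambda>y. a * F y + b * G y) has_derivative (\<lambda>h. a * F' y h + b * G' y h)) (at y)"
      using U V y by (intro has_derivative_add has_derivative_mult_right) auto
    then show "((\<lambda>y. a * F y + b * G y) has_derivative (a *\<^sub>R F' y + b *\<^sub>R G' y)) (at y)"
      by (rule has_derivative_eq_rhs) (simp add: blinfun.add_left blinfun.scaleR_left fun_eq_iff)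
    have "((\<lambda>y. a *\<^sub>R F' y + b *\<^sub>R G' y) has_derivative (\<lambda>h. a *\<^sub>R F'' y h + b *\<^sub>R G'' y h)) (at y)"
      using U V y by (intro has_derivative_add has_derivative_scaleR_right) auto
    then show "((\<lambda>y. a *\<^sub>R F' y + b *\<^sub>R G' y) has_derivative (a *\<^sub>R F'' y + b *\<^sub>R G'' y)) (at y)"
      by (rule has_derivative_eq_rhs) (simp add: blinfun.add_left blinfun.scaleR_left fun_eq_iff)
  qed (use U V in \<open>auto simp: blinfun.add_left blinfun.scaleR_left fun_eq_iff
        intro!: continuous_intros intro: continuous_on_subset\<close>)
qed

text \<open>Takes gradient and Hessian as vectors for the Euclidean inner product; by finite
  dimension, continuity of the Hessian on basis vectors suffices.\<close>

lemma has_jetI: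
  fixes x :: "real \<times> 'a::euclidean_space"
  assumes U: "open U" "x \<in> U" and F: "\<And>y. y \<in> U \<Longrightarrow> (F has_derivative (\<lambda>h. G y \<bullet> h)) (at y)"
    and G: "\<And>y. y \<in> U \<Longrightarrow> (G has_derivative H y) (at y)"
    and H: "\<And>b. b \<in> Basis \<Longrightarrow> continuous_on U (\<lambda>y. H y b)"
    and f: "\<And>y. y \<in> U \<Longrightarrow> y \<in> space_form K \<Longrightarrow> F y = f y"
  shows "has_jet K f x (\<lambda>h. G x \<bullet> h) (\<lambda>v w. H x v \<bullet> w)"
proof -
  have bl: "bounded_linear (\<lambda>h. blinfun_inner_right (H y h))" if "y \<in> U" for y
    by (rule bounded_linear_compose[OF bounded_linear_blinfun_inner_right
          has_derivative_bounded_linear[OF G[OF that]]])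
  define F'' where "F'' y = Blinfun (\<lambda>h. blinfun_inner_right (H y h))" for y
  have F'': "blinfun_apply (F'' y) = (\<lambda>h. blinfun_inner_right (H y h))" if "y \<in> U" for y
    unfolding F''_def by (rule bounded_linear_Blinfun_apply[OF bl[OF that]])
  show ?thesis unfolding has_jet_def
  proof (intro exI[of _ U] exI[of _ F] exI[of _ "\<lambda>y. blinfun_inner_right (G y)"] exI[of _ F''] conjI ballI)
    show "continuous_on U F''"
    proof (rule continuous_on_blinfun_componentwise)
      fix b :: "real \<times> 'a" assume b: "b \<in> Basis"
      have "continuous_on U (\<lambda>y. blinfun_inner_right (H y b))"
        by (intro bounded_linear.continuous_on[OF bounded_linear_blinfun_inner_right] H b)
      then show "continuous_on U (\<lambda>y. blinfun_apply (F'' y) b)"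
        by (rule continuous_on_eq) (simp add: F'')
    qed
    show "((\<lambda>y. blinfun_inner_right (G y)) has_derivative blinfun_apply (F'' y)) (at y)" if "y \<in> U" for y
      unfolding F''[OF that]
      by (rule bounded_linear.has_derivative[OF bounded_linear_blinfun_inner_right G[OF that]])
  qed (use U F f in \<open>auto simp: F''\<close>)
qed

lemma has_jet_derivative:
  assumes "has_jet K f x D D2" "x \<in> space_form K"
  shows "(f has_derivative D) (at x within space_form K)"
proof -
  obtain U F and F' :: "real \<times> 'a \<Rightarrow> (real \<times> 'a) \<Rightarrow>\<^sub>L real" where U: "open U" "x \<in> U"
     "\<forall>y \<in> U. (F has_derivative blinfun_apply (F' y)) (at y)"
     "\<forall>y \<in> U \<inter> space_form K. F y = f y" "D = blinfun_apply (F' x)"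
    using assms(1) unfolding has_jet_def by blast
  obtain d where d: "d > 0" "ball x d \<subseteq> U" using U by (meson open_contains_ball)
  have "(F has_derivative D) (at x within space_form K)" using U has_derivative_at_withinI by blast
  then show ?thesis
    by (rule has_derivative_transform_within[OF _ d(1) assms(2)]) (use d U in \<open>auto simp: dist_commute\<close>)
qed

text \<open>The last term is the mean curvature correction: a unit speed geodesic through x has
  acceleration - K x, so each of the n tangent directions contributes \<open>- K * D x\<close>
  beyond the ambient second derivative.\<close>

lemma laplace_beltrami_has_jet:
  fixes x :: "real \<times> 'a::euclidean_space"
  assumes jet: "has_jet K f x D D2" and x: "x \<in> space_form K"
  shows "laplace_beltrami K f x
    = (\<Sum>e \<in> (SOME B. orthonormal_basis K x B). D2 e e) - real DIM('a) * K * D x"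
proof -
  let ?M = "space_form K :: (real \<times> 'a) set"
  obtain U F and F' :: "real \<times> 'a \<Rightarrow> (real \<times> 'a) \<Rightarrow>\<^sub>L real" and F'' where U: "open U" "x \<in> U"
     "\<forall>y \<in> U. (F has_derivative blinfun_apply (F' y)) (at y)"
     "\<forall>y \<in> U. (F' has_derivative blinfun_apply (F'' y)) (at y)"
     "\<forall>y \<in> U \<inter> ?M. F y = f y"
     "D = blinfun_apply (F' x)" "D2 = (\<lambda>v. blinfun_apply (blinfun_apply (F'' x) v))"
    using jet unfolding has_jet_def by blast
  obtain d where d: "d > 0" "ball x d \<subseteq> U" using U by (meson open_contains_ball)
  \<comment> \<open>The tangential projection of the ambient gradient with respect to
    \<open>riem K\<close>; the factor K on the first component undoes the division by K. The formula
    makes sense off the hypersurface and can be differentiated there.\<close>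
  define W where "W y = (K * F' y (1, 0), \<Sum>b\<in>Basis. F' y (0, b) *\<^sub>R b) - (K * F' y y) *\<^sub>R y" for y
  have F'rep: "F' y v = F' y (1, 0) * fst v + (\<Sum>b\<in>Basis. F' y (0, b) * (snd v \<bullet> b))" for y v
  proof -
    have "v = fst v *\<^sub>R (1, 0) + (\<Sum>b\<in>Basis. (snd v \<bullet> b) *\<^sub>R (0, b))"
      by (simp add: prod_eq_iff fst_sum snd_sum euclidean_representation)
    then have "F' y v = F' y (fst v *\<^sub>R (1, 0) + (\<Sum>b\<in>Basis. (snd v \<bullet> b) *\<^sub>R (0, b)))" by simp
    also have "\<dots> = fst v * F' y (1, 0) + (\<Sum>b\<in>Basis. (snd v \<bullet> b) * F' y (0, b))"
      by (simp add: blinfun.add_right blinfun.scaleR_right blinfun.sum_right del: scaleR_Pair)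
    finally show ?thesis by (simp add: mult.commute)
  qed
  have ambient: "riem K (K * F' y (1, 0), \<Sum>b\<in>Basis. F' y (0, b) *\<^sub>R b) v = F' y v"
    if "K = 0 \<longrightarrow> fst v = 0" for y v
    using that unfolding F'rep[of y v] by (auto simp: riem_def inner_sum_left inner_commute[of "snd v"])
  have grad: "grad K f y = W y" if y: "y \<in> U" "y \<in> ?M" for y
  proof -
    obtain d where d: "d > 0" "ball y d \<subseteq> U" using U y by (meson open_contains_ball)
    have "(F has_derivative F' y) (at y within ?M)" using U y has_derivative_at_withinI by blast
    then have f: "(f has_derivative F' y) (at y within ?M)"
      by (rule has_derivative_transform_within[OF _ d(1) y(2)]) (use d U in \<open>auto simp: dist_commute\<close>)
    show ?thesis
    proof (rule grad_eqI[OF f y(2)])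
      let ?A = "(K * F' y (1, 0), \<Sum>b\<in>Basis. F' y (0, b) *\<^sub>R b)"
      have "K * riem K ?A y = K * F' y y" by (cases "K = 0") (simp_all add: ambient)
      then have "W y = tproj K y ?A" by (simp only: W_def tproj_def)
      then show "W y \<in> tangent K y" using tproj_tangent[OF y(2), of ?A] by simp
      fix v assume v: "v \<in> tangent K y"
      have "riem K (W y) v = riem K ?A v"
        using K_riem_tangent[OF y(2) v] by (auto simp: W_def riem.diff_left)
      also have "\<dots> = F' y v" using fst_tangent_0[of y v] y v by (intro ambient) auto
      finally show "riem K (W y) v = F' y v" .
    qed
  qed
  define W' where "W' h = (K * F'' x h (1, 0), \<Sum>b\<in>Basis. F'' x h (0, b) *\<^sub>R b)
     - ((K * (F'' x h x + F' x h)) *\<^sub>R x + (K * F' x x) *\<^sub>R h)" for h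
  have F'x: "(F' has_derivative F'' x) (at x)" using U by blast
  have F'y: "((\<lambda>y. F' y v) has_derivative (\<lambda>h. F'' x h v)) (at x)" for v
    by (rule bounded_linear.has_derivative[OF blinfun.bounded_linear_left F'x])
  have F'yy: "((\<lambda>y. F' y y) has_derivative (\<lambda>h. F' x h + F'' x h x)) (at x)"
    by (rule has_derivative_eq_rhs[OF blinfun.FDERIV[OF F'x has_derivative_ident]]) auto
  have "(W has_derivative W') (at x)"
    unfolding W_def[abs_def] W'_def[abs_def]
  proof -
    have 1: "((\<lambda>y. (K * F' y (1, 0), \<Sum>b\<in>Basis. F' y (0, b) *\<^sub>R b)) has_derivative
       (\<lambda>h. (K * F'' x h (1, 0), \<Sum>b\<in>Basis. F'' x h (0, b) *\<^sub>R b))) (at x)"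
      by (intro has_derivative_Pair has_derivative_mult_right has_derivative_sum has_derivative_scaleR_left F'y)
    have "((\<lambda>y. (K * F' y y) *\<^sub>R y) has_derivative
       (\<lambda>h. (K * F' x x) *\<^sub>R h + (K * (F' x h + F'' x h x)) *\<^sub>R x)) (at x)"
      by (intro has_derivative_scaleR has_derivative_mult_right F'yy has_derivative_ident)
    from has_derivative_diff[OF 1 this]
    show "((\<lambda>y. (K * F' y (1, 0), \<Sum>b\<in>Basis. F' y (0, b) *\<^sub>R b) - (K * F' y y) *\<^sub>R y) has_derivative
       (\<lambda>h. (K * F'' x h (1, 0), \<Sum>b\<in>Basis. F'' x h (0, b) *\<^sub>R b)
         - ((K * (F'' x h x + F' x h)) *\<^sub>R x + (K * F' x x) *\<^sub>R h))) (at x)"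
      by (rule has_derivative_eq_rhs) (simp add: fun_eq_iff add.commute)
  qed
  then have "(W has_derivative W') (at x within ?M)" by (rule has_derivative_at_withinI)
  then have gradd: "(grad K f has_derivative W') (at x within ?M)"
    by (rule has_derivative_transform_within[OF _ d(1) x]) (use d grad in \<open>auto simp: dist_commute subset_eq\<close>)
  define B where "B = (SOME B. orthonormal_basis K x B)"
  have B: "orthonormal_basis K x B" unfolding B_def using ex_orthonormal_basis[OF x] by (rule someI_ex)
  have Bt: "B \<subseteq> tangent K x" using B span_superset[of B] by (simp add: orthonormal_basis_def)
  have "deriv_along K (grad K f) x e = W' e" if "e \<in> B" for e
    using deriv_along_eq[OF gradd x] Bt that by blast
  moreover have "riem K (W' e) e = D2 e e - K * D x" if e: "e \<in> B" for e
  proof -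
    have et: "e \<in> tangent K x" and ee: "riem K e e = 1"
      using B e Bt by (auto simp: orthonormal_basis_def)
    have "riem K (K * F'' x e (1, 0), \<Sum>b\<in>Basis. F'' x e (0, b) *\<^sub>R b) e = F'' x e e"
    proof -
      have "e = fst e *\<^sub>R (1, 0) + (\<Sum>b\<in>Basis. (snd e \<bullet> b) *\<^sub>R (0, b))"
        by (simp add: prod_eq_iff fst_sum snd_sum euclidean_representation)
      then have "F'' x e e = F'' x e (fst e *\<^sub>R (1, 0) + (\<Sum>b\<in>Basis. (snd e \<bullet> b) *\<^sub>R (0, b)))" by simp
      also have "\<dots> = fst e * F'' x e (1, 0) + (\<Sum>b\<in>Basis. (snd e \<bullet> b) * F'' x e (0, b))"
        by (simp add: blinfun.add_right blinfun.scaleR_right blinfun.sum_right del: scaleR_Pair)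
      finally show ?thesis using fst_tangent_0[of x e] x et
        by (cases "K = 0") (auto simp: riem_def inner_sum_left inner_commute[of "snd e"] mult.commute)
    qed
    then show ?thesis using K_riem_tangent[OF x et] ee U
      by (auto simp: W'_def riem_algebra)
  qed
  ultimately have "laplace_beltrami K f x = (\<Sum>e\<in>B. D2 e e - K * D x)"
    by (simp add: laplace_beltrami_def divergence_def B_def[symmetric] cong: sum.cong)
  then show ?thesis using orthonormal_basis_sum[OF x B] by (simp add: sum_subtractf B_def)
qed

section \<open>Riemannian distance in polar coordinates\<close>

text \<open>Lower bounds for lengths come from functions along the curve that grow no faster than
  its length. Derivatives are compared only inside the interval, where the velocity is known to be
  tangent.\<close>

lemma curve_length_ge:
  fixes \<gamma> :: "real \<Rightarrow> real \<times> 'a::euclidean_space" and g :: "real \<Rightarrow> real"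
  assumes \<gamma>: "\<gamma> C1_differentiable_on {0..1}"
    and g: "continuous_on {0..1} g"
      "\<And>s. s \<in> {0<..<1} \<Longrightarrow> (g has_real_derivative g' s) (at s)"
      "\<And>s. s \<in> {0<..<1} \<Longrightarrow> g' s \<le> riem_norm K (vector_derivative \<gamma> (at s))"
  shows "g 1 - g 0 \<le> curve_length K \<gamma>"
proof -
  let ?\<rho> = "\<lambda>s. riem_norm K (vector_derivative \<gamma> (at s))"
  have "continuous_on {0..1} (\<lambda>s. vector_derivative \<gamma> (at s))"
    using \<gamma> by (simp add: C1_differentiable_on_eq)
  then have "continuous_on {0..1} ?\<rho>"
    unfolding riem_norm_def by (intro continuous_intros riem.continuous_on)
  then have \<rho>: "(?\<rho> has_integral curve_length K \<gamma>) {0..1}"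
    unfolding curve_length_def by (intro integrable_integral integrable_continuous_interval)
  \<comment> \<open>At the end points nothing is known about g'. Putting the speed there leaves the
    integral unchanged and makes the comparison hold on the closed interval.\<close>
  define h where "h s = (if s \<in> {0<..<1} then g' s else ?\<rho> s)" for s
  have "(h has_integral (g 1 - g 0)) {0..1}"
    by (rule fundamental_theorem_of_calculus_interior)
      (use g in \<open>auto simp: h_def has_real_derivative_iff_has_vector_derivative[symmetric]\<close>)
  then show ?thesis
    by (rule has_integral_le[OF _ \<rho>]) (use g(3) in \<open>auto simp: h_def\<close>)
qed

lemma bounded_linear_ip: "bounded_linear (ip K x)"
  unfolding ip_def
  by (intro bounded_linear_add bounded_linear_const_mult bounded_linear_fst
      bounded_linear_compose[OF bounded_linear_inner_right bounded_linear_snd])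

lemma velocity_tangent:
  assumes "\<gamma> ` {0..1} \<subseteq> space_form K" "s \<in> {0<..<1}" "(\<gamma> has_vector_derivative v) (at s)"
  shows "v \<in> tangent K (\<gamma> s)"
proof -
  have f: "((\<lambda>s. fst (\<gamma> s)) has_vector_derivative fst v) (at s)"
    and g: "((\<lambda>s. snd (\<gamma> s)) has_vector_derivative snd v) (at s)"
    using assms(3) by (auto simp: has_vector_derivative_def intro!: derivative_eq_intros)
  have "((\<lambda>s. ip K (\<gamma> s) (\<gamma> s)) has_vector_derivative 2 * ip K (\<gamma> s) v) (at s)"
    unfolding ip_def
    using has_vector_derivative_add[OF bounded_bilinear.has_vector_derivative[OF bounded_bilinear_mult f f]
        has_vector_derivative_mult_right[OF bounded_bilinear.has_vector_derivative[OF bounded_bilinear_inner g g], of K]]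
    by (rule has_vector_derivative_eq_rhs) (simp add: inner_commute algebra_simps)
  then have "((\<lambda>s. 1 :: real) has_vector_derivative 2 * ip K (\<gamma> s) v) (at s)"
    by (rule has_vector_derivative_transform_within_open[of _ _ _ "{0<..<1}"])
      (use assms in \<open>auto intro!: ip_self\<close>)
  moreover have "((\<lambda>s. 1 :: real) has_vector_derivative 0) (at s)" by simp
  ultimately show ?thesis using vector_derivative_unique_at by (fastforce simp: tangent_iff)
qed

text \<open>With \<open>ip K p x = cs K r\<close> the factor \<open>K * (1 - (ip K p x)^2)\<close>
  is \<open>(K * sn K r)^2\<close>, the squared norm of the gradient of
  \<open>cs K r\<close>.\<close>

lemma ip_velocity_le:
  assumes p: "p \<in> space_form K" and x: "x \<in> space_form K" and v: "v \<in> tangent K x" and K: "K \<noteq> 0"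
  shows "(ip K p v)\<^sup>2 \<le> K * (1 - (ip K p x)\<^sup>2) * riem K v v"
proof -
  have t: "tproj K x p \<in> tangent K x" using tproj_tangent[OF x] K by simp
  have pp: "K * riem K p p = 1" using K p by (metis ip_eq_riem ip_self)
  have "(ip K p v)\<^sup>2 = K\<^sup>2 * (riem K (tproj K x p) v)\<^sup>2"
    by (simp add: ip_eq_riem[OF K] riem_tproj[OF x v] power_mult_distrib)
  also have "\<dots> \<le> K\<^sup>2 * (riem K (tproj K x p) (tproj K x p) * riem K v v)"
    by (intro mult_left_mono riem_Cauchy_Schwarz[OF x t v]) auto
  also have "riem K (tproj K x p) (tproj K x p) = riem K p p - K * riem K p x * riem K p x"
    by (rule riem_tproj_tproj[OF x])
  also have "K\<^sup>2 * ((riem K p p - K * riem K p x * riem K p x) * riem K v v)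
    = K * (K * riem K p p - (K * riem K p x)\<^sup>2) * riem K v v"
    by (simp add: power2_eq_square algebra_simps)
  finally show ?thesis using pp by (simp add: ip_eq_riem[OF K])
qed

text \<open>The condition on f' says that x |-> f (ip K p x) has gradient of norm at most 1. As f
  must be differentiable at every value taken, including 1 at p, the distance itself is excluded and
  has to be approximated.\<close>

lemma curve_length_ge_ip:
  fixes \<gamma> :: "real \<Rightarrow> real \<times> 'a::euclidean_space"
  assumes \<gamma>: "\<gamma> C1_differentiable_on {0..1}" "\<gamma> ` {0..1} \<subseteq> space_form K"
    and p: "p \<in> space_form K" and K: "K \<noteq> 0"
    and f: "\<And>x. x \<in> space_form K \<Longrightarrow> (f has_real_derivative f' (ip K p x)) (at (ip K p x))"
    and f': "\<And>x. x \<in> space_form K \<Longrightarrow> (f' (ip K p x))\<^sup>2 * (K * (1 - (ip K p x)\<^sup>2)) \<le> 1"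
  shows "f (ip K p (\<gamma> 1)) - f (ip K p (\<gamma> 0)) \<le> curve_length K \<gamma>"
proof (rule curve_length_ge[OF \<gamma>(1)])
  have der: "(\<gamma> has_vector_derivative vector_derivative \<gamma> (at s)) (at s)" if "s \<in> {0..1}" for s
    using \<gamma> that by (simp add: C1_differentiable_on_eq vector_derivative_works)
  have cder: "((\<lambda>s. f (ip K p (\<gamma> s))) has_real_derivative
      f' (ip K p (\<gamma> s)) * ip K p (vector_derivative \<gamma> (at s))) (at s)" if s: "s \<in> {0..1}" for s
  proof -
    have "((\<lambda>s. ip K p (\<gamma> s)) has_real_derivative ip K p (vector_derivative \<gamma> (at s))) (at s)"
      using bounded_linear.has_vector_derivative[OF bounded_linear_ip der[OF s]]
      by (simp add: has_real_derivative_iff_has_vector_derivative)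
    moreover have "\<gamma> s \<in> space_form K" using \<gamma>(2) s by blast
    ultimately show ?thesis using DERIV_chain2[where f = f and g = "\<lambda>s. ip K p (\<gamma> s)"] f by blast
  qed
  show "continuous_on {0..1} (\<lambda>s. f (ip K p (\<gamma> s)))"
    using cder by (intro DERIV_continuous_on) (auto intro: has_field_derivative_at_within)
  fix s :: real assume s: "s \<in> {0<..<1}"
  let ?v = "vector_derivative \<gamma> (at s)" and ?c = "ip K p (\<gamma> s)"
  show "((\<lambda>s. f (ip K p (\<gamma> s))) has_real_derivative f' ?c * ip K p ?v) (at s)"
    using cder s by simp
  have x: "\<gamma> s \<in> space_form K" using \<gamma>(2) s by auto
  have v: "?v \<in> tangent K (\<gamma> s)" using velocity_tangent[OF \<gamma>(2) s] der s by simp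
  have "(f' ?c * ip K p ?v)\<^sup>2 \<le> (f' ?c)\<^sup>2 * (K * (1 - ?c\<^sup>2) * riem K ?v ?v)"
    unfolding power_mult_distrib by (intro mult_left_mono ip_velocity_le[OF p x v K]) simp
  also have "\<dots> = ((f' ?c)\<^sup>2 * (K * (1 - ?c\<^sup>2))) * riem K ?v ?v" by simp
  also have "\<dots> \<le> 1 * riem K ?v ?v" by (intro mult_right_mono f' x riem_nonneg[OF x v])
  finally show "f' ?c * ip K p ?v \<le> riem_norm K ?v" by (simp add: riem_norm_def real_le_rsqrt)
qed

locale space_form_point =
  fixes K :: real and p :: "real \<times> 'a::euclidean_space"
  assumes p: "p \<in> space_form K"
begin

text \<open>The same choice as in \<open>surface_measure\<close>, so that the unfolded surface
  measure is expressed through it.\<close>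

definition L :: "'a \<Rightarrow> real \<times> 'a" where "L = (SOME L. tangent_isometry K p L)"

lemma tangent_isometry_L: "tangent_isometry K p L"
  unfolding L_def using ex_tangent_isometry[OF p] by (rule someI_ex)

lemma linear_L: "linear L" and L_tangent: "L v \<in> tangent K p" and riem_L: "riem K (L v) (L w) = v \<bullet> w"
  using tangent_isometry_L by (auto simp: tangent_isometry_def)

lemma bounded_linear_L: "bounded_linear L"
  using linear_L linear_conv_bounded_linear by blast

lemmas L_scaleR = linear_scale[OF linear_L]
lemmas L_diff = linear_diff[OF linear_L]

lemma K_riem_L: "K * riem K p (L v) = 0"
  by (rule K_riem_tangent[OF p L_tangent])

lemma inj_L: "L v = L w \<Longrightarrow> v = w"
  by (metis L_diff diff_self inner_eq_zero_iff right_minus_eq riem.zero_left riem_L)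

text \<open>Geodesic polar coordinates: the point exp_p (r L(\<theta>)) for a unit vector
  \<theta>.\<close>

definition ex :: "real \<Rightarrow> 'a \<Rightarrow> real \<times> 'a" where
  "ex r \<theta> = cs K r *\<^sub>R p + sn K r *\<^sub>R L \<theta>"

lemma ex_eq_geo: "ex r \<theta> = geo K p (L \<theta>) r"
  by (simp add: ex_def geo_def)

lemma ex_0 [simp]: "ex 0 \<theta> = p"
  by (simp add: ex_def)

lemma ex_in_space_form: "norm \<theta> = 1 \<Longrightarrow> ex r \<theta> \<in> space_form K"
  unfolding ex_eq_geo by (rule geo_in_space_form[OF p L_tangent]) (simp add: riem_L norm_eq_1[symmetric])

lemma ip_ex: "ip K p (ex r \<theta>) = cs K r"
proof -
  have "ip K p (ex r \<theta>) = cs K r * ip K p p + sn K r * ip K p (L \<theta>)"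
    by (simp add: ex_def ip_def inner_add_right algebra_simps)
  then show ?thesis using L_tangent by (simp add: ip_self[OF p] tangent_iff)
qed

text \<open>For K = 0 the first summand is 0 / 0 = 0. Directions enter only through the second
  summand, a Euclidean distance; invariance under rotations and the search for the nearest point
  reduce to Euclidean geometry.\<close>

lemma chord2_ex:
  "chord2 K (ex r \<theta>) (ex s \<omega>) = (cs K r - cs K s)\<^sup>2 / K + (norm (sn K r *\<^sub>R \<theta> - sn K s *\<^sub>R \<omega>))\<^sup>2"
proof -
  define a where "a = cs K r - cs K s"
  define v where "v = sn K r *\<^sub>R \<theta> - sn K s *\<^sub>R \<omega>"
  have 0: "a = 0" if "K = 0" using that by (simp add: a_def cs_def)
  have e: "ex r \<theta> - ex s \<omega> = a *\<^sub>R p + L v"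
    by (simp add: ex_def a_def v_def L_diff L_scaleR algebra_simps)
  have "a = 0 \<or> riem K p (L v) = 0" using 0 K_riem_L[of v] by auto
  then have 1: "a * riem K p (L v) = 0" by auto
  have 2: "a * (a * riem K p p) = a\<^sup>2 / K"
  proof (cases "K = 0")
    case False
    then have "K * riem K p p = 1" using p by (metis ip_eq_riem ip_self)
    then have "riem K p p = 1 / K" using False by (simp add: field_simps)
    then show ?thesis by (simp add: power2_eq_square)
  qed (simp add: 0)
  have "chord2 K (ex r \<theta>) (ex s \<omega>) = a * (a * riem K p p) + 2 * (a * riem K p (L v)) + riem K (L v) (L v)"
    unfolding chord2_def e by (simp add: riem_algebra riem_sym[of K "L v" p] distrib_left)
  then show ?thesis unfolding 1 2 by (simp add: riem_L dot_square_norm a_def v_def)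
qed

lemma chord2_ex_p: "norm \<theta> = 1 \<Longrightarrow> chord2 K (ex r \<theta>) p = 4 * (sn K (r/2))\<^sup>2"
proof -
  assume n: "norm \<theta> = 1"
  have "chord2 K (ex r \<theta>) p = (cs K r - 1)\<^sup>2 / K + (sn K r)\<^sup>2"
    using chord2_ex[of r \<theta> 0 \<theta>] n by (simp add: power_mult_distrib)
  also have "(cs K r - 1)\<^sup>2 / K = 4 * K * (sn K (r/2))\<^sup>2 * (sn K (r/2))\<^sup>2"
    by (simp add: cs_half[of K r] power2_eq_square)
  also have "(sn K r)\<^sup>2 = 4 * (sn K (r/2))\<^sup>2 * (cs K (r/2))\<^sup>2"
    by (simp add: sn_half[of K r] power_mult_distrib)
  also have "4 * K * (sn K (r/2))\<^sup>2 * (sn K (r/2))\<^sup>2 + 4 * (sn K (r/2))\<^sup>2 * (cs K (r/2))\<^sup>2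
    = 4 * (sn K (r/2))\<^sup>2 * ((cs K (r/2))\<^sup>2 + K * (sn K (r/2))\<^sup>2)" by (simp add: algebra_simps)
  finally show ?thesis by (simp add: cs_sn_square)
qed

text \<open>The reversed Cauchy-Schwarz inequality for two points on the upper sheet; it later
  selects the branch \<open>ip K p x >= 1\<close>.\<close>

lemma ip_pos: "x \<in> space_form K \<Longrightarrow> K < 0 \<Longrightarrow> ip K p x > 0"
proof -
  assume x: "x \<in> space_form K" and K: "K < 0"
  define t y t0 y0 where "t = fst x" "y = snd x" "t0 = fst p" "y0 = snd p"
  note defs = this
  have xx: "K * (y \<bullet> y) = 1 - t\<^sup>2" "K * (y0 \<bullet> y0) = 1 - t0\<^sup>2"
    using ip_self[OF x] ip_self[OF p] by (simp_all add: ip_def defs power2_eq_square)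
  have t: "t > 0" "t0 > 0" using x p K by (auto simp: space_form_def defs)
  have "K\<^sup>2 * (y0 \<bullet> y)\<^sup>2 \<le> K\<^sup>2 * ((y0 \<bullet> y0) * (y \<bullet> y))"
    by (intro mult_left_mono Cauchy_Schwarz_ineq) simp
  also have "\<dots> = (K * (y0 \<bullet> y0)) * (K * (y \<bullet> y))" by (simp add: power2_eq_square)
  also have "\<dots> = (1 - t0\<^sup>2) * (1 - t\<^sup>2)" by (simp add: xx)
  also have "\<dots> = (t0 * t)\<^sup>2 - (t0\<^sup>2 + t\<^sup>2 - 1)" by (simp add: algebra_simps power2_eq_square)
  also have "\<dots> < (t0 * t)\<^sup>2"
  proof -
    have "K * (y \<bullet> y) \<le> 0" using K by (simp add: mult_le_0_iff)
    then have "t\<^sup>2 \<ge> 1" using xx by simp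
    moreover have "t0\<^sup>2 > 0" using t by simp
    ultimately show ?thesis by linarith
  qed
  finally have "(K * (y0 \<bullet> y))\<^sup>2 < (t0 * t)\<^sup>2" by (simp add: power_mult_distrib)
  moreover have "0 \<le> t0 * t" using t by simp
  ultimately have "\<bar>K * (y0 \<bullet> y)\<bar> < t0 * t" by (metis power2_abs power2_less_imp_less)
  then have "t0 * t + K * (y0 \<bullet> y) > 0" by linarith
  then show ?thesis by (simp add: ip_def defs)
qed

lemma ip_range:
  assumes x: "x \<in> space_form K" and K: "K \<noteq> 0"
  shows "K * (1 - (ip K p x)\<^sup>2) \<ge> 0"
    "\<exists>v. x = ip K p x *\<^sub>R p + L v \<and> K * (norm v)\<^sup>2 = 1 - (ip K p x)\<^sup>2"
proof -
  have t: "tproj K p x \<in> tangent K p" using tproj_tangent[OF p] K by simp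
  obtain v where v: "tproj K p x = L v" using tangent_isometry_surj[OF tangent_isometry_L t] by blast
  have c: "ip K p x = K * riem K x p" using ip_eq_riem[OF K] riem_sym by metis
  have "K * riem K x x = 1" using x K by (metis ip_eq_riem ip_self)
  moreover have "riem K (L v) (L v) = riem K x x - K * riem K x p * riem K x p"
    unfolding v[symmetric] by (rule riem_tproj_tproj[OF p])
  ultimately have 1: "K * (norm v)\<^sup>2 = 1 - (ip K p x)\<^sup>2"
  proof -
    have "(norm v)\<^sup>2 = riem K x x - K * riem K x p * riem K x p"
      using \<open>riem K (L v) (L v) = _\<close> by (simp add: riem_L dot_square_norm)
    then have "K * (norm v)\<^sup>2 = K * riem K x x - (K * riem K x p)\<^sup>2"
      by (simp only: right_diff_distrib power2_eq_square mult.assoc mult.left_commute)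
    then show ?thesis using \<open>K * riem K x x = 1\<close> c by simp
  qed
  have "K * (1 - (ip K p x)\<^sup>2) = (K * norm v)\<^sup>2" unfolding 1[symmetric] by (simp add: power2_eq_square)
  then show "K * (1 - (ip K p x)\<^sup>2) \<ge> 0" by simp
  have "x = ip K p x *\<^sub>R p + L v" using v[symmetric] by (simp add: tproj_def c)
  then show "\<exists>v. x = ip K p x *\<^sub>R p + L v \<and> K * (norm v)\<^sup>2 = 1 - (ip K p x)\<^sup>2" using 1 by blast
qed

lemma ip_le_1: "x \<in> space_form K \<Longrightarrow> K > 0 \<Longrightarrow> \<bar>ip K p x\<bar> \<le> 1"
  using ip_range(1)[of x] by (simp add: zero_le_mult_iff abs_square_le_1)

lemma ip_ge_1: "x \<in> space_form K \<Longrightarrow> K < 0 \<Longrightarrow> ip K p x \<ge> 1"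
proof -
  assume x: "x \<in> space_form K" and K: "K < 0"
  have "1 \<le> (ip K p x)\<^sup>2" using ip_range(1)[OF x] K by (simp add: zero_le_mult_iff)
  then show ?thesis using ip_pos[OF x K] by (simp add: power2_ge_1_iff)
qed

lemma ex_surj:
  assumes x: "x \<in> space_form K"
  shows "\<exists>r \<theta>. 0 \<le> r \<and> (K > 0 \<longrightarrow> r \<le> pi / sqrt K) \<and> norm \<theta> = 1 \<and> x = ex r \<theta>"
proof -
  have "\<exists>r v. 0 \<le> r \<and> (K > 0 \<longrightarrow> r \<le> pi / sqrt K) \<and> sn K r = norm v \<and> x = cs K r *\<^sub>R p + L v"
  proof (cases "K = 0")
    case True
    have "x - p \<in> tangent K p"
      using fst_space_form_0[of x] fst_space_form_0[of p] x p True by (simp add: tangent_def)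
    then obtain v where v: "x - p = L v" using tangent_isometry_surj[OF tangent_isometry_L] by blast
    show ?thesis using True v by (intro exI[of _ "norm v"] exI[of _ v]) (auto simp: sn_def cs_def algebra_simps)
  next
    case K: False
    define c where "c = ip K p x"
    obtain v where v: "x = c *\<^sub>R p + L v" "K * (norm v)\<^sup>2 = 1 - c\<^sup>2" using ip_range(2)[OF x K] by (auto simp: c_def)
    show ?thesis
    proof (cases "K > 0")
      case True
      have c: "-1 \<le> c" "c \<le> 1" using ip_le_1[OF x True] by (auto simp: c_def)
      have "sn K (arccos c / sqrt K) = sqrt ((1 - c\<^sup>2) / K)"
        using True c by (simp add: sn_def sin_arccos real_sqrt_divide)
      also have "\<dots> = norm v" using True by (simp add: v(2)[symmetric])
      finally show ?thesis using True c arccos_ubound[OF c] arccos_lbound[OF c] v(1)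
        by (intro exI[of _ "arccos c / sqrt K"] exI[of _ v]) (auto simp: cs_def divide_right_mono)
    next
      case False
      then have K: "K < 0" using K by simp
      have c: "c \<ge> 1" using ip_ge_1[OF x K] by (simp add: c_def)
      have "sn K (arcosh c / sqrt (-K)) = sqrt ((c\<^sup>2 - 1) / (-K))"
        using K c by (simp add: sn_def sinh_arcosh_real real_sqrt_divide[symmetric])
      also have "(c\<^sup>2 - 1) / (-K) = (norm v)\<^sup>2" using K v(2) by (simp add: field_simps)
      finally show ?thesis using K c v(1)
        by (intro exI[of _ "arcosh c / sqrt (-K)"] exI[of _ v]) (auto simp: cs_def)
    qed
  qed
  then obtain r v where rv: "0 \<le> r" "K > 0 \<longrightarrow> r \<le> pi / sqrt K" "sn K r = norm v" "x = cs K r *\<^sub>R p + L v"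
    by blast
  \<comment> \<open>The tangential part vanishes at p, and for K > 0 also at the antipode, where
    every direction serves.\<close>
  obtain \<theta> :: 'a where \<theta>: "norm \<theta> = 1" "v = norm v *\<^sub>R \<theta>"
  proof (cases "v = 0")
    case True
    obtain b :: 'a where "b \<in> Basis" using nonempty_Basis by blast
    then show ?thesis using that[of b] True by simp
  next
    case False
    then show ?thesis using that[of "(1 / norm v) *\<^sub>R v"] by simp
  qed
  then have "x = ex r \<theta>" using rv by (simp add: ex_def L_scaleR[symmetric])
  then show ?thesis using rv \<theta> by blast
qed

text \<open>For K \<noteq> 0 the distance is arccos or arcosh of \<open>ip K p x\<close> divided by
  sqrt \<bar>K\<bar>, which is singular at p, where the curve starts. Scaling the argument by 1 -
  \<eta> or 1 + \<eta> moves all values into the smooth range and keeps the gradient at most 1; the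
  limit \<eta> to 0 restores the radius. For K = 0 a linear function in the direction of the end
  point is enough.\<close>

lemma curve_length_ge_radius:
  assumes \<gamma>: "\<gamma> C1_differentiable_on {0..1}" "\<gamma> ` {0..1} \<subseteq> space_form K" "\<gamma> 0 = p" "\<gamma> 1 = ex r \<theta>"
    and r: "0 \<le> r" "K > 0 \<longrightarrow> r \<le> pi / sqrt K" "norm \<theta> = 1"
  shows "r \<le> curve_length K \<gamma>"
proof -
  consider "K = 0" | "K > 0" | "K < 0" by linarith
  then show ?thesis
  proof cases
    case 1
    define v where "v s = snd (vector_derivative \<gamma> (at s))" for s
    have der: "(\<gamma> has_vector_derivative vector_derivative \<gamma> (at s)) (at s)" if "s \<in> {0..1}" for s
      using \<gamma> that by (simp add: C1_differentiable_on_eq vector_derivative_works)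
    define e where "e = snd (ex r \<theta> - p)"
    have ee: "e \<bullet> e = r\<^sup>2"
    proof -
      have "chord2 K (ex r \<theta>) p = r\<^sup>2" using chord2_ex_p[OF r(3)] 1 by (simp add: sn_def power2_eq_square)
      then show ?thesis using 1 by (simp add: chord2_def riem_def e_def)
    qed
    \<comment> \<open>For r = 0 the factor 1 / r is 0 and the estimate says that the length is
      nonnegative.\<close>
    have "(1/r) * (e \<bullet> snd (\<gamma> 1)) - (1/r) * (e \<bullet> snd (\<gamma> 0)) \<le> curve_length K \<gamma>"
    proof (rule curve_length_ge[OF \<gamma>(1)])
      have d: "((\<lambda>s. (1/r) * (e \<bullet> snd (\<gamma> s))) has_real_derivative (1/r) * (e \<bullet> v s)) (at s)" if "s \<in> {0..1}" for s
      proof -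
        have "bounded_linear (\<lambda>z. (1/r) * (e \<bullet> snd z))"
          by (intro bounded_linear_const_mult bounded_linear_compose[OF bounded_linear_inner_right bounded_linear_snd])
        from bounded_linear.has_vector_derivative[OF this der[OF that]] show ?thesis
          by (simp add: has_real_derivative_iff_has_vector_derivative v_def)
      qed
      show "continuous_on {0..1} (\<lambda>s. (1/r) * (e \<bullet> snd (\<gamma> s)))"
        using d by (intro DERIV_continuous_on) (auto intro: has_field_derivative_at_within)
      fix s :: real assume s: "s \<in> {0<..<1}"
      show "((\<lambda>s. (1/r) * (e \<bullet> snd (\<gamma> s))) has_real_derivative (1/r) * (e \<bullet> v s)) (at s)"
        using d s by simp
      have "e \<bullet> v s \<le> r * norm (v s)"
        using norm_cauchy_schwarz[of e "v s"] ee r by (simp add: norm_eq_sqrt_inner)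
      then have "(1/r) * (e \<bullet> v s) \<le> norm (v s)"
        by (cases "r = 0") (use r in \<open>auto simp: field_simps\<close>)
      also have "norm (v s) = riem_norm K (vector_derivative \<gamma> (at s))"
        using 1 by (simp add: riem_norm_def riem_def v_def norm_eq_sqrt_inner)
      finally show "(1/r) * (e \<bullet> v s) \<le> riem_norm K (vector_derivative \<gamma> (at s))" .
    qed
    moreover have "(1/r) * (e \<bullet> snd (\<gamma> 1)) - (1/r) * (e \<bullet> snd (\<gamma> 0)) = (1/r) * (e \<bullet> e)"
      by (simp add: \<gamma> e_def right_diff_distrib inner_diff_right)
    ultimately show ?thesis using ee by (simp add: power2_eq_square)
  next
    case 2
    have *: "arccos ((1 - \<eta>) * cs K r) / sqrt K - arccos (1 - \<eta>) / sqrt K \<le> curve_length K \<gamma>"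
      if \<eta>: "0 < \<eta>" "\<eta> < 1" for \<eta> :: real
    proof -
      define f where "f c = arccos ((1 - \<eta>) * c) / sqrt K" for c
      define f' where "f' c = - (1 - \<eta>) / sqrt (1 - ((1 - \<eta>) * c)\<^sup>2) / sqrt K" for c
      have "f (ip K p (\<gamma> 1)) - f (ip K p (\<gamma> 0)) \<le> curve_length K \<gamma>"
      proof (rule curve_length_ge_ip[OF \<gamma>(1,2) p])
        fix x :: "real \<times> 'a" assume x: "x \<in> space_form K"
        let ?c = "ip K p x"
        have c: "\<bar>?c\<bar> \<le> 1" by (rule ip_le_1[OF x 2])
        have "\<bar>(1 - \<eta>) * ?c\<bar> \<le> (1 - \<eta>) * 1"
          unfolding abs_mult using \<eta> c by (intro mult_mono) auto
        also have "\<dots> < 1" using \<eta> by simp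
        finally have l: "\<bar>(1 - \<eta>) * ?c\<bar> < 1" .
        have "(arccos has_real_derivative inverse (- sqrt (1 - ((1 - \<eta>) * ?c)\<^sup>2))) (at ((1 - \<eta>) * ?c))"
          using l by (intro DERIV_arccos) auto
        then have "((\<lambda>c. arccos ((1 - \<eta>) * c)) has_real_derivative inverse (- sqrt (1 - ((1 - \<eta>) * ?c)\<^sup>2)) * (1 - \<eta>)) (at ?c)"
          by (rule DERIV_chain2) (auto intro!: derivative_eq_intros)
        then have "(f has_real_derivative inverse (- sqrt (1 - ((1 - \<eta>) * ?c)\<^sup>2)) * (1 - \<eta>) / sqrt K) (at ?c)"
          unfolding f_def[abs_def] by (rule DERIV_cdivide)
        then show "(f has_real_derivative f' ?c) (at ?c)"
          by (simp add: f'_def divide_inverse algebra_simps)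
        have l2: "((1 - \<eta>) * ?c)\<^sup>2 < 1" using l by (simp add: abs_square_less_1)
        have "(f' ?c)\<^sup>2 = (1 - \<eta>)\<^sup>2 / (1 - ((1 - \<eta>) * ?c)\<^sup>2) / K"
          using l2 2 by (simp add: f'_def power_divide power_mult_distrib power2_commute[of \<eta> 1] del: minus_diff_eq)
        then have "(f' ?c)\<^sup>2 * (K * (1 - ?c\<^sup>2)) = ((1 - \<eta>)\<^sup>2 * (1 - ?c\<^sup>2)) / (1 - ((1 - \<eta>) * ?c)\<^sup>2)"
          using 2 by simp
        also have "\<dots> \<le> 1"
        proof -
          have "(1 - \<eta>)\<^sup>2 \<le> 1" using \<eta> by (simp add: abs_square_le_1)
          then have "(1 - \<eta>)\<^sup>2 * (1 - ?c\<^sup>2) \<le> 1 - ((1 - \<eta>) * ?c)\<^sup>2"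
            by (simp add: power_mult_distrib right_diff_distrib)
          then show ?thesis using l2 by simp
        qed
        finally show "(f' ?c)\<^sup>2 * (K * (1 - ?c\<^sup>2)) \<le> 1" .
      qed (use 2 in auto)
      then show ?thesis by (simp add: f_def \<gamma> ip_ex ip_self[OF p])
    qed
    have cr: "-1 \<le> cs K r" "cs K r \<le> 1" using 2 by (auto simp: cs_def)
    have "((\<lambda>\<eta>. arccos ((1 - \<eta>) * cs K r) / sqrt K - arccos (1 - \<eta>) / sqrt K) \<longlongrightarrow>
        arccos ((1 - 0) * cs K r) / sqrt K - arccos (1 - 0) / sqrt K) (at 0 within {0..1})"
    proof -
      have "continuous_on {0..1} (\<lambda>\<eta>. arccos ((1 - \<eta>) * cs K r) / sqrt K - arccos (1 - \<eta>) / sqrt K)"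
      proof (intro continuous_intros ballI)
        fix \<eta> :: real assume \<eta>: "\<eta> \<in> {0..1}"
        have "\<bar>(1 - \<eta>) * cs K r\<bar> \<le> 1 * 1" unfolding abs_mult using \<eta> cr by (intro mult_mono) auto
        then show "- 1 \<le> (1 - \<eta>) * cs K r \<and> (1 - \<eta>) * cs K r \<le> 1" "- 1 \<le> 1 - \<eta> \<and> 1 - \<eta> \<le> 1" using \<eta> by auto
      qed (use 2 in auto)
      then show ?thesis unfolding continuous_on_def by (rule bspec) simp
    qed
    then have "((\<lambda>\<eta>. arccos ((1 - \<eta>) * cs K r) / sqrt K - arccos (1 - \<eta>) / sqrt K) \<longlongrightarrow> r) (at 0 within {0..1})"
      using 2 r by (simp add: cs_def arccos_cos field_simps)
    moreover have "\<forall>\<^sub>F \<eta> in at 0 within {0..1}. arccos ((1 - \<eta>) * cs K r) / sqrt K - arccos (1 - \<eta>) / sqrt K \<le> curve_length K \<gamma>"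
      unfolding eventually_at using * by (intro exI[of _ 1]) auto
    moreover have "at (0::real) within {0..1} \<noteq> bot"
      by (simp add: at_within_Icc_at_right)
    ultimately show ?thesis using tendsto_upperbound by blast
  next
    case 3
    have *: "arcosh ((1 + \<eta>) * cs K r) / sqrt (-K) - arcosh (1 + \<eta>) / sqrt (-K) \<le> curve_length K \<gamma>"
      if \<eta>: "0 < \<eta>" for \<eta> :: real
    proof -
      define f where "f c = arcosh ((1 + \<eta>) * c) / sqrt (-K)" for c
      define f' where "f' c = (1 + \<eta>) / sqrt (((1 + \<eta>) * c)\<^sup>2 - 1) / sqrt (-K)" for c
      have "f (ip K p (\<gamma> 1)) - f (ip K p (\<gamma> 0)) \<le> curve_length K \<gamma>"
      proof (rule curve_length_ge_ip[OF \<gamma>(1,2) p])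
        fix x :: "real \<times> 'a" assume x: "x \<in> space_form K"
        let ?c = "ip K p x"
        have c: "?c \<ge> 1" by (rule ip_ge_1[OF x 3])
        have l: "1 < (1 + \<eta>) * ?c" using \<eta> c by (metis less_1_mult less_add_same_cancel1 less_le mult_cancel_left1 not_less)
        have "(arcosh has_real_derivative 1 / sqrt (((1 + \<eta>) * ?c)\<^sup>2 - 1)) (at ((1 + \<eta>) * ?c))"
          using l by (intro arcosh_real_has_field_derivative) auto
        then have "((\<lambda>c. arcosh ((1 + \<eta>) * c)) has_real_derivative 1 / sqrt (((1 + \<eta>) * ?c)\<^sup>2 - 1) * (1 + \<eta>)) (at ?c)"
          by (rule DERIV_chain2) (auto intro!: derivative_eq_intros)
        then have "(f has_real_derivative 1 / sqrt (((1 + \<eta>) * ?c)\<^sup>2 - 1) * (1 + \<eta>) / sqrt (-K)) (at ?c)"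
          unfolding f_def[abs_def] by (rule DERIV_cdivide)
        then show "(f has_real_derivative f' ?c) (at ?c)" by (simp add: f'_def)
        have l2: "((1 + \<eta>) * ?c)\<^sup>2 > 1" using l by (simp add: one_less_power)
        have "(f' ?c)\<^sup>2 = (1 + \<eta>)\<^sup>2 / (((1 + \<eta>) * ?c)\<^sup>2 - 1) / (-K)"
          using l2 3 by (simp add: f'_def power_divide power_mult_distrib)
        then have "(f' ?c)\<^sup>2 * (K * (1 - ?c\<^sup>2)) = ((1 + \<eta>)\<^sup>2 * (?c\<^sup>2 - 1)) / (((1 + \<eta>) * ?c)\<^sup>2 - 1)"
        proof -
          have "K * (1 - ?c\<^sup>2) = (-K) * (?c\<^sup>2 - 1)" by algebra
          then show ?thesis using 3 unfolding \<open>(f' ?c)\<^sup>2 = _\<close> by simp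
        qed
        also have "\<dots> \<le> 1"
        proof -
          have "(1 + \<eta>)\<^sup>2 \<ge> 1" using \<eta> by (simp add: one_le_power)
          then have "(1 + \<eta>)\<^sup>2 * (?c\<^sup>2 - 1) \<le> ((1 + \<eta>) * ?c)\<^sup>2 - 1"
            by (simp add: power_mult_distrib right_diff_distrib)
          then show ?thesis using l2 by simp
        qed
        finally show "(f' ?c)\<^sup>2 * (K * (1 - ?c\<^sup>2)) \<le> 1" .
      qed (use 3 in auto)
      then show ?thesis by (simp add: f_def \<gamma> ip_ex ip_self[OF p])
    qed
    have cr: "1 \<le> cs K r" using 3 by (auto simp: cs_def cosh_real_ge_1)
    have "((\<lambda>\<eta>. arcosh ((1 + \<eta>) * cs K r) / sqrt (-K) - arcosh (1 + \<eta>) / sqrt (-K)) \<longlongrightarrow>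
        arcosh ((1 + 0) * cs K r) / sqrt (-K) - arcosh (1 + 0) / sqrt (-K)) (at 0 within {0..1})"
    proof -
      have "continuous_on {0..1} (\<lambda>\<eta>. arcosh ((1 + \<eta>) * cs K r) / sqrt (-K) - arcosh (1 + \<eta>) / sqrt (-K))"
      proof (intro continuous_intros)
        fix \<eta> :: real assume \<eta>: "\<eta> \<in> {0..1}"
        have "1 * 1 \<le> (1 + \<eta>) * cs K r" using \<eta> cr by (intro mult_mono) auto
        then show "1 \<le> (1 + \<eta>) * cs K r" by simp
      qed (use 3 in auto)
      then show ?thesis unfolding continuous_on_def by (rule bspec) simp
    qed
    then have "((\<lambda>\<eta>. arcosh ((1 + \<eta>) * cs K r) / sqrt (-K) - arcosh (1 + \<eta>) / sqrt (-K)) \<longlongrightarrow> r) (at 0 within {0..1})"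
      using 3 r by (simp add: cs_def arcosh_cosh_real)
    moreover have "\<forall>\<^sub>F \<eta> in at 0 within {0..1}. arcosh ((1 + \<eta>) * cs K r) / sqrt (-K) - arcosh (1 + \<eta>) / sqrt (-K) \<le> curve_length K \<gamma>"
      unfolding eventually_at using * by (intro exI[of _ 1]) auto
    moreover have "at (0::real) within {0..1} \<noteq> bot"
      by (simp add: at_within_Icc_at_right)
    ultimately show ?thesis using tendsto_upperbound by blast
  qed
qed

lemma riem_dist_ex:
  assumes r: "0 \<le> r" "K > 0 \<longrightarrow> r \<le> pi / sqrt K" "norm \<theta> = 1"
  shows "riem_dist K p (ex r \<theta>) = r"
  unfolding riem_dist_def
proof (rule cInf_eq_minimum)
  define \<gamma> where "\<gamma> s = ex (r * s) \<theta>" for s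
  define \<gamma>' where "\<gamma>' s = r *\<^sub>R ((- K * sn K (r * s)) *\<^sub>R p + cs K (r * s) *\<^sub>R L \<theta>)" for s
  have d: "(\<gamma> has_vector_derivative \<gamma>' s) (at s)" for s
    unfolding \<gamma>_def[abs_def] ex_eq_geo \<gamma>'_def
    by (rule vector_diff_chain_at[of "\<lambda>s. r * s" r, unfolded o_def, OF _ has_vector_derivative_geo])
      (auto intro!: derivative_eq_intros)
  then have vd: "vector_derivative \<gamma> (at s) = \<gamma>' s" for s by (rule vector_derivative_at)
  have KK: "K * (K * riem K p p) = K"
    by (cases "K = 0") (use p ip_eq_riem[of K p p] ip_self[OF p] in auto)
  have "riem K (\<gamma>' s) (\<gamma>' s) = r\<^sup>2" for s
  proof -
    let ?a = "sn K (r * s)" and ?c = "cs K (r * s)"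
    have "riem K (\<gamma>' s) (\<gamma>' s) = r\<^sup>2 * (?a\<^sup>2 * (K * (K * riem K p p)) - 2 * ?a * ?c * (K * riem K p (L \<theta>)) + ?c\<^sup>2 * riem K (L \<theta>) (L \<theta>))"
      by (simp add: \<gamma>'_def riem_algebra riem.minus_left riem.minus_right riem_sym[of K "L \<theta>" p] power2_eq_square algebra_simps)
    also have "\<dots> = r\<^sup>2 * (?c\<^sup>2 + K * ?a\<^sup>2)"
      unfolding KK K_riem_L using r(3) by (simp add: riem_L dot_square_norm mult.commute)
    finally show ?thesis by (simp add: cs_sn_square)
  qed
  then have "riem_norm K (\<gamma>' s) = r" for s using r(1) by (simp add: riem_norm_def)
  then have len: "curve_length K \<gamma> = r" by (simp add: curve_length_def vd)
  have "\<gamma> C1_differentiable_on {0..1}"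
    unfolding C1_differentiable_on_def
    by (intro exI[of _ \<gamma>'] conjI ballI d) (auto simp: \<gamma>'_def[abs_def] intro!: continuous_intros)
  then show "r \<in> {curve_length K \<gamma> | \<gamma>. \<gamma> C1_differentiable_on {0..1} \<and> \<gamma> ` {0..1} \<subseteq> space_form K \<and>
     pathstart \<gamma> = p \<and> pathfinish \<gamma> = ex r \<theta>}"
    using len r by (intro CollectI exI[of _ \<gamma>])
      (auto simp: pathstart_def pathfinish_def \<gamma>_def intro: ex_in_space_form)
  fix l assume "l \<in> {curve_length K \<gamma> | \<gamma>. \<gamma> C1_differentiable_on {0..1} \<and> \<gamma> ` {0..1} \<subseteq> space_form K \<and>
     pathstart \<gamma> = p \<and> pathfinish \<gamma> = ex r \<theta>}"
  then show "r \<le> l" using curve_length_ge_radius r by (auto simp: pathstart_def pathfinish_def)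
qed

end

section \<open>Integration over the unit sphere\<close>

lemma ball_borel [measurable]: "ball x r \<in> sets (borel :: 'a::metric_space measure)"
  by simp

text \<open>No determinant is involved. With B the unit ball, the double integral of the indicators
  of \<open>T x + y \<in> E\<close> and \<open>y \<in> B\<close> is computed in both orders.
  Translation invariance before T gives the image measure of E times the volume of B; translation
  invariance after T, with T preserving balls, gives the volume of E times that of B. The volume of
  B is finite and nonzero and cancels.\<close>

lemma lborel_distr_orthogonal:
  fixes T :: "'a::euclidean_space \<Rightarrow> 'a"
  assumes T: "orthogonal_transformation T"
  shows "distr lborel borel T = lborel"
proof (rule measure_eqI)
  have Tm [measurable]: "T \<in> borel_measurable borel"
    using orthogonal_transformation_linear[OF T]
    by (intro borel_measurable_continuous_onI linear_continuous_on) (simp add: linear_conv_bounded_linear)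
  show "sets (distr lborel borel T) = sets lborel" by simp
  fix E assume "E \<in> sets (distr lborel borel T)"
  then have E [measurable]: "E \<in> sets borel" by simp
  define B where "B = ball (0::'a) 1"
  have B [measurable]: "B \<in> sets borel" by (simp add: B_def)
  let ?b = "emeasure lborel B"
  have transl: "(\<integral>\<^sup>+ x. g (c + x) \<partial>lborel) = (\<integral>\<^sup>+ x. g x \<partial>lborel)" if [measurable]: "g \<in> borel_measurable borel" for g and c :: 'a
  proof -
    have "(\<integral>\<^sup>+ x. g x \<partial>distr lborel borel ((+) c)) = (\<integral>\<^sup>+ x. g (c + x) \<partial>lborel)"
      by (rule nn_integral_distr) auto
    then show ?thesis by (simp add: lborel_distr_plus)
  qed
  have surj: "\<exists>z. T z = y" for y using orthogonal_transformation_surj[OF T] by (metis surjD)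
  have Tadd: "T (a + b) = T a + T b" for a b using orthogonal_transformation_linear[OF T] by (simp add: linear_add)
  have "emeasure (distr lborel borel T) E * ?b = (\<integral>\<^sup>+ x. indicator E (T x) \<partial>lborel) * (\<integral>\<^sup>+ y. indicator B y \<partial>lborel)"
  proof -
    have "emeasure (distr lborel borel T) E = (\<integral>\<^sup>+ x. indicator E x \<partial>distr lborel borel T)" by simp
    also have "\<dots> = (\<integral>\<^sup>+ x. indicator E (T x) \<partial>lborel)" by (rule nn_integral_distr) auto
    finally show ?thesis by simp
  qed
  also have "\<dots> = (\<integral>\<^sup>+ y. (\<integral>\<^sup>+ x. indicator E (T x) \<partial>lborel) * indicator B y \<partial>lborel)"
    by (rule nn_integral_cmult[symmetric]) auto
  also have "\<dots> = (\<integral>\<^sup>+ y. (\<integral>\<^sup>+ x. indicator E (T x + y) * indicator B y \<partial>lborel) \<partial>lborel)"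
  proof (rule nn_integral_cong)
    fix y :: 'a
    obtain z where z: "T z = y" using surj by blast
    have "(\<integral>\<^sup>+ x. indicator E (T x) \<partial>lborel) = (\<integral>\<^sup>+ x. indicator E (T (z + x)) \<partial>lborel)"
      by (rule transl[symmetric]) measurable
    also have "\<dots> = (\<integral>\<^sup>+ x. indicator E (T x + y) \<partial>lborel)" by (simp add: Tadd z add.commute)
    finally show "(\<integral>\<^sup>+ x. indicator E (T x) \<partial>lborel) * indicator B y = (\<integral>\<^sup>+ x. indicator E (T x + y) * indicator B y \<partial>lborel)"
      by (simp add: nn_integral_multc)
  qed
  also have "\<dots> = (\<integral>\<^sup>+ x. (\<integral>\<^sup>+ y. indicator E (T x + y) * indicator B y \<partial>lborel) \<partial>lborel)"
    by (rule lborel_pair.Fubini') measurable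
  also have "\<dots> = (\<integral>\<^sup>+ x. (\<integral>\<^sup>+ y. indicator E y * indicator B (y - T x) \<partial>lborel) \<partial>lborel)"
  proof (rule nn_integral_cong)
    fix x :: 'a
    show "(\<integral>\<^sup>+ y. indicator E (T x + y) * indicator B y \<partial>lborel) = (\<integral>\<^sup>+ y. indicator E y * indicator B (y - T x) \<partial>lborel)"
      using transl[of "\<lambda>y. indicator E y * indicator B (y - T x)" "T x"] by simp
  qed
  also have "\<dots> = (\<integral>\<^sup>+ y. (\<integral>\<^sup>+ x. indicator E y * indicator B (y - T x) \<partial>lborel) \<partial>lborel)"
    by (rule lborel_pair.Fubini'[symmetric]) measurable
  also have "\<dots> = (\<integral>\<^sup>+ y. indicator E y * ?b \<partial>lborel)"
  proof (rule nn_integral_cong)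
    fix y :: 'a
    obtain z where z: "T z = y" using surj by blast
    have "indicator B (y - T x) = (indicator (ball z 1) x :: ennreal)" for x
    proof -
      have "y - T x = T (z - x)" using z orthogonal_transformation_linear[OF T] by (simp add: linear_diff)
      then have "norm (y - T x) = norm (z - x)" using T by (simp add: orthogonal_transformation_norm)
      then show ?thesis unfolding B_def indicator_def mem_ball dist_norm by (simp add: norm_minus_commute)
    qed
    then have "(\<integral>\<^sup>+ x. indicator B (y - T x) \<partial>lborel) = emeasure lborel (ball z 1)" by simp
    also have "\<dots> = ?b"
    proof -
      have "(\<integral>\<^sup>+ x. indicator (ball z 1) x \<partial>lborel) = (\<integral>\<^sup>+ x. indicator (ball z 1) (z + x) \<partial>lborel)"
        by (rule transl[symmetric]) simp
      also have "(\<lambda>x. indicator (ball z 1) (z + x)) = (indicator B :: 'a \<Rightarrow> ennreal)"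
        by (auto simp: B_def indicator_def dist_norm)
      finally show ?thesis by simp
    qed
    finally show "(\<integral>\<^sup>+ x. indicator E y * indicator B (y - T x) \<partial>lborel) = indicator E y * ?b"
      by (simp add: nn_integral_cmult)
  qed
  also have "\<dots> = emeasure lborel E * ?b" by (simp add: nn_integral_multc)
  finally have "emeasure (distr lborel borel T) E * ?b = emeasure lborel E * ?b" .
  moreover have "?b \<noteq> \<infinity>" using emeasure_lborel_ball_finite[of "0::'a" 1] by (simp add: B_def)
  moreover have "?b \<noteq> 0"
  proof
    assume "?b = 0"
    then have "B \<in> null_sets lborel" by (simp add: null_sets_def)
    then have "negligible B" using negligible_iff_null_sets null_sets_completionI by blast
    then show False using open_not_negligible[of B] by (auto simp: B_def)
  qed
  ultimately show "emeasure (distr lborel borel T) E = emeasure lborel E"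
    by (metis ennreal_mult_cancel_left infinity_ennreal_def mult.commute)
qed

text \<open>The cone measure: its total mass is the volume of the unit ball, so surface area is n
  times it. The factor n is restored in \<open>integral_euclidean_sphere_measure\<close>.\<close>

definition unit_sphere_measure :: "'a::euclidean_space measure" where
  "unit_sphere_measure = distr (density lborel (indicator (ball 0 1))) borel sgn"

text \<open>The restriction to the sphere discards the value \<open>sgn 0 = 0\<close>, so integrands
  need only be continuous on the sphere.\<close>

definition sphere_integral :: "('a::euclidean_space \<Rightarrow> 'b::{banach, second_countable_topology}) \<Rightarrow> 'b" where
  "sphere_integral f = (LINT \<omega>:sphere 0 1|unit_sphere_measure. f \<omega>)"

lemma sgn_borel_measurable [measurable]: "(sgn :: 'a::euclidean_space \<Rightarrow> 'a) \<in> borel_measurable borel"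
  unfolding sgn_div_norm[abs_def] by measurable

lemma sphere_integral_eq_lborel:
  fixes f :: "'a::euclidean_space \<Rightarrow> 'b::euclidean_space"
  assumes "continuous_on (sphere 0 1) f"
  shows "sphere_integral f = (LINT x|lborel. indicator (ball 0 1) x *\<^sub>R (indicator (sphere 0 1) (sgn x) *\<^sub>R f (sgn x)))"
proof -
  have m [measurable]: "(\<lambda>x. indicator (sphere 0 1) x *\<^sub>R f x) \<in> borel_measurable borel"
    by (rule borel_measurable_continuous_on_indicator[OF _ assms]) simp
  have "sphere_integral f = (LINT x|density lborel (indicator (ball 0 1)). indicator (sphere 0 1) (sgn x) *\<^sub>R f (sgn x))"
    unfolding sphere_integral_def set_lebesgue_integral_def unit_sphere_measure_def
    by (rule integral_distr) auto
  also have "density lborel (indicator (ball (0::'a) 1)) = density lborel (\<lambda>x. ennreal (indicator (ball 0 1) x))"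
    by (simp add: ennreal_indicator)
  also have "(LINT x|density lborel (\<lambda>x. ennreal (indicator (ball (0::'a) 1) x)). indicator (sphere 0 1) (sgn x) *\<^sub>R f (sgn x))
     = (LINT x|lborel. indicator (ball 0 1) x *\<^sub>R (indicator (sphere 0 1) (sgn x) *\<^sub>R f (sgn x)))"
  proof (rule integral_density)
    show "(\<lambda>x. indicator (sphere 0 1) (sgn x) *\<^sub>R f (sgn x)) \<in> borel_measurable lborel"
      using measurable_compose[OF sgn_borel_measurable m] by (simp del: real_scaleR_def)
  qed auto
  finally show ?thesis .
qed

lemma finite_unit_sphere_measure: "finite_measure (unit_sphere_measure :: 'a::euclidean_space measure)"
proof
  have "emeasure (unit_sphere_measure :: 'a measure) UNIV = emeasure lborel (ball (0::'a) 1)"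
    unfolding unit_sphere_measure_def
    by (subst emeasure_distr, simp, simp, subst emeasure_density) (auto simp: ball_borel)
  then show "emeasure (unit_sphere_measure :: 'a measure) (space unit_sphere_measure) \<noteq> \<infinity>"
    using emeasure_lborel_ball_finite[of "0::'a" 1] by (simp add: unit_sphere_measure_def)
qed

lemma sphere_integrable:
  fixes f :: "'a::euclidean_space \<Rightarrow> 'b::euclidean_space"
  assumes f: "continuous_on (sphere 0 1) f"
  shows "set_integrable unit_sphere_measure (sphere 0 1) f"
proof -
  interpret finite_measure "unit_sphere_measure :: 'a measure" by (rule finite_unit_sphere_measure)
  have "compact (f ` sphere 0 1)" by (rule compact_continuous_image[OF f]) simp
  then obtain B where B: "\<And>x. x \<in> sphere 0 1 \<Longrightarrow> norm (f x) \<le> B"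
    by (meson bounded_iff compact_imp_bounded imageI)
  have m: "(\<lambda>x. indicator (sphere 0 1) x *\<^sub>R f x) \<in> borel_measurable borel"
    by (rule borel_measurable_continuous_on_indicator[OF _ f]) simp
  show ?thesis unfolding set_integrable_def
  proof (rule integrable_const_bound[where B = "max B 0"])
    show "AE x in unit_sphere_measure. norm (indicator (sphere 0 1) x *\<^sub>R f x) \<le> max B 0"
      using B by (intro always_eventually) (auto simp: indicator_def le_max_iff_disj)
    show "(\<lambda>x. indicator (sphere 0 1) x *\<^sub>R f x) \<in> borel_measurable unit_sphere_measure"
      using m by (simp add: unit_sphere_measure_def)
  qed
qed

lemma sphere_integral_cong:
  assumes "\<And>\<omega>. norm \<omega> = 1 \<Longrightarrow> f \<omega> = g \<omega>"
  shows "sphere_integral f = sphere_integral g"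
  unfolding sphere_integral_def set_lebesgue_integral_def
  by (intro Bochner_Integration.integral_cong refl) (use assms in \<open>auto simp: indicator_def\<close>)

lemma sphere_integral_add:
  fixes f :: "'a::euclidean_space \<Rightarrow> 'b::euclidean_space"
  assumes "continuous_on (sphere 0 1) f" "continuous_on (sphere 0 1) g"
  shows "sphere_integral (\<lambda>\<omega>. f \<omega> + g \<omega>) = sphere_integral f + sphere_integral g"
  unfolding sphere_integral_def using sphere_integrable[OF assms(1)] sphere_integrable[OF assms(2)] by simp

lemma sphere_integral_diff:
  fixes f :: "'a::euclidean_space \<Rightarrow> 'b::euclidean_space"
  assumes "continuous_on (sphere 0 1) f" "continuous_on (sphere 0 1) g"
  shows "sphere_integral (\<lambda>\<omega>. f \<omega> - g \<omega>) = sphere_integral f - sphere_integral g"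
  unfolding sphere_integral_def using sphere_integrable[OF assms(1)] sphere_integrable[OF assms(2)] by simp

lemma sphere_integral_bounded_linear:
  fixes f :: "'a::euclidean_space \<Rightarrow> 'b::euclidean_space" and T :: "'b \<Rightarrow> 'c::euclidean_space"
  assumes "continuous_on (sphere 0 1) f" "bounded_linear T"
  shows "sphere_integral (\<lambda>\<omega>. T (f \<omega>)) = T (sphere_integral f)"
proof -
  interpret T: bounded_linear T by fact
  show ?thesis
    using integral_bounded_linear[OF assms(2) sphere_integrable[OF assms(1), unfolded set_integrable_def]]
    by (simp add: sphere_integral_def set_lebesgue_integral_def T.scaleR)
qed

lemma sphere_integral_mult:
  fixes f :: "'a::euclidean_space \<Rightarrow> real"
  assumes "continuous_on (sphere 0 1) f"
  shows "sphere_integral (\<lambda>\<omega>. c * f \<omega>) = c * sphere_integral f"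
  by (rule sphere_integral_bounded_linear[OF assms bounded_linear_mult_right])

lemma sphere_integral_sum:
  fixes f :: "'i \<Rightarrow> 'a::euclidean_space \<Rightarrow> 'b::euclidean_space"
  assumes "finite I" "\<And>i. i \<in> I \<Longrightarrow> continuous_on (sphere 0 1) (f i)"
  shows "sphere_integral (\<lambda>\<omega>. \<Sum>i\<in>I. f i \<omega>) = (\<Sum>i\<in>I. sphere_integral (f i))"
  using assms
proof (induction I rule: finite_induct)
  case empty
  show ?case by (simp add: sphere_integral_def)
next
  case (insert i I)
  then show ?case by (simp add: sphere_integral_add continuous_on_sum)
qed

lemma sphere_integral_mono:
  fixes f :: "'a::euclidean_space \<Rightarrow> real"
  assumes "continuous_on (sphere 0 1) f" "continuous_on (sphere 0 1) g" "\<And>\<omega>. norm \<omega> = 1 \<Longrightarrow> f \<omega> \<le> g \<omega>"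
  shows "sphere_integral f \<le> sphere_integral g"
  unfolding sphere_integral_def set_lebesgue_integral_def
  by (intro integral_mono sphere_integrable[unfolded set_integrable_def] assms)
     (use assms(3) in \<open>auto simp: indicator_def\<close>)

lemma sphere_integral_nonneg:
  fixes f :: "'a::euclidean_space \<Rightarrow> real"
  assumes "continuous_on (sphere 0 1) f" "\<And>\<omega>. norm \<omega> = 1 \<Longrightarrow> 0 \<le> f \<omega>"
  shows "0 \<le> sphere_integral f"
  using sphere_integral_mono[of "\<lambda>_. 0" f] assms by (simp add: sphere_integral_def)

lemma norm_sphere_integral_le:
  fixes f :: "'a::euclidean_space \<Rightarrow> 'b::euclidean_space"
  assumes "continuous_on (sphere 0 1) f"
  shows "norm (sphere_integral f) \<le> sphere_integral (\<lambda>\<omega>. norm (f \<omega>))"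
  unfolding sphere_integral_def set_lebesgue_integral_def
  using integral_norm_bound[of unit_sphere_measure "\<lambda>x. indicator (sphere 0 1) x *\<^sub>R f x"] by simp

lemma norm_sphere_integral_bound:
  fixes f :: "'a::euclidean_space \<Rightarrow> 'b::euclidean_space"
  assumes "continuous_on (sphere 0 1) f" "\<And>\<omega>. norm \<omega> = 1 \<Longrightarrow> norm (f \<omega>) \<le> B"
  shows "norm (sphere_integral f) \<le> B * sphere_integral (\<lambda>\<omega>::'a. 1)"
proof -
  have "norm (sphere_integral f) \<le> sphere_integral (\<lambda>\<omega>. norm (f \<omega>))"
    by (rule norm_sphere_integral_le[OF assms(1)])
  also have "\<dots> \<le> sphere_integral (\<lambda>\<omega>::'a. B * 1)"
    by (rule sphere_integral_mono) (use assms in \<open>auto intro: continuous_intros\<close>)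
  also have "\<dots> = B * sphere_integral (\<lambda>\<omega>::'a. 1)"
    by (rule sphere_integral_mult) auto
  finally show ?thesis .
qed

text \<open>The measure has full support: where f is positive, the open cone over that part of the
  sphere meets the unit ball in a nonempty open set, which has positive volume.\<close>

lemma sphere_integral_eq_0:
  fixes f :: "'a::euclidean_space \<Rightarrow> real"
  assumes f: "continuous_on (sphere 0 1) f" and nonneg: "\<And>\<omega>. norm \<omega> = 1 \<Longrightarrow> 0 \<le> f \<omega>" and 0: "sphere_integral f = 0"
    and \<omega>: "norm \<omega> = 1"
  shows "f \<omega> = 0"
proof (rule ccontr)
  assume "f \<omega> \<noteq> 0"
  then have pos: "f \<omega> > 0" using nonneg[OF \<omega>] by simp
  let ?g = "\<lambda>x. indicator (sphere 0 1) x *\<^sub>R f x"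
  have gm [measurable]: "?g \<in> borel_measurable borel"
    by (rule borel_measurable_continuous_on_indicator[OF _ f]) simp
  have gi: "integrable unit_sphere_measure ?g"
    using sphere_integrable[OF f] by (simp add: set_integrable_def)
  have "AE x in unit_sphere_measure. 0 \<le> ?g x" using nonneg by (intro always_eventually) (auto simp: indicator_def)
  from integral_nonneg_eq_0_iff_AE[OF gi this] have "AE x in unit_sphere_measure. ?g x = 0"
    using 0 by (simp add: sphere_integral_def set_lebesgue_integral_def)
  moreover have S: "{x \<in> space borel. ?g x = 0} \<in> sets borel" by measurable
  ultimately have "AE x in density lborel (indicator (ball (0::'a) 1)). ?g (sgn x) = 0"
    unfolding unit_sphere_measure_def using AE_distr_iff[OF _ S, of sgn "density lborel (indicator (ball (0::'a) 1))"]
    by simp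
  then have "AE x in lborel. 0 < (indicator (ball (0::'a) 1) x :: ennreal) \<longrightarrow> ?g (sgn x) = 0"
    by (subst (asm) AE_density) (auto simp: ball_borel)
  then have ae: "AE x in lborel. x \<in> ball (0::'a) 1 \<longrightarrow> ?g (sgn x) = 0"
    by eventually_elim simp
  define V where "V = ball 0 1 \<inter> {x \<in> - {0}. f (sgn x) > 0}"
  have sgn1: "norm (sgn x) = 1" if "x \<noteq> 0" for x :: 'a using that by (simp add: norm_sgn)
  have "continuous_on (- {0}) (\<lambda>x. f (sgn x))"
    by (rule continuous_on_compose2[OF f]) (auto intro!: continuous_intros simp: norm_sgn split: if_splits)
  then have "open ((- {0}) \<inter> (\<lambda>x. f (sgn x)) -` {0<..})"
    by (rule continuous_open_preimage) auto
  also have "(- {0}) \<inter> (\<lambda>x. f (sgn x)) -` {0<..} = {x \<in> - {0}. f (sgn x) > 0}" by auto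
  finally have "open {x \<in> - {0}. f (sgn x) > 0}" .
  then have openV: "open V" unfolding V_def by (intro open_Int) auto
  have "(1/2) *\<^sub>R \<omega> \<in> V" using \<omega> pos by (auto simp: V_def sgn_div_norm)
  then have "V \<noteq> {}" by blast
  have "AE x in lborel. x \<notin> V"
    using ae
  proof eventually_elim
    case (elim x)
    then show ?case using sgn1[of x] by (auto simp: V_def)
  qed
  then have "V \<in> null_sets lborel" using AE_iff_null_sets[of V lborel] openV by simp
  then have "negligible V" using negligible_iff_null_sets null_sets_completionI by blast
  then show False using open_not_negligible[OF openV] \<open>V \<noteq> {}\<close> by blast
qed

lemma sphere_integral_pos:
  fixes f :: "'a::euclidean_space \<Rightarrow> real"
  assumes f: "continuous_on (sphere 0 1) f" and pos: "\<And>\<omega>. norm \<omega> = 1 \<Longrightarrow> 0 < f \<omega>"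
  shows "sphere_integral f > 0"
proof -
  obtain b :: 'a where b: "b \<in> Basis" using nonempty_Basis by blast
  have "sphere_integral f \<noteq> 0" using sphere_integral_eq_0[OF f, of b] pos b by (metis less_imp_le norm_Basis order_less_irrefl)
  moreover have "sphere_integral f \<ge> 0" using sphere_integral_nonneg[OF f] pos by (simp add: less_imp_le)
  ultimately show ?thesis by simp
qed

lemma sphere_integral_orthogonal:
  fixes f :: "'a::euclidean_space \<Rightarrow> 'b::euclidean_space" and T :: "'a \<Rightarrow> 'a"
  assumes f: "continuous_on (sphere 0 1) f" and T: "orthogonal_transformation T"
  shows "sphere_integral (\<lambda>\<omega>. f (T \<omega>)) = sphere_integral f"
proof -
  have lin: "linear T" using T by (rule orthogonal_transformation_linear)
  have nT: "norm (T x) = norm x" for x using T by (simp add: orthogonal_transformation_norm)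
  have T0: "T x = 0 \<longleftrightarrow> x = 0" for x by (metis nT norm_eq_zero)
  have contT: "continuous_on A T" for A using lin linear_continuous_on linear_conv_bounded_linear by blast
  have Tm [measurable]: "T \<in> borel_measurable borel" by (rule borel_measurable_continuous_onI[OF contT])
  have fT: "continuous_on (sphere 0 1) (\<lambda>\<omega>. f (T \<omega>))"
    by (rule continuous_on_compose2[OF f contT]) (auto simp: nT)
  let ?g = "\<lambda>x. indicator (ball 0 1) x *\<^sub>R (indicator (sphere 0 1) (sgn x) *\<^sub>R f (sgn x))"
  have gm: "(\<lambda>x. indicator (sphere 0 1) x *\<^sub>R f x) \<in> borel_measurable borel"
    by (rule borel_measurable_continuous_on_indicator[OF _ f]) simp
  have gm2: "?g \<in> borel_measurable borel"
    by (intro borel_measurable_scaleR borel_measurable_indicator ball_borel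
        measurable_compose[OF sgn_borel_measurable gm])
  have Tsgn: "T (sgn x) = sgn (T x)" for x by (simp add: sgn_div_norm nT linear_scale[OF lin])
  have "sphere_integral f = (LINT x|distr lborel borel T. ?g x)"
    by (simp add: sphere_integral_eq_lborel[OF f] lborel_distr_orthogonal[OF T])
  also have "\<dots> = (LINT x|lborel. ?g (T x))"
    by (rule integral_distr[OF _ gm2]) (use Tm in simp)
  also have "\<dots> = sphere_integral (\<lambda>\<omega>. f (T \<omega>))"
    unfolding sphere_integral_eq_lborel[OF fT]
    by (intro Bochner_Integration.integral_cong refl) (auto simp: Tsgn indicator_def nT T0 norm_sgn)
  finally show ?thesis by simp
qed

text \<open>The reflection in the hyperplane orthogonal to a - b.\<close>

lemma ex_orthogonal_transformation:
  fixes a b :: "'a::euclidean_space"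
  assumes "norm a = norm b"
  shows "\<exists>T. orthogonal_transformation T \<and> T a = b"
proof (cases "a = b")
  case True
  then show ?thesis by (intro exI[of _ id]) (auto simp: id_def)
next
  case False
  define c where "c = a - b"
  have c: "c \<bullet> c \<noteq> 0" using False by (simp add: c_def)
  define T where "T v = v - (2 * (c \<bullet> v) / (c \<bullet> c)) *\<^sub>R c" for v
  have "linear T" by (rule linearI) (auto simp: T_def inner_add_right algebra_simps add_divide_distrib)
  moreover have "T v \<bullet> T w = v \<bullet> w" for v w
  proof -
    have "T v \<bullet> T w = v \<bullet> w - 2 * (c \<bullet> w) / (c \<bullet> c) * (c \<bullet> v) - 2 * (c \<bullet> v) / (c \<bullet> c) * (c \<bullet> w)
        + 2 * (c \<bullet> v) / (c \<bullet> c) * (2 * (c \<bullet> w) / (c \<bullet> c)) * (c \<bullet> c)"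
      unfolding T_def inner_diff_left inner_diff_right inner_scaleR_left inner_scaleR_right
      by (simp add: inner_commute[of v c])
    then show ?thesis using c by simp
  qed
  ultimately have "orthogonal_transformation T" by (simp add: orthogonal_transformation_def)
  moreover have "a \<bullet> a = b \<bullet> b" using assms by (simp add: norm_eq)
  then have "2 * (c \<bullet> a) = c \<bullet> c" by (simp add: c_def inner_diff_left inner_diff_right inner_commute)
  then have "T a = b" using c by (simp add: T_def c_def)
  ultimately show ?thesis by blast
qed

text \<open>Compactness of the sphere makes the continuity in x uniform in the direction.\<close>

lemma continuous_on_sphere_integral:
  fixes k :: "'e::metric_space \<Rightarrow> 'a::euclidean_space \<Rightarrow> 'b::euclidean_space"
  assumes k: "continuous_on (U \<times> sphere 0 1) (\<lambda>(x, \<omega>). k x \<omega>)"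
  shows "continuous_on U (\<lambda>x. sphere_integral (k x))"
  unfolding continuous_on_iff
proof (intro ballI allI impI)
  fix x and e :: real assume x: "x \<in> U" and e: "e > 0"
  let ?m = "sphere_integral (\<lambda>\<omega>::'a. 1 :: real)"
  have m: "?m > 0" by (rule sphere_integral_pos) auto
  have e2: "e / (2 * ?m) > 0" using e m by simp
  obtain V where V: "x \<in> V" "open V"
    "\<forall>y\<in>V \<inter> U. \<forall>\<omega>\<in>sphere 0 1. dist (case (y, \<omega>) of (x, \<omega>) \<Rightarrow> k x \<omega>) (case (x, \<omega>) of (x, \<omega>) \<Rightarrow> k x \<omega>) \<le> e / (2 * ?m)"
    by (rule continuous_on_prod_compactE[OF k compact_sphere x e2])
  obtain d where d: "d > 0" "ball x d \<subseteq> V" using V by (meson open_contains_ball)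
  have kc: "continuous_on (sphere 0 1) (k y)" if "y \<in> U" for y
  proof -
    have "continuous_on (sphere 0 1) (\<lambda>\<omega>. (\<lambda>(x, \<omega>). k x \<omega>) (y, \<omega>))"
      by (rule continuous_on_compose2[OF k]) (use that in \<open>auto intro!: continuous_intros\<close>)
    then show ?thesis by simp
  qed
  have "dist (sphere_integral (k y)) (sphere_integral (k x)) < e" if y: "y \<in> U" "dist y x < d" for y
  proof -
    have "norm (sphere_integral (k y) - sphere_integral (k x)) = norm (sphere_integral (\<lambda>\<omega>. k y \<omega> - k x \<omega>))"
      using kc x y by (simp add: sphere_integral_diff)
    also have "\<dots> \<le> (e / (2 * ?m)) * ?m"
      proof (rule norm_sphere_integral_bound)

      show "continuous_on (sphere 0 1) (\<lambda>\<omega>. k y \<omega> - k x \<omega>)" using kc x y by (intro continuous_intros)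
      have "y \<in> V" using d y by (auto simp: dist_commute)
      then show "norm (k y \<omega> - k x \<omega>) \<le> e / (2 * ?m)" if "norm \<omega> = 1" for \<omega>
        using V(3) y that by (auto simp: dist_norm)
    qed
    also have "\<dots> < e" using e m by simp
    finally show ?thesis by (simp add: dist_norm)
  qed
  then show "\<exists>d>0. \<forall>y\<in>U. dist y x < d \<longrightarrow> dist (sphere_integral (k y)) (sphere_integral (k x)) < e"
    using d by blast
qed

text \<open>Differentiation under the integral through the mean value inequality: joint continuity
  of the derivative and compactness of the sphere make the linearisation error small uniformly in
  the direction.\<close>

lemma has_derivative_sphere_integral:
  fixes k :: "'e::euclidean_space \<Rightarrow> 'a::euclidean_space \<Rightarrow> 'b::euclidean_space"
  assumes U: "open U" "x \<in> U"
    and der: "\<And>x \<omega>. x \<in> U \<Longrightarrow> norm \<omega> = 1 \<Longrightarrow> ((\<lambda>x. k x \<omega>) has_derivative k' x \<omega>) (at x)"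
    and k: "\<And>x. x \<in> U \<Longrightarrow> continuous_on (sphere 0 1) (k x)"
    and k': "\<And>b. b \<in> Basis \<Longrightarrow> continuous_on (U \<times> sphere 0 1) (\<lambda>(x, \<omega>). k' x \<omega> b)"
  shows "((\<lambda>x. sphere_integral (k x)) has_derivative (\<lambda>h. sphere_integral (\<lambda>\<omega>. k' x \<omega> h))) (at x)"
proof -
  let ?m = "sphere_integral (\<lambda>\<omega>::'a. 1 :: real)"
  have m: "?m > 0" by (rule sphere_integral_pos) auto
  have bl: "bounded_linear (k' y \<omega>)" if "y \<in> U" "norm \<omega> = 1" for y \<omega>
    using der[OF that] by (rule has_derivative_bounded_linear)
  have rep: "k' y \<omega> h = (\<Sum>b\<in>Basis. (h \<bullet> b) *\<^sub>R k' y \<omega> b)" if "y \<in> U" "norm \<omega> = 1" for y \<omega> h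
  proof -
    interpret bounded_linear "k' y \<omega>" using bl that by blast
    have "k' y \<omega> h = k' y \<omega> (\<Sum>b\<in>Basis. (h \<bullet> b) *\<^sub>R b)" by (simp add: euclidean_representation)
    then show ?thesis by (simp add: sum scaleR del: euclidean_representation)
  qed
  have k'c: "continuous_on (sphere 0 1) (\<lambda>\<omega>. k' y \<omega> h)" if "y \<in> U" for y h
  proof -
    have "continuous_on (sphere 0 1) (\<lambda>\<omega>. k' y \<omega> b)" if b: "b \<in> Basis" for b
    proof -
      have "continuous_on (sphere 0 1) (\<lambda>\<omega>. (\<lambda>(x, \<omega>). k' x \<omega> b) (y, \<omega>))"
        by (rule continuous_on_compose2[OF k'[OF b]]) (use \<open>y \<in> U\<close> in \<open>auto intro!: continuous_intros\<close>)
      then show ?thesis by simp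
    qed
    then have "continuous_on (sphere 0 1) (\<lambda>\<omega>. \<Sum>b\<in>Basis. (h \<bullet> b) *\<^sub>R k' y \<omega> b)" by (intro continuous_intros)
    then show ?thesis by (rule continuous_on_eq) (use rep that in auto)
  qed
  have lin: "linear (\<lambda>h. sphere_integral (\<lambda>\<omega>. k' x \<omega> h))"
  proof (rule linearI)
    fix h h' :: 'e and c :: real
    have "sphere_integral (\<lambda>\<omega>. k' x \<omega> (h + h')) = sphere_integral (\<lambda>\<omega>. k' x \<omega> h + k' x \<omega> h')"
      by (rule sphere_integral_cong) (use bl U in \<open>auto simp: linear_simps\<close>)
    then show "sphere_integral (\<lambda>\<omega>. k' x \<omega> (h + h')) = sphere_integral (\<lambda>\<omega>. k' x \<omega> h) + sphere_integral (\<lambda>\<omega>. k' x \<omega> h')"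
      using k'c U by (simp add: sphere_integral_add)
    have "sphere_integral (\<lambda>\<omega>. k' x \<omega> (c *\<^sub>R h)) = sphere_integral (\<lambda>\<omega>. c *\<^sub>R k' x \<omega> h)"
      by (rule sphere_integral_cong) (use bl U in \<open>auto simp: linear_simps\<close>)
    then show "sphere_integral (\<lambda>\<omega>. k' x \<omega> (c *\<^sub>R h)) = c *\<^sub>R sphere_integral (\<lambda>\<omega>. k' x \<omega> h)"
      using sphere_integral_bounded_linear[OF k'c[OF U(2)] bounded_linear_scaleR_right] by simp
  qed
  \<comment> \<open>This sum over the basis dominates the operator norm of
    \<open>k' y \<omega> - k' x \<omega>\<close> and vanishes for y = x.\<close>
  define \<Psi> where "\<Psi> = (\<lambda>(y, \<omega>). \<Sum>b\<in>Basis. norm (k' y \<omega> b - k' x \<omega> b))"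
  have \<Psi>c: "continuous_on (U \<times> sphere 0 1) \<Psi>"
    unfolding \<Psi>_def split_beta
  proof (intro continuous_intros)
    fix b :: 'e assume b: "b \<in> Basis"
    show "continuous_on (U \<times> sphere 0 1) (\<lambda>z. k' (fst z) (snd z) b)"
      using k'[OF b] by (simp add: split_beta)
    show "continuous_on (U \<times> sphere 0 1) (\<lambda>z. k' x (snd z) b)"
      by (rule continuous_on_compose2[OF k'c[OF U(2)]]) (auto intro: continuous_intros)
  qed
  show ?thesis unfolding has_derivative_at_alt
  proof (intro conjI allI impI)
    show "bounded_linear (\<lambda>h. sphere_integral (\<lambda>\<omega>. k' x \<omega> h))" using lin linear_conv_bounded_linear by blast
    fix e :: real assume e: "e > 0"
    have e2: "e / ?m > 0" using e m by simp
    obtain V where V: "x \<in> V" "open V" "\<forall>y\<in>V \<inter> U. \<forall>\<omega>\<in>sphere 0 1. dist (\<Psi> (y, \<omega>)) (\<Psi> (x, \<omega>)) \<le> e / ?m"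
      by (rule continuous_on_prod_compactE[OF \<Psi>c compact_sphere U(2) e2])
    obtain d where d: "d > 0" "ball x d \<subseteq> V \<inter> U" using V U by (meson open_contains_ball open_Int IntI)
    have "norm (sphere_integral (k y) - sphere_integral (k x) - sphere_integral (\<lambda>\<omega>. k' x \<omega> (y - x))) \<le> e * norm (y - x)"
      if y: "norm (y - x) < d" for y
    proof -
      have "y \<in> ball x d" using y by (simp add: dist_norm norm_minus_commute)
      then have yU: "y \<in> U" using d by blast
      have pt: "norm (k y \<omega> - k x \<omega> - k' x \<omega> (y - x)) \<le> e / ?m * norm (y - x)" if \<omega>: "norm \<omega> = 1" for \<omega>
      proof -
        have "norm (k y \<omega> - k x \<omega> - k' x \<omega> (y - x)) \<le> norm (y - x) * (e / ?m)"
        proof (rule differentiable_bound_linearization[where S = "ball x d" and f' = "\<lambda>z. k' z \<omega>" and f = "\<lambda>z. k z \<omega>"])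
          fix t :: real assume t: "t \<in> {0..1}"
          have "norm (t *\<^sub>R (y - x)) \<le> 1 * norm (y - x)" using t by (simp add: mult_left_le_one_le)
          then show "x + t *\<^sub>R (y - x) \<in> ball x d" using y by (simp add: dist_norm)
        next
          fix z assume z: "z \<in> ball x d"
          then have zU: "z \<in> U" "z \<in> V \<inter> U" using d by auto
          show "((\<lambda>z. k z \<omega>) has_derivative k' z \<omega>) (at z within ball x d)"
            using der[OF zU(1) \<omega>] by (rule has_derivative_at_withinI)
          have "onorm (k' z \<omega> - k' x \<omega>) \<le> (\<Sum>b\<in>Basis. norm ((k' z \<omega> - k' x \<omega>) b))"
            unfolding fun_diff_def by (rule onorm_componentwise) (intro bounded_linear_sub bl zU U \<omega>)
          also have "\<dots> \<le> e / ?m" using V(3) zU(2) \<omega> by (auto simp: \<Psi>_def dist_real_def abs_le_iff)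
          finally show "onorm (k' z \<omega> - k' x \<omega>) \<le> e / ?m" .
        qed (use d in auto)
        then show ?thesis by (simp add: mult.commute)
      qed
      have "sphere_integral (k y) - sphere_integral (k x) - sphere_integral (\<lambda>\<omega>. k' x \<omega> (y - x))
        = sphere_integral (\<lambda>\<omega>. k y \<omega> - k x \<omega> - k' x \<omega> (y - x))"
        using k[OF yU] k[OF U(2)] k'c[OF U(2)] by (simp add: sphere_integral_diff continuous_on_diff)
      also have "norm \<dots> \<le> (e / ?m * norm (y - x)) * ?m"
        by (rule norm_sphere_integral_bound) (use k[OF yU] k[OF U(2)] k'c[OF U(2)] pt in \<open>auto intro!: continuous_intros\<close>)
      also have "\<dots> = e * norm (y - x)" using m by simp
      finally show ?thesis .
    qed
    then show "\<exists>d>0. \<forall>y. norm (y - x) < d \<longrightarrow>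
       norm (sphere_integral (k y) - sphere_integral (k x) - sphere_integral (\<lambda>\<omega>. k' x \<omega> (y - x))) \<le> e * norm (y - x)"
      using d by blast
  qed
qed

section \<open>Surface measures of Euclidean and geodesic spheres\<close>

lemma scale_measure_eq_density: "scale_measure c M = density M (\<lambda>_. c)"
  by (rule measure_eqI) (auto simp: emeasure_density_const)

text \<open>Rescaling space by \<rho> turns the constant n / \<rho> into n times \<rho> to the power
  n - 1. At the origin the radial projection takes the value 0, off the sphere;
  \<open>g 0 = 0\<close> makes the integrands agree there as well.\<close>

lemma integral_euclidean_sphere_measure:
  fixes g :: "'a::euclidean_space \<Rightarrow> real" and \<rho> :: real
  assumes \<rho>: "\<rho> > 0" and [measurable]: "g \<in> borel_measurable borel" and g0: "g 0 = 0"
    and gc: "continuous_on (sphere 0 1) (\<lambda>\<omega>. g (\<rho> *\<^sub>R \<omega>))"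
  shows "(LINT v|euclidean_sphere_measure \<rho>. g v) = DIM('a) * \<rho> ^ (DIM('a) - 1) * sphere_integral (\<lambda>\<omega>. g (\<rho> *\<^sub>R \<omega>))"
proof -
  let ?n = "real DIM('a)"
  let ?G = "\<lambda>x. indicator (ball 0 \<rho>) x *\<^sub>R g ((\<rho> / norm x) *\<^sub>R x)"
  have Gm [measurable]: "(\<lambda>x. g ((\<rho> / norm x) *\<^sub>R x)) \<in> borel_measurable borel" by measurable
  have "(LINT v|euclidean_sphere_measure \<rho>. g v)
     = (LINT v|density (distr (density lborel (indicator (ball 0 \<rho>))) borel (\<lambda>x. (\<rho> / norm x) *\<^sub>R x)) (\<lambda>_. ennreal (?n / \<rho>)). g v)"
    by (simp add: euclidean_sphere_measure_def scale_measure_eq_density)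
  also have "\<dots> = (LINT v|distr (density lborel (indicator (ball 0 \<rho>))) borel (\<lambda>x. (\<rho> / norm x) *\<^sub>R x). (?n / \<rho>) *\<^sub>R g v)"
    using \<rho> by (intro integral_density) auto
  also have "\<dots> = (LINT x|density lborel (\<lambda>x. ennreal (indicator (ball 0 \<rho>) x)). (?n / \<rho>) *\<^sub>R g ((\<rho> / norm x) *\<^sub>R x))"
    unfolding ennreal_indicator by (rule integral_distr) auto
  also have "\<dots> = (LINT x|lborel. indicator (ball 0 \<rho>) x *\<^sub>R (?n / \<rho>) *\<^sub>R g ((\<rho> / norm x) *\<^sub>R x))"
    by (intro integral_density) auto
  also have "\<dots> = (?n / \<rho>) * (LINT x|lborel. ?G x)"
    by (simp add: mult.left_commute)
  also have "(LINT x|lborel. ?G x) = (LINT x|density (distr lborel borel (\<lambda>x. 0 + \<rho> *\<^sub>R x)) (\<lambda>_. ennreal (\<bar>\<rho>\<bar> ^ DIM('a))). ?G x)"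
    using lborel_affine[of \<rho> "0::'a"] \<rho> by (simp add: ennreal_power)
  also have "\<dots> = (LINT x|distr lborel borel (\<lambda>x. 0 + \<rho> *\<^sub>R x). (\<bar>\<rho>\<bar> ^ DIM('a)) *\<^sub>R ?G x)"
    by (intro integral_density) auto
  also have "\<dots> = (LINT x|lborel. (\<bar>\<rho>\<bar> ^ DIM('a)) *\<^sub>R ?G (0 + \<rho> *\<^sub>R x))"
    by (intro integral_distr) auto
  also have "\<dots> = \<rho> ^ DIM('a) * (LINT x|lborel. ?G (\<rho> *\<^sub>R x))"
    using \<rho> by simp
  also have "(LINT x|lborel. ?G (\<rho> *\<^sub>R x)) = sphere_integral (\<lambda>\<omega>. g (\<rho> *\<^sub>R \<omega>))"
    unfolding sphere_integral_eq_lborel[OF gc]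
  proof (intro Bochner_Integration.integral_cong refl)
    fix x :: 'a
    have "(\<rho> / norm (\<rho> *\<^sub>R x)) *\<^sub>R (\<rho> *\<^sub>R x) = \<rho> *\<^sub>R sgn x"
      using \<rho> by (simp add: sgn_div_norm field_simps)
    then show "?G (\<rho> *\<^sub>R x) = indicator (ball 0 1) x *\<^sub>R indicator (sphere 0 1) (sgn x) *\<^sub>R g (\<rho> *\<^sub>R sgn x)"
      using \<rho> g0 by (cases "x = 0") (auto simp: indicator_def norm_sgn)
  qed
  finally show ?thesis using \<rho> by (simp add: power_eq_if)
qed

context space_form_point begin

lemma continuous_on_ex [continuous_intros]:
  "continuous_on S f \<Longrightarrow> continuous_on S g \<Longrightarrow> continuous_on S (\<lambda>x. ex (f x) (g x))"
  unfolding ex_def by (intro continuous_intros bounded_linear.continuous_on[OF bounded_linear_L])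

lemma geodesic_sphere_eq:
  assumes "R > 0" "K > 0 \<longrightarrow> R < pi / sqrt K"
  shows "geodesic_sphere K p R = ex R ` sphere 0 1"
proof (intro equalityI subsetI)
  fix x assume "x \<in> geodesic_sphere K p R"
  then have x: "x \<in> space_form K" "riem_dist K p x = R" by (auto simp: geodesic_sphere_def)
  obtain r \<theta> where "0 \<le> r" "K > 0 \<longrightarrow> r \<le> pi / sqrt K" "norm \<theta> = 1" "x = ex r \<theta>"
    using ex_surj[OF x(1)] by blast
  then show "x \<in> ex R ` sphere 0 1" using riem_dist_ex[of r \<theta>] x(2) by auto
next
  fix x assume "x \<in> ex R ` sphere 0 1"
  then show "x \<in> geodesic_sphere K p R"
    using assms riem_dist_ex ex_in_space_form by (auto simp: geodesic_sphere_def)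
qed

lemma geodesic_ball_eq:
  assumes "R > 0" "K > 0 \<longrightarrow> R < pi / sqrt K"
  shows "geodesic_ball K p R = {ex r \<theta> | r \<theta>. 0 \<le> r \<and> r < R \<and> norm \<theta> = 1}"
proof (intro equalityI subsetI)
  fix x assume "x \<in> geodesic_ball K p R"
  then have x: "x \<in> space_form K" "riem_dist K p x < R" by (auto simp: geodesic_ball_def)
  obtain r \<theta> where "0 \<le> r" "K > 0 \<longrightarrow> r \<le> pi / sqrt K" "norm \<theta> = 1" "x = ex r \<theta>"
    using ex_surj[OF x(1)] by blast
  then show "x \<in> {ex r \<theta> | r \<theta>. 0 \<le> r \<and> r < R \<and> norm \<theta> = 1}" using riem_dist_ex[of r \<theta>] x(2) by auto
next
  fix x assume "x \<in> {ex r \<theta> | r \<theta>. 0 \<le> r \<and> r < R \<and> norm \<theta> = 1}"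
  then obtain r \<theta> where x: "x = ex r \<theta>" "0 \<le> r" "r < R" "norm \<theta> = 1" by blast
  then have "riem_dist K p x = r" using assms by (auto intro!: riem_dist_ex)
  then show "x \<in> geodesic_ball K p R" using x ex_in_space_form by (simp add: geodesic_ball_def)
qed

text \<open>Exhibits the ball as the trace of an open set of the ambient space, the form in which
  jets and conformal solutions are handled. It rests on the monotonicity of the chord in the
  radius.\<close>

lemma geodesic_ball_eq_chord2:
  assumes "R > 0" "K > 0 \<longrightarrow> R < pi / sqrt K"
  shows "geodesic_ball K p R = space_form K \<inter> {x. chord2 K x p < 4 * (sn K (R/2))\<^sup>2}"
proof (intro equalityI subsetI)
  fix x assume "x \<in> geodesic_ball K p R"
  then obtain r \<theta> where x: "x = ex r \<theta>" "0 \<le> r" "r < R" "norm \<theta> = 1" using geodesic_ball_eq[OF assms] by blast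
  then show "x \<in> space_form K \<inter> {x. chord2 K x p < 4 * (sn K (R/2))\<^sup>2}"
    using ex_in_space_form chord2_ex_p sn_half_square_less[of r R K] assms by auto
next
  fix x assume x: "x \<in> space_form K \<inter> {x. chord2 K x p < 4 * (sn K (R/2))\<^sup>2}"
  then obtain r \<theta> where r: "0 \<le> r" "K > 0 \<longrightarrow> r \<le> pi / sqrt K" "norm \<theta> = 1" "x = ex r \<theta>"
    using ex_surj[of x] by blast
  have "r < R"
  proof (rule ccontr)
    assume "\<not> r < R"
    then have "(sn K (R/2))\<^sup>2 \<le> (sn K (r/2))\<^sup>2"
      using sn_half_square_less[of R r K] r assms by (cases "r = R") auto
    then show False using x r chord2_ex_p[of \<theta> r] by simp
  qed
  then show "x \<in> geodesic_ball K p R" using r geodesic_ball_eq[OF assms] by blast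
qed

lemma surface_integral_eq:
  fixes f :: "real \<times> 'a \<Rightarrow> real"
  assumes R: "R > 0" "K > 0 \<longrightarrow> R < pi / sqrt K" and f: "continuous_on (geodesic_sphere K p R) f"
  shows "(LINT y:geodesic_sphere K p R|surface_measure K p R. f y)
    = DIM('a) * sn K R ^ (DIM('a) - 1) * sphere_integral (\<lambda>\<omega>. f (ex R \<omega>))"
proof -
  let ?S = "geodesic_sphere K p R" and ?Y = "\<lambda>v. cs K R *\<^sub>R p + L v"
  have \<rho>: "sn K R > 0" by (rule sn_pos[OF R])
  have S: "?S = ex R ` sphere 0 1" by (rule geodesic_sphere_eq[OF R])
  have "compact ?S" unfolding S by (intro compact_continuous_image continuous_intros) auto
  then have [measurable]: "?S \<in> sets borel" by (simp add: borel_compact)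
  have gm: "(\<lambda>x. indicator ?S x *\<^sub>R f x) \<in> borel_measurable borel"
    by (rule borel_measurable_continuous_on_indicator[OF _ f]) simp
  have Ym: "?Y \<in> borel_measurable borel"
    by (intro borel_measurable_continuous_onI continuous_intros bounded_linear.continuous_on[OF bounded_linear_L])
  \<comment> \<open>The vector 0 corresponds to the Euclidean centre of the sphere, which is off the
    sphere as \<open>sn K R > 0\<close>; hence the integrand vanishes at 0.\<close>
  have "cs K R *\<^sub>R p + L 0 \<notin> ?S"
  proof
    assume "cs K R *\<^sub>R p + L 0 \<in> ?S"
    then obtain \<omega> where \<omega>: "norm \<omega> = 1" "L 0 = sn K R *\<^sub>R L \<omega>" unfolding S by (auto simp: ex_def)
    then have "0 = sn K R *\<^sub>R \<omega>" by (intro inj_L) (simp add: L_scaleR)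
    then have "norm (sn K R *\<^sub>R \<omega>) = 0" by (metis norm_zero)
    then show False using \<rho> \<omega>(1) by simp
  qed
  moreover have Yex: "?Y (sn K R *\<^sub>R \<omega>) = ex R \<omega>" for \<omega> by (simp add: ex_def L_scaleR)
  moreover have exS: "ex R \<omega> \<in> ?S" if "norm \<omega> = 1" for \<omega> unfolding S using that by auto
  moreover have c: "continuous_on (sphere 0 1) (\<lambda>\<omega>. f (ex R \<omega>))"
    by (rule continuous_on_compose2[OF f]) (auto intro!: continuous_intros exS)
  moreover have "continuous_on (sphere 0 1) (\<lambda>\<omega>. indicator ?S (ex R \<omega>) *\<^sub>R f (ex R \<omega>))"
    by (rule continuous_on_eq[OF c]) (auto simp: exS)
  ultimately have "(LINT v|euclidean_sphere_measure (sn K R). indicator ?S (?Y v) *\<^sub>R f (?Y v))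
     = DIM('a) * sn K R ^ (DIM('a) - 1) * sphere_integral (\<lambda>\<omega>. indicator ?S (?Y (sn K R *\<^sub>R \<omega>)) *\<^sub>R f (?Y (sn K R *\<^sub>R \<omega>)))"
    by (intro integral_euclidean_sphere_measure[OF \<rho>] measurable_compose[OF Ym gm]) (simp_all add: Yex)
  also have "sphere_integral (\<lambda>\<omega>. indicator ?S (?Y (sn K R *\<^sub>R \<omega>)) *\<^sub>R f (?Y (sn K R *\<^sub>R \<omega>))) = sphere_integral (\<lambda>\<omega>. f (ex R \<omega>))"
    by (rule sphere_integral_cong) (simp add: Yex exS)
  also have "(LINT v|euclidean_sphere_measure (sn K R). indicator ?S (?Y v) *\<^sub>R f (?Y v))
     = (LINT y:?S|surface_measure K p R. f y)"
    unfolding set_lebesgue_integral_def surface_measure_def L_def[symmetric]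
    by (rule integral_distr[symmetric, OF _ gm]) (use Ym in \<open>simp add: euclidean_sphere_measure_def\<close>)
  finally show ?thesis .
qed

end

section \<open>Functions of chord lengths\<close>

text \<open>One family containing the radial solution \<open>h\<close>, the subsolution
  \<open>g\<close> and the Poisson kernel: an affine function of one squared chord times a power of
  an affine function of another. A single computation of the Laplacian serves all three.\<close>

definition chord_fun where
  "chord_fun K p y c0 c1 d0 d1 a x = (c0 + c1 * chord2 K x p) * (d0 + d1 * chord2 K x y) powr (- a)"

definition chord_grad where
  "chord_grad K p y c0 c1 d0 d1 a x =
     (2 * c1 * (d0 + d1 * chord2 K x y) powr (- a)) *\<^sub>R riem_dual K (x - p)
     - (2 * a * d1 * (c0 + c1 * chord2 K x p) * (d0 + d1 * chord2 K x y) powr (- a - 1)) *\<^sub>R riem_dual K (x - y)"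

definition chord_hess where
  "chord_hess K p y c0 c1 d0 d1 a x h =
     (2 * c1 * (d0 + d1 * chord2 K x y) powr (- a)) *\<^sub>R riem_dual K h
     - (4 * a * c1 * d1 * (d0 + d1 * chord2 K x y) powr (- a - 1) * riem K (x - y) h) *\<^sub>R riem_dual K (x - p)
     - (2 * a * d1 * (c0 + c1 * chord2 K x p) * (d0 + d1 * chord2 K x y) powr (- a - 1)) *\<^sub>R riem_dual K h
     - (4 * a * c1 * d1 * (d0 + d1 * chord2 K x y) powr (- a - 1) * riem K (x - p) h) *\<^sub>R riem_dual K (x - y)
     + (4 * a * (a + 1) * d1\<^sup>2 * (c0 + c1 * chord2 K x p) * (d0 + d1 * chord2 K x y) powr (- a - 2) * riem K (x - y) h)
         *\<^sub>R riem_dual K (x - y)"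

lemma has_derivative_chord2 [derivative_intros]:
  "((\<lambda>x. chord2 K x y) has_derivative (\<lambda>h. 2 * riem K (x - y) h)) (at x)"
proof -
  have "((\<lambda>x. x - y) has_derivative (\<lambda>h. h)) (at x)" by (auto intro!: derivative_eq_intros)
  from riem.FDERIV[OF this this] show ?thesis
    unfolding chord2_def by (rule has_derivative_eq_rhs) (simp add: fun_eq_iff riem_sym)
qed

lemma has_derivative_powr_chord2:
  assumes "d0 + d1 * chord2 K x y > 0"
  shows "((\<lambda>x. (d0 + d1 * chord2 K x y) powr b) has_derivative
     (\<lambda>h. b * (d0 + d1 * chord2 K x y) powr (b - 1) * (d1 * (2 * riem K (x - y) h)))) (at x)"
proof -
  have "((\<lambda>t. t powr b) has_derivative (\<lambda>h. h * (b * (d0 + d1 * chord2 K x y) powr (b - 1)))) (at (d0 + d1 * chord2 K x y))"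
    using has_real_derivative_powr[OF assms, of b] unfolding has_field_derivative_def
    by (rule has_derivative_eq_rhs) (simp add: fun_eq_iff)
  moreover have "((\<lambda>x. d0 + d1 * chord2 K x y) has_derivative (\<lambda>h. d1 * (2 * riem K (x - y) h))) (at x)"
    by (auto intro!: derivative_eq_intros)
  ultimately have "((\<lambda>x. (d0 + d1 * chord2 K x y) powr b) has_derivative
     (\<lambda>h. d1 * (2 * riem K (x - y) h) * (b * (d0 + d1 * chord2 K x y) powr (b - 1)))) (at x)"
    using has_derivative_compose[of "\<lambda>x. d0 + d1 * chord2 K x y"] by blast
  then show ?thesis by (rule has_derivative_eq_rhs) (simp add: fun_eq_iff)
qed

lemma has_derivative_chord_fun:
  assumes "d0 + d1 * chord2 K x y > 0"
  shows "(chord_fun K p y c0 c1 d0 d1 a has_derivative (\<lambda>h. chord_grad K p y c0 c1 d0 d1 a x \<bullet> h)) (at x)"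
  unfolding chord_fun_def[abs_def]
proof -
  have A: "((\<lambda>x. c0 + c1 * chord2 K x p) has_derivative (\<lambda>h. c1 * (2 * riem K (x - p) h))) (at x)"
    by (auto intro!: derivative_eq_intros)
  show "((\<lambda>x. (c0 + c1 * chord2 K x p) * (d0 + d1 * chord2 K x y) powr - a) has_derivative
     (\<lambda>h. chord_grad K p y c0 c1 d0 d1 a x \<bullet> h)) (at x)"
    by (rule has_derivative_eq_rhs[OF has_derivative_mult[OF A has_derivative_powr_chord2[OF assms]]])
      (simp add: fun_eq_iff chord_grad_def inner_diff_left riem_eq_inner[symmetric] algebra_simps)
qed

lemma has_derivative_chord_grad:
  assumes "d0 + d1 * chord2 K x y > 0"
  shows "(chord_grad K p y c0 c1 d0 d1 a has_derivative chord_hess K p y c0 c1 d0 d1 a x) (at x)"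
proof -
  let ?B = "\<lambda>x. d0 + d1 * chord2 K x y"
  have rd: "((\<lambda>x. riem_dual K (x - z)) has_derivative riem_dual K) (at x)" for z
    by (rule has_derivative_eq_rhs, rule bounded_linear.has_derivative[OF bounded_linear_riem_dual])
       (auto intro!: derivative_eq_intros)
  have 1: "((\<lambda>x. (2 * c1 * ?B x powr (- a)) *\<^sub>R riem_dual K (x - p)) has_derivative
     (\<lambda>h. (2 * c1 * ?B x powr (- a)) *\<^sub>R riem_dual K h
       + (2 * c1 * (- a * ?B x powr (- a - 1) * (d1 * (2 * riem K (x - y) h)))) *\<^sub>R riem_dual K (x - p))) (at x)"
    by (rule has_derivative_scaleR[OF has_derivative_mult_right[OF has_derivative_powr_chord2[OF assms]] rd])
  have A: "((\<lambda>x. 2 * a * d1 * (c0 + c1 * chord2 K x p)) has_derivative (\<lambda>h. 2 * a * d1 * (c1 * (2 * riem K (x - p) h)))) (at x)"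
    by (auto intro!: derivative_eq_intros)
  have 2: "((\<lambda>x. (2 * a * d1 * (c0 + c1 * chord2 K x p) * ?B x powr (- a - 1)) *\<^sub>R riem_dual K (x - y)) has_derivative
     (\<lambda>h. (2 * a * d1 * (c0 + c1 * chord2 K x p) * ?B x powr (- a - 1)) *\<^sub>R riem_dual K h
       + (2 * a * d1 * (c0 + c1 * chord2 K x p) * ((- a - 1) * ?B x powr (- a - 1 - 1) * (d1 * (2 * riem K (x - y) h)))
          + 2 * a * d1 * (c1 * (2 * riem K (x - p) h)) * ?B x powr (- a - 1)) *\<^sub>R riem_dual K (x - y))) (at x)"
    by (rule has_derivative_scaleR[OF has_derivative_mult[OF A has_derivative_powr_chord2[OF assms]] rd])
  have e: "- a - 1 - 1 = - a - (2::real)" by simp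
  show ?thesis unfolding chord_grad_def[abs_def]
    by (rule has_derivative_eq_rhs[OF has_derivative_diff[OF 1 2]], unfold e)
       (simp add: fun_eq_iff chord_hess_def algebra_simps power2_eq_square)
qed

lemma continuous_on_chord2 [continuous_intros]:
  "continuous_on S f \<Longrightarrow> continuous_on S g \<Longrightarrow> continuous_on S (\<lambda>s. chord2 K (f s) (g s))"
  unfolding chord2_def by (intro riem.continuous_on continuous_intros)

lemma continuous_on_riem_dual [continuous_intros]:
  "continuous_on S f \<Longrightarrow> continuous_on S (\<lambda>s. riem_dual K (f s))"
  by (rule bounded_linear.continuous_on[OF bounded_linear_riem_dual])

lemma
  assumes "continuous_on S f" "continuous_on S g" "\<And>s. s \<in> S \<Longrightarrow> d0 + d1 * chord2 K (f s) (g s) > 0"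
  shows continuous_on_chord_fun: "continuous_on S (\<lambda>s. chord_fun K p (g s) c0 c1 d0 d1 a (f s))"
    and continuous_on_chord_grad: "continuous_on S (\<lambda>s. chord_grad K p (g s) c0 c1 d0 d1 a (f s))"
    and continuous_on_chord_hess: "continuous_on S (\<lambda>s. chord_hess K p (g s) c0 c1 d0 d1 a (f s) h)"
  unfolding chord_fun_def chord_grad_def chord_hess_def
  by (intro continuous_intros riem.continuous_on assms; use assms(3) in force)+

lemma has_jet_chord_fun:
  assumes x: "d0 + d1 * chord2 K x y > 0"
  shows "has_jet K (chord_fun K p y c0 c1 d0 d1 a) x (\<lambda>h. chord_grad K p y c0 c1 d0 d1 a x \<bullet> h)
    (\<lambda>v w. chord_hess K p y c0 c1 d0 d1 a x v \<bullet> w)"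
proof (rule has_jetI[where U = "{x. d0 + d1 * chord2 K x y > 0}"])
  show "open {x. d0 + d1 * chord2 K x y > 0}"
    by (intro open_Collect_less continuous_intros)
qed (use x in \<open>auto intro!: has_derivative_chord_fun has_derivative_chord_grad continuous_on_chord_hess continuous_intros\<close>)

definition jet_laplacian :: "real \<Rightarrow> real \<times> 'a::euclidean_space \<Rightarrow> (real \<times> 'a \<Rightarrow> real)
    \<Rightarrow> (real \<times> 'a \<Rightarrow> real \<times> 'a \<Rightarrow> real) \<Rightarrow> real" where
  "jet_laplacian K x D D2 = (\<Sum>e \<in> (SOME B. orthonormal_basis K x B). D2 e e) - real DIM('a) * K * D x"

lemma jet_laplacian_lincomb:
  "jet_laplacian K x (\<lambda>v. a * D v + b * E v) (\<lambda>v w. a * D2 v w + b * E2 v w)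
    = a * jet_laplacian K x D D2 + b * jet_laplacian K x E E2"
  by (simp add: jet_laplacian_def sum.distrib sum_distrib_left algebra_simps)

text \<open>The traces over an orthonormal basis are inner products of projected chords, which
  \<open>riem_tproj_diff_diff\<close> expresses by squared chords. With the common power P factored
  out, the bracket is polynomial, so each differential equation becomes a polynomial
  identity.\<close>

lemma jet_laplacian_chord_fun:
  fixes x y p :: "real \<times> 'a::euclidean_space" and c0 c1 d0 d1 a :: real
  assumes x: "x \<in> space_form K" and p: "p \<in> space_form K" and y: "y \<in> space_form K"
    and B: "B > 0" "B = d0 + d1 * chord2 K x y"
  defines "n \<equiv> real DIM('a)" and "A \<equiv> c0 + c1 * chord2 K x p"
    and "P \<equiv> B powr (- a - 2)"
  shows "jet_laplacian K x (\<lambda>h. chord_grad K p y c0 c1 d0 d1 a x \<bullet> h) (\<lambda>v w. chord_hess K p y c0 c1 d0 d1 a x v \<bullet> w)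
    = P * (n * c1 * B\<^sup>2 * (2 - K * chord2 K x p) - n * a * d1 * A * B * (2 - K * chord2 K x y)
       - 2 * a * c1 * d1 * B * (2 * (chord2 K x p + chord2 K x y - chord2 K p y) - K * chord2 K x p * chord2 K x y)
       + a * (a + 1) * d1\<^sup>2 * A * (4 * chord2 K x y - K * (chord2 K x y)\<^sup>2))"
proof -
  define E where "E = (SOME E. orthonormal_basis K x E)"
  have E: "orthonormal_basis K x E" unfolding E_def using ex_orthonormal_basis[OF x] by (rule someI_ex)
  have Et: "E \<subseteq> tangent K x" using E span_superset[of E] by (simp add: orthonormal_basis_def)
  have ee: "riem K e e = 1" if "e \<in> E" for e using E that by (simp add: orthonormal_basis_def)
  note Es = orthonormal_basis_sum[OF x E]
  have S: "(\<Sum>e\<in>E. riem K (x - y) e * riem K (x - z) e)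
     = (chord2 K x y + chord2 K x z - chord2 K y z) / 2 - K * chord2 K x y * chord2 K x z / 4"
    if y: "y \<in> space_form K" and z: "z \<in> space_form K" for y z
  proof -
    have "(\<Sum>e\<in>E. riem K (x - y) e * riem K (x - z) e)
       = (\<Sum>e\<in>E. riem K (tproj K x (x - y)) e * riem K (tproj K x (x - z)) e)"
      using Et by (intro sum.cong refl) (auto simp: riem_tproj[OF x])
    also have "\<dots> = riem K (tproj K x (x - y)) (tproj K x (x - z))"
      by (intro Es(3) tproj_tangent x fst_diff_space_form y z)
    finally show ?thesis by (simp add: riem_tproj_diff_diff[OF x y z])
  qed
  have P1: "B powr (- a - 1) = P * B"
  proof -
    have "- a - 1 = (- a - 2) + 1" by simp
    then show ?thesis using B(1) by (simp only: P_def powr_add) simp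
  qed
  have P0: "B powr (- a) = P * B\<^sup>2"
    using powr_add[of B "- a - 2" 2] B(1) by (simp add: P_def)
  let ?qp = "chord2 K x p" and ?qy = "chord2 K x y"
  have "(\<Sum>e\<in>E. chord_hess K p y c0 c1 d0 d1 a x e \<bullet> e)
    = (\<Sum>e\<in>E. (2 * c1 * (P * B\<^sup>2) - 2 * a * d1 * A * (P * B))
        - (8 * a * c1 * d1 * (P * B)) * (riem K (x - p) e * riem K (x - y) e)
        + (4 * a * (a + 1) * d1\<^sup>2 * A * P) * (riem K (x - y) e * riem K (x - y) e))"
    by (intro sum.cong refl)
       (simp add: chord_hess_def inner_diff_left inner_add_left riem_eq_inner[symmetric] ee
         B(2)[symmetric] P0 P1 P_def[symmetric] A_def[symmetric] algebra_simps)
  also have "\<dots> = n * (2 * c1 * (P * B\<^sup>2) - 2 * a * d1 * A * (P * B))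
        - (8 * a * c1 * d1 * (P * B)) * (\<Sum>e\<in>E. riem K (x - p) e * riem K (x - y) e)
        + (4 * a * (a + 1) * d1\<^sup>2 * A * P) * (\<Sum>e\<in>E. riem K (x - y) e * riem K (x - y) e)"
    by (simp add: sum.distrib sum_subtractf sum_distrib_left Es(2) n_def)
  also have "\<dots> = n * (2 * c1 * (P * B\<^sup>2) - 2 * a * d1 * A * (P * B))
        - (8 * a * c1 * d1 * (P * B)) * ((?qp + ?qy - chord2 K p y) / 2 - K * ?qp * ?qy / 4)
        + (4 * a * (a + 1) * d1\<^sup>2 * A * P) * (?qy - K * ?qy\<^sup>2 / 4)"
    unfolding S[OF p y] S[OF y y] by (simp add: power2_eq_square)
  finally have s: "(\<Sum>e\<in>E. chord_hess K p y c0 c1 d0 d1 a x e \<bullet> e) = \<dots>" .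
  have "K * (chord_grad K p y c0 c1 d0 d1 a x \<bullet> x)
     = 2 * c1 * (P * B\<^sup>2) * (K * riem K (x - p) x) - 2 * a * d1 * A * (P * B) * (K * riem K (x - y) x)"
    by (simp add: chord_grad_def inner_diff_left riem_eq_inner[symmetric]
         B(2)[symmetric] P0 P1 A_def[symmetric] algebra_simps)
  also have "\<dots> = 2 * c1 * (P * B\<^sup>2) * (K * ?qp / 2) - 2 * a * d1 * A * (P * B) * (K * ?qy / 2)"
    by (simp only: K_riem_diff[OF x p] K_riem_diff[OF x y])
  finally have t: "K * (chord_grad K p y c0 c1 d0 d1 a x \<bullet> x) = \<dots>" .
  show ?thesis
    unfolding jet_laplacian_def E_def[symmetric] s mult.assoc t n_def[symmetric]
    by (simp add: field_simps power2_eq_square)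
qed

section \<open>Interior maxima and conformal solutions\<close>

lemma second_derivative_local_max:
  fixes f g :: "real \<Rightarrow> real"
  assumes d: "d > 0" and f: "\<And>s. \<bar>s\<bar> < d \<Longrightarrow> (f has_real_derivative g s) (at s)"
    and g: "(g has_real_derivative c) (at 0)" and max: "\<And>s. \<bar>s\<bar> < d \<Longrightarrow> f s \<le> f 0"
  shows "c \<le> 0"
proof (rule ccontr)
  assume "\<not> c \<le> 0"
  then have c: "c > 0" by simp
  have g0: "g 0 = 0" by (rule DERIV_local_max[OF f d]) (use d max in auto)
  obtain d' where d': "d' > 0" "\<And>h. 0 < h \<Longrightarrow> h < d' \<Longrightarrow> g 0 < g (0 + h)"
    using DERIV_pos_inc_right[OF g c] by blast
  define h where "h = min d d' / 2"
  have h: "0 < h" "h < d" "h < d'" using d d' by (auto simp: h_def)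
  obtain z where z: "0 < z" "z < h" "f h - f 0 = (h - 0) * g z"
    using MVT2[of 0 h f g] h f by auto
  then have "f h - f 0 > 0" using d'(2)[of z] h g0 by simp
  then show False using max[of h] h by simp
qed

text \<open>Each summand \<open>D2 e e - K * D x\<close> of the Laplacian is the second derivative
  along the geodesic in direction e, because the acceleration at 0 is - K x; at a maximum all of
  them are nonpositive.\<close>

lemma jet_laplacian_local_max:
  fixes x :: "real \<times> 'a::euclidean_space"
  assumes jet: "has_jet K f x D D2" and x: "x \<in> space_form K"
    and V: "open V" "x \<in> V" "\<And>y. y \<in> V \<Longrightarrow> y \<in> space_form K \<Longrightarrow> f y \<le> f x"
  shows "jet_laplacian K x D D2 \<le> 0"
proof -
  obtain U F and F' :: "real \<times> 'a \<Rightarrow> (real \<times> 'a) \<Rightarrow>\<^sub>L real" and F'' where U: "open U" "x \<in> U"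
     "\<forall>y \<in> U. (F has_derivative blinfun_apply (F' y)) (at y)"
     "\<forall>y \<in> U. (F' has_derivative blinfun_apply (F'' y)) (at y)"
     "\<forall>y \<in> U \<inter> space_form K. F y = f y"
     "D = blinfun_apply (F' x)" "D2 = (\<lambda>v. blinfun_apply (blinfun_apply (F'' x) v))"
    using jet unfolding has_jet_def by blast
  define E where "E = (SOME E. orthonormal_basis K x E)"
  have E: "orthonormal_basis K x E" unfolding E_def using ex_orthonormal_basis[OF x] by (rule someI_ex)
  have Et: "E \<subseteq> tangent K x" using E span_superset[of E] by (simp add: orthonormal_basis_def)
  have ee: "riem K e e = 1" if "e \<in> E" for e using E that by (simp add: orthonormal_basis_def)
  have "D2 e e - K * D x \<le> 0" if e: "e \<in> E" for e
  proof -
    let ?\<gamma> = "geo K x e"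
    define v where "v s = (- K * sn K s) *\<^sub>R x + cs K s *\<^sub>R e" for s
    have \<gamma>: "(?\<gamma> has_vector_derivative v s) (at s)" for s
      unfolding v_def by (rule has_vector_derivative_geo)
    have "open (?\<gamma> -` (U \<inter> V))" using continuous_on_geo[of UNIV K x e] U(1) V(1)
      by (intro open_vimage open_Int) auto
    moreover have "0 \<in> ?\<gamma> -` (U \<inter> V)" using U V by simp
    ultimately obtain d where d: "d > 0" "ball 0 d \<subseteq> ?\<gamma> -` (U \<inter> V)" by (meson open_contains_ball)
    have inUV: "?\<gamma> s \<in> U" "?\<gamma> s \<in> V" if "\<bar>s\<bar> < d" for s using d(2) that by (auto simp: subset_eq)
    show ?thesis
    proof (rule second_derivative_local_max[OF d(1)])
      fix s :: real assume s: "\<bar>s\<bar> < d"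
      have "(F has_derivative F' (?\<gamma> s)) (at (?\<gamma> s))" using U(3) inUV[OF s] by blast
      then have "((\<lambda>s. F (?\<gamma> s)) has_derivative (\<lambda>h. F' (?\<gamma> s) (h *\<^sub>R v s))) (at s)"
        using has_derivative_compose[OF \<gamma>[unfolded has_vector_derivative_def]] by blast
      then show "((\<lambda>s. F (?\<gamma> s)) has_real_derivative F' (?\<gamma> s) (v s)) (at s)"
        by (simp add: has_field_derivative_def blinfun.scaleR_right mult.commute[of _ "F' (?\<gamma> s) (v s)"])
      have m: "?\<gamma> s \<in> space_form K" using geo_in_space_form[OF x _ ee[OF e]] e Et by blast
      then have "F (?\<gamma> s) = f (?\<gamma> s)" "F x = f x" using U(2,5) inUV[OF s] x by blast+
      then show "F (?\<gamma> s) \<le> F (?\<gamma> 0)" using V(3)[OF inUV(2)[OF s] m] by simp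
    next
      have F': "((\<lambda>s. F' (?\<gamma> s)) has_derivative (\<lambda>h. F'' x (h *\<^sub>R e))) (at 0)"
        using has_derivative_compose[OF \<gamma>[of 0, unfolded has_vector_derivative_def], of F' "F'' x"] U(2,4)
        by (simp add: v_def)
      have v: "(v has_derivative (\<lambda>h. h *\<^sub>R (- K *\<^sub>R x))) (at 0)"
      proof -
        have "(v has_vector_derivative (- K * cs K 0) *\<^sub>R x + (- K * sn K 0) *\<^sub>R e) (at 0)"
          unfolding v_def[abs_def] by (auto intro!: derivative_eq_intros)
        then show ?thesis by (simp add: has_vector_derivative_def)
      qed
      have "((\<lambda>s. F' (?\<gamma> s) (v s)) has_derivative (\<lambda>h. F' (?\<gamma> 0) (h *\<^sub>R (- K *\<^sub>R x)) + F'' x (h *\<^sub>R e) (v 0))) (at 0)"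
        by (rule blinfun.FDERIV[OF F' v])
      then show "((\<lambda>s. F' (?\<gamma> s) (v s)) has_real_derivative D2 e e - K * D x) (at 0)"
        unfolding has_field_derivative_def
        by (rule has_derivative_eq_rhs)
           (simp add: fun_eq_iff U(6,7) v_def blinfun.scaleR_right blinfun.scaleR_left blinfun.minus_right algebra_simps)
    qed
  qed
  then have "(\<Sum>e\<in>E. D2 e e - K * D x) \<le> 0" by (rule sum_nonpos)
  then show ?thesis
    using orthonormal_basis_sum[OF x E] by (simp add: jet_laplacian_def E_def[symmetric] sum_subtractf mult.assoc)
qed

lemma conformal_laplacian_has_jet:
  assumes "has_jet K f x D D2" "x \<in> space_form K"
  shows "conformal_laplacian K f x = - jet_laplacian K x D D2 + real DIM('a) * (real DIM('a) - 2) * K / 4 * f (x :: real \<times> 'a::euclidean_space)"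
  by (simp add: conformal_laplacian_def laplace_beltrami_has_jet[OF assms] jet_laplacian_def)

lemma conformal_solution_iff:
  fixes f :: "real \<times> 'a::euclidean_space \<Rightarrow> real"
  assumes "open V"
  shows "conformal_solution K (space_form K \<inter> V) f \<longleftrightarrow> (\<forall>x \<in> space_form K \<inter> V. \<exists>D D2. has_jet K f x D D2 \<and>
     jet_laplacian K x D D2 = real DIM('a) * (real DIM('a) - 2) * K / 4 * f x)"
proof -
  have "(\<exists>D D2. has_jet K f x D D2) \<and> conformal_laplacian K f x = 0 \<longleftrightarrow> (\<exists>D D2. has_jet K f x D D2 \<and>
     jet_laplacian K x D D2 = real DIM('a) * (real DIM('a) - 2) * K / 4 * f x)" if "x \<in> space_form K" for x
    using conformal_laplacian_has_jet[OF _ that, of f] by fastforce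
  then show ?thesis unfolding conformal_solution_def C2_on_iff_has_jet[OF assms] by (simp add: ball_conj_distrib[symmetric])
qed

lemma conformal_solution_lincomb:
  assumes V: "open V" and f: "conformal_solution K (space_form K \<inter> V) f" and g: "conformal_solution K (space_form K \<inter> V) g"
  shows "conformal_solution K (space_form K \<inter> V) (\<lambda>x. a * f x + b * g x)"
  unfolding conformal_solution_iff[OF V]
proof
  fix x assume x: "x \<in> space_form K \<inter> V"
  obtain D D2 E E2 where "has_jet K f x D D2" "has_jet K g x E E2"
    "jet_laplacian K x D D2 = real DIM('a) * (real DIM('a) - 2) * K / 4 * f x"
    "jet_laplacian K x E E2 = real DIM('a) * (real DIM('a) - 2) * K / 4 * g x"
    using f g x unfolding conformal_solution_iff[OF V] by meson
  note D = this
  show "\<exists>D D2. has_jet K (\<lambda>x. a * f x + b * g x) x D D2 \<and>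
     jet_laplacian K x D D2 = real DIM('a) * (real DIM('a) - 2) * K / 4 * (a * f x + b * g x)"
  proof (intro exI conjI)
    show "has_jet K (\<lambda>x. a * f x + b * g x) x (\<lambda>v. a * D v + b * E v) (\<lambda>v w. a * D2 v w + b * E2 v w)"
      by (rule has_jet_lincomb[OF D(1,2)])
    show "jet_laplacian K x (\<lambda>v. a * D v + b * E v) (\<lambda>v w. a * D2 v w + b * E2 v w)
      = real DIM('a) * (real DIM('a) - 2) * K / 4 * (a * f x + b * g x)"
      unfolding jet_laplacian_lincomb D(3,4) by (simp only: distrib_left mult.left_commute)
  qed
qed

lemma conformal_solution_cong:
  assumes V: "open V" and f: "conformal_solution K (space_form K \<inter> V) f" and eq: "\<And>x. x \<in> space_form K \<inter> V \<Longrightarrow> f x = g x"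
  shows "conformal_solution K (space_form K \<inter> V) g"
  unfolding conformal_solution_iff[OF V]
proof
  fix x assume x: "x \<in> space_form K \<inter> V"
  obtain D D2 where D: "has_jet K f x D D2"
    "jet_laplacian K x D D2 = real DIM('a) * (real DIM('a) - 2) * K / 4 * f x"
    using f x unfolding conformal_solution_iff[OF V] by meson
  have "has_jet K g x D D2" by (rule has_jet_cong[OF D(1) V]) (use x eq in auto)
  then show "\<exists>D D2. has_jet K g x D D2 \<and>
     jet_laplacian K x D D2 = real DIM('a) * (real DIM('a) - 2) * K / 4 * g x"
    using D eq[OF x] by auto
qed

text \<open>This and the next two identities are the equations for \<open>h\<close>,
  \<open>g\<close> and the kernel once the common power is removed. Writing K = 4 k clears the
  fractions. The surplus \<open>2 * n * (1 + - (K / 4) * q)\<close> in the second one is what makes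
  \<open>g\<close> a strict subsolution.\<close>

lemma h_jet_identity:
  fixes K m n q :: real
  assumes "n = 2 * m + 2"
  shows "n * m * (K / 4) * (1 + - (K / 4) * q) * (2 - K * q) + m * (m + 1) * (K / 4)\<^sup>2 * (4 * q - K * q\<^sup>2)
     = n * (n - 2) * K / 4 * (1 + - (K / 4) * q)\<^sup>2"
proof -
  define k where "k = K / 4"
  have K: "K = 4 * k" by (simp add: k_def)
  show ?thesis unfolding assms K by simp algebra
qed

lemma g_jet_identity:
  fixes K a n q :: real
  assumes "n = 2 * a"
  shows "n * (1 + - (K / 4) * q)\<^sup>2 * (2 - K * q) + n * a * (K / 4) * q * (1 + - (K / 4) * q) * (2 - K * q)
        + a * (K / 2) * (1 + - (K / 4) * q) * (4 * q - K * q\<^sup>2)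
        + a * (a + 1) * (K / 4)\<^sup>2 * q * (4 * q - K * q\<^sup>2)
     = n * (n - 2) * K / 4 * (q * (1 + - (K / 4) * q)\<^sup>2) + 2 * n * (1 + - (K / 4) * q)"
proof -
  define k where "k = K / 4"
  have K: "K = 4 * k" by (simp add: k_def)
  show ?thesis unfolding assms K by simp algebra
qed

lemma kern_jet_identity:
  fixes K a n q y Q :: real
  assumes "n = 2 * a"
  shows "- n * y\<^sup>2 * (2 - K * q) - n * a * (Q - q) * y * (2 - K * y)
         + n * y * (2 * (q + y - Q) - K * q * y) + a * (a + 1) * (Q - q) * (4 * y - K * y\<^sup>2)
       = n * (n - 2) * K / 4 * ((Q - q) * y\<^sup>2)"
proof -
  define k where "k = K / 4"
  have K: "K = 4 * k" by (simp add: k_def)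
  show ?thesis unfolding assms K by simp algebra
qed

context space_form_point begin

lemma chord2_ex_same:
  assumes "norm \<theta> = 1"
  shows "chord2 K (ex r \<theta>) (ex s \<theta>) = 4 * (sn K ((s - r) / 2))\<^sup>2"
proof -
  define S s' C c where "S = sn K (s/2)" "s' = sn K (r/2)" "C = cs K (s/2)" "c = cs K (r/2)"
  note defs = this
  have C2: "C\<^sup>2 = 1 - K * S\<^sup>2" and c2: "c\<^sup>2 = 1 - K * s'\<^sup>2"
    using cs_sn_square[of K "s/2"] cs_sn_square[of K "r/2"] by (auto simp: defs)
  have "sn K r *\<^sub>R \<theta> - sn K s *\<^sub>R \<theta> = (sn K r - sn K s) *\<^sub>R \<theta>" by (simp add: algebra_simps)
  then have "chord2 K (ex r \<theta>) (ex s \<theta>) = (cs K r - cs K s)\<^sup>2 / K + (sn K r - sn K s)\<^sup>2"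
    using assms by (simp add: chord2_ex)
  also have "cs K r - cs K s = 2 * K * (S\<^sup>2 - s'\<^sup>2)"
    by (simp add: cs_half[of K r] cs_half[of K s] defs algebra_simps)
  also have "(2 * K * (S\<^sup>2 - s'\<^sup>2))\<^sup>2 / K = 4 * K * (S\<^sup>2 - s'\<^sup>2)\<^sup>2"
    by (simp add: power2_eq_square)
  also have "sn K r - sn K s = 2 * (s' * c - S * C)"
    by (simp add: sn_half[of K r] sn_half[of K s] defs)
  also have "4 * K * (S\<^sup>2 - s'\<^sup>2)\<^sup>2 + (2 * (s' * c - S * C))\<^sup>2
     = 4 * (K * (S\<^sup>2 - s'\<^sup>2)\<^sup>2 + (s'\<^sup>2 * c\<^sup>2 - 2 * s' * c * S * C + S\<^sup>2 * C\<^sup>2))"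
    by (simp add: power2_eq_square algebra_simps)
  also have "\<dots> = 4 * (S\<^sup>2 * c\<^sup>2 - 2 * s' * c * S * C + C\<^sup>2 * s'\<^sup>2)"
    unfolding C2 c2 by (simp add: power2_eq_square algebra_simps)
  also have "\<dots> = 4 * (S * c - C * s')\<^sup>2" by (simp add: power2_eq_square algebra_simps)
  also have "S * c - C * s' = sn K ((s - r) / 2)" by (simp add: defs diff_divide_distrib sn_diff)
  finally show ?thesis .
qed

text \<open>The boundary point nearest to a given point lies on the same ray: only the Euclidean
  summand of \<open>chord2_ex\<close> depends on the directions, and the triangle inequality
  minimises it for equal ones.\<close>

lemma chord2_ex_ge:
  assumes "norm \<theta> = 1" "norm \<omega> = 1" "sn K r \<ge> 0" "sn K s \<ge> 0"
  shows "chord2 K (ex r \<theta>) (ex s \<omega>) \<ge> 4 * (sn K ((s - r) / 2))\<^sup>2"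
proof -
  have "\<bar>sn K r - sn K s\<bar> \<le> norm (sn K r *\<^sub>R \<theta> - sn K s *\<^sub>R \<omega>)"
    using norm_triangle_ineq3[of "sn K r *\<^sub>R \<theta>" "sn K s *\<^sub>R \<omega>"] assms by simp
  then have "(sn K r - sn K s)\<^sup>2 \<le> (norm (sn K r *\<^sub>R \<theta> - sn K s *\<^sub>R \<omega>))\<^sup>2"
    by (metis abs_le_square_iff abs_norm_cancel)
  moreover have "sn K r *\<^sub>R \<theta> - sn K s *\<^sub>R \<theta> = (sn K r - sn K s) *\<^sub>R \<theta>" by (simp add: algebra_simps)
  then have "chord2 K (ex r \<theta>) (ex s \<theta>) = (cs K r - cs K s)\<^sup>2 / K + (sn K r - sn K s)\<^sup>2"
    using assms by (simp add: chord2_ex)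
  ultimately show ?thesis unfolding chord2_ex_same[OF assms(1), symmetric] chord2_ex[of r \<theta> s \<omega>] by simp
qed

end

section \<open>The Poisson integral and the Dirichlet problem\<close>

locale space_form_ball = space_form_point K p for K and p :: "real \<times> 'a::euclidean_space" +
  fixes R n :: real
  assumes R: "R > 0" "K > 0 \<longrightarrow> R < pi / sqrt K" and n: "n = real DIM('a)" and dim: "DIM('a) \<ge> 2"
begin

abbreviation B where "B \<equiv> geodesic_ball K p R"
abbreviation S where "S \<equiv> geodesic_sphere K p R"

definition Q :: real where "Q = 4 * (sn K (R/2))\<^sup>2"
definition m :: real where "m = (n - 2) / 2"
definition V :: "(real \<times> 'a) set" where "V = {x. chord2 K x p < Q}"

lemma n_ge_2: "n \<ge> 2"
  using dim n by simp

lemma n_eq: "n = 2 * m + 2" and m_nonneg: "m \<ge> 0"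
  using n_ge_2 by (simp_all add: m_def field_simps)

lemma open_V: "open V"
  unfolding V_def by (intro open_Collect_less continuous_intros)

lemma B_eq: "B = space_form K \<inter> V"
  using geodesic_ball_eq_chord2[OF R] by (simp add: V_def Q_def)

lemma B_ex: "B = {ex r \<theta> | r \<theta>. 0 \<le> r \<and> r < R \<and> norm \<theta> = 1}"
  by (rule geodesic_ball_eq[OF R])

lemma S_ex: "S = ex R ` sphere 0 1"
  by (rule geodesic_sphere_eq[OF R])

lemma B_ex_iff: "x \<in> B \<longleftrightarrow> (\<exists>r \<theta>. x = ex r \<theta> \<and> 0 \<le> r \<and> r < R \<and> norm \<theta> = 1)"
  by (auto simp: B_ex)

lemma ex_R_in_S: "norm \<omega> = 1 \<Longrightarrow> ex R \<omega> \<in> S"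
  by (auto simp: S_ex)

lemma closed_ball_eq: "B \<union> S = (\<lambda>(r, \<theta>). ex r \<theta>) ` ({0..R} \<times> sphere 0 1)"
proof
  show "B \<union> S \<subseteq> (\<lambda>(r, \<theta>). ex r \<theta>) ` ({0..R} \<times> sphere 0 1)"
    using R(1) by (force simp: B_ex S_ex)
  show "(\<lambda>(r, \<theta>). ex r \<theta>) ` ({0..R} \<times> sphere 0 1) \<subseteq> B \<union> S"
  proof
    fix x assume "x \<in> (\<lambda>(r, \<theta>). ex r \<theta>) ` ({0..R} \<times> sphere 0 1)"
    then obtain r \<theta> where x: "x = ex r \<theta>" "0 \<le> r" "r \<le> R" "norm \<theta> = 1" by auto
    show "x \<in> B \<union> S"
    proof (cases "r = R")
      case True
      then show ?thesis using x ex_R_in_S by simp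
    next
      case False
      then have "x \<in> B" unfolding B_ex_iff using x by (intro exI[of _ r] exI[of _ \<theta>]) simp
      then show ?thesis by simp
    qed
  qed
qed

lemma closed_ballE:
  assumes "x \<in> B \<union> S"
  obtains r \<theta> where "x = ex r \<theta>" "0 \<le> r" "r \<le> R" "norm \<theta> = 1"
  using assms unfolding closed_ball_eq by auto

lemma compact_closed_ball: "compact (B \<union> S)"
  unfolding closed_ball_eq split_beta
  by (intro compact_continuous_image compact_Times continuous_intros) auto

lemma closed_ball_subset: "x \<in> B \<union> S \<Longrightarrow> x \<in> space_form K"
  by (auto simp: geodesic_ball_def geodesic_sphere_def)

lemma p_in_B: "p \<in> B"
proof -
  obtain b :: 'a where "b \<in> Basis" using nonempty_Basis by blast
  then show ?thesis unfolding B_ex_iff using R by (intro exI[of _ 0] exI[of _ b]) simp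
qed

lemma rK: "r \<le> R \<Longrightarrow> K > 0 \<longrightarrow> r < pi / sqrt K"
  using R by auto

lemma one_minus_pos:
  assumes "x \<in> B \<union> S"
  shows "1 - K / 4 * chord2 K x p > 0"
proof -
  obtain r \<theta> where r: "x = ex r \<theta>" "0 \<le> r" "r \<le> R" "norm \<theta> = 1" using assms by (rule closed_ballE)
  have "1 - K / 4 * chord2 K x p = (cs K (r/2))\<^sup>2"
    using cs_sn_square[of K "r/2"] by (simp add: r(1) chord2_ex_p[OF r(4)])
  moreover have "cs K (r/2) > 0" using r rK by (intro cs_half_pos) auto
  ultimately show ?thesis by simp
qed

definition h where "h = chord_fun K p p 1 0 1 (- (K / 4)) m"
text \<open>The quotient g / h is q / (1 - K q / 4), that is four times the square of
  \<open>sn K (r / 2) / cs K (r / 2)\<close>: up to scaling the squared radius in stereographic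
  coordinates, the simplest strictly subharmonic function there.\<close>

definition g where "g = chord_fun K p p 0 1 1 (- (K / 4)) (n / 2)"

lemma h_eq: "h x = (1 - K / 4 * chord2 K x p) powr (- m)"
  by (simp add: h_def chord_fun_def)

lemma h_pos: "x \<in> B \<union> S \<Longrightarrow> h x > 0"
  using one_minus_pos[of x] by (simp add: h_eq)

lemma h_p [simp]: "h p = 1"
  by (simp add: h_eq)

lemma continuous_on_h: "continuous_on (B \<union> S) h"
  unfolding h_def by (rule continuous_on_chord_fun) (use one_minus_pos in \<open>auto intro: continuous_intros\<close>)

lemma continuous_on_g: "continuous_on (B \<union> S) g"
  unfolding g_def by (rule continuous_on_chord_fun) (use one_minus_pos in \<open>auto intro: continuous_intros\<close>)

lemma h_jet:
  assumes x: "x \<in> B"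
  shows "\<exists>D D2. has_jet K h x D D2 \<and> jet_laplacian K x D D2 = n * (n - 2) * K / 4 * h x"
proof -
  let ?q = "chord2 K x p"
  have pos: "1 + - (K / 4) * ?q > 0" using one_minus_pos[of x] x by simp
  have xM: "x \<in> space_form K" using x by (auto simp: geodesic_ball_def)
  let ?z = "1 + - (K / 4) * ?q"
  have z2: "?z powr (- m) = ?z powr (- m - 2) * ?z\<^sup>2"
    using powr_add[of ?z "- m - 2" 2] pos by simp
  let ?P = "?z powr (- m - 2)"
  have "jet_laplacian K x (\<lambda>h. chord_grad K p p 1 0 1 (- (K / 4)) m x \<bullet> h) (\<lambda>v w. chord_hess K p p 1 0 1 (- (K / 4)) m x v \<bullet> w)
     = ?P * (n * m * (K / 4) * ?z * (2 - K * ?q) + m * (m + 1) * (K / 4)\<^sup>2 * (4 * ?q - K * ?q\<^sup>2))"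
    unfolding jet_laplacian_chord_fun[OF xM p p pos refl] n[symmetric] by (simp add: algebra_simps)
  also have "n * m * (K / 4) * ?z * (2 - K * ?q) + m * (m + 1) * (K / 4)\<^sup>2 * (4 * ?q - K * ?q\<^sup>2)
     = n * (n - 2) * K / 4 * ?z\<^sup>2"
    by (rule h_jet_identity[OF n_eq])
  also have "?P * (n * (n - 2) * K / 4 * ?z\<^sup>2) = n * (n - 2) * K / 4 * (?P * ?z\<^sup>2)"
    by (rule mult.left_commute)
  also have "?P * ?z\<^sup>2 = h x" unfolding z2[symmetric] by (simp add: h_eq)
  finally have "jet_laplacian K x (\<lambda>h. chord_grad K p p 1 0 1 (- (K / 4)) m x \<bullet> h) (\<lambda>v w. chord_hess K p p 1 0 1 (- (K / 4)) m x v \<bullet> w)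
     = n * (n - 2) * K / 4 * h x" .
  then show ?thesis unfolding h_def using has_jet_chord_fun[OF pos] by blast
qed

lemma g_jet:
  assumes x: "x \<in> B"
  shows "\<exists>D D2. has_jet K g x D D2 \<and> jet_laplacian K x D D2 > n * (n - 2) * K / 4 * g x"
proof -
  let ?q = "chord2 K x p"
  have pos: "1 + - (K / 4) * ?q > 0" using one_minus_pos[of x] x by simp
  have xM: "x \<in> space_form K" using x by (auto simp: geodesic_ball_def)
  let ?z = "1 + - (K / 4) * ?q"
  let ?a = "n / 2"
  have z2: "?z powr (- ?a) = ?z powr (- ?a - 2) * ?z\<^sup>2"
    using powr_add[of ?z "- ?a - 2" 2] pos by simp
  let ?P = "?z powr (- ?a - 2)"
  have "jet_laplacian K x (\<lambda>h. chord_grad K p p 0 1 1 (- (K / 4)) ?a x \<bullet> h) (\<lambda>v w. chord_hess K p p 0 1 1 (- (K / 4)) ?a x v \<bullet> w)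
     = ?P * (n * ?z\<^sup>2 * (2 - K * ?q) + n * ?a * (K / 4) * ?q * ?z * (2 - K * ?q)
        + ?a * (K / 2) * ?z * (4 * ?q - K * ?q\<^sup>2)
        + ?a * (?a + 1) * (K / 4)\<^sup>2 * ?q * (4 * ?q - K * ?q\<^sup>2))"
    unfolding jet_laplacian_chord_fun[OF xM p p pos refl] n[symmetric] by (simp add: algebra_simps power2_eq_square)
  also have "n * ?z\<^sup>2 * (2 - K * ?q) + n * ?a * (K / 4) * ?q * ?z * (2 - K * ?q)
        + ?a * (K / 2) * ?z * (4 * ?q - K * ?q\<^sup>2)
        + ?a * (?a + 1) * (K / 4)\<^sup>2 * ?q * (4 * ?q - K * ?q\<^sup>2)
     = n * (n - 2) * K / 4 * (?q * ?z\<^sup>2) + 2 * n * ?z"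
    by (rule g_jet_identity) simp
  also have "?P * (n * (n - 2) * K / 4 * (?q * ?z\<^sup>2) + 2 * n * ?z)
     = n * (n - 2) * K / 4 * (?q * (?P * ?z\<^sup>2)) + ?P * (2 * n * ?z)"
    by (simp only: distrib_left mult.left_commute)
  also have "?q * (?P * ?z\<^sup>2) = g x" unfolding z2[symmetric] by (simp add: g_def chord_fun_def)
  finally have l: "jet_laplacian K x (\<lambda>h. chord_grad K p p 0 1 1 (- (K / 4)) ?a x \<bullet> h) (\<lambda>v w. chord_hess K p p 0 1 1 (- (K / 4)) ?a x v \<bullet> w)
     = n * (n - 2) * K / 4 * g x + ?P * (2 * n * ?z)" .
  have "?P * (2 * n * ?z) > 0" using pos n_ge_2 by (intro mult_pos_pos) simp_all
  then have "jet_laplacian K x (\<lambda>h. chord_grad K p p 0 1 1 (- (K / 4)) ?a x \<bullet> h) (\<lambda>v w. chord_hess K p p 0 1 1 (- (K / 4)) ?a x v \<bullet> w)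
     > n * (n - 2) * K / 4 * g x" unfolding l by linarith
  then show ?thesis unfolding g_def using has_jet_chord_fun[OF pos] by blast
qed

lemma conformal_solution_B: "conformal_solution K B f \<longleftrightarrow> (\<forall>x \<in> B. \<exists>D D2. has_jet K f x D D2 \<and>
     jet_laplacian K x D D2 = n * (n - 2) * K / 4 * f x)"
  unfolding B_eq n by (rule conformal_solution_iff[OF open_V])

lemma conformal_solution_h: "conformal_solution K B h"
  unfolding conformal_solution_B using h_jet by blast

text \<open>The function \<open>g\<close> is a strict subsolution, which turns the weak maximum principle into a
  statement about interior maxima of \<open>(w + \<epsilon> g) / h\<close>.\<close>

lemma maximum_principle:
  assumes w: "conformal_solution K B w" and wc: "continuous_on (B \<union> S) w" and w0: "\<And>y. y \<in> S \<Longrightarrow> w y = 0"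
    and x1: "x1 \<in> B"
  shows "w x1 \<le> 0"
proof (rule ccontr)
  assume "\<not> w x1 \<le> 0"
  then have w1: "w x1 > 0" by simp
  have ne: "B \<union> S \<noteq> {}" using x1 by auto
  have "continuous_on (B \<union> S) (\<lambda>x. g x / h x)"
    by (intro continuous_on_divide continuous_on_g continuous_on_h) (use h_pos in force)
  then have "compact ((\<lambda>x. g x / h x) ` (B \<union> S))" by (rule compact_continuous_image[OF _ compact_closed_ball])
  then have "bounded ((\<lambda>x. g x / h x) ` (B \<union> S))" by (rule compact_imp_bounded)
  then obtain G where "\<forall>y \<in> (\<lambda>x. g x / h x) ` (B \<union> S). norm y \<le> G" unfolding bounded_iff by blast
  then have G: "\<bar>g x / h x\<bar> \<le> G" if "x \<in> B \<union> S" for x using that by auto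
  have G0: "G \<ge> 0" using G[of x1] x1 abs_ge_zero order_trans by blast
  define t where "t = w x1 / h x1"
  have t: "t > 0" using w1 h_pos[of x1] x1 by (simp add: t_def)
  \<comment> \<open>Any positive k > G works. Then \<epsilon> G is below t / 2, so the perturbed
    quotient at x1 still exceeds its values on the boundary and its maximum is interior.\<close>
  define k where "k = 2 * G + 1"
  have k: "k > 0" "G < k" using G0 by (simp_all add: k_def)
  define \<epsilon> where "\<epsilon> = t / k / 2"
  have \<epsilon>: "\<epsilon> > 0" using t k by (simp add: \<epsilon>_def)
  have \<epsilon>G: "2 * (\<epsilon> * G) < t"
  proof -
    have "2 * (\<epsilon> * G) = t * (G / k)" by (simp add: \<epsilon>_def)
    also have "\<dots> < t * 1" using t k by (intro mult_strict_left_mono) simp_all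
    finally show ?thesis by simp
  qed
  define f where "f x = w x + \<epsilon> * g x" for x
  have fc: "continuous_on (B \<union> S) (\<lambda>x. f x / h x)"
    unfolding f_def by (intro continuous_intros continuous_on_g continuous_on_h wc) (use h_pos in force)
  obtain x0 where x0: "x0 \<in> B \<union> S" "\<And>x. x \<in> B \<union> S \<Longrightarrow> f x / h x \<le> f x0 / h x0"
    using continuous_attains_sup[OF compact_closed_ball ne fc] by blast
  have "f x1 / h x1 > \<epsilon> * G"
  proof -
    have "f x1 / h x1 = t + \<epsilon> * (g x1 / h x1)" by (simp add: f_def t_def add_divide_distrib)
    moreover have "\<epsilon> * (g x1 / h x1) \<ge> \<epsilon> * (- G)" using abs_le_D2[OF G[of x1]] x1 \<epsilon> by (intro mult_left_mono) auto
    ultimately show ?thesis using \<epsilon>G by simp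
  qed
  then have big: "f x0 / h x0 > \<epsilon> * G" using x0(2)[of x1] x1 by simp
  have "x0 \<notin> S"
  proof
    assume s: "x0 \<in> S"
    then have "f x0 / h x0 = \<epsilon> * (g x0 / h x0)" by (simp add: f_def w0)
    also have "\<dots> \<le> \<epsilon> * G" using abs_le_D1[OF G[of x0]] s \<epsilon> by (intro mult_left_mono) auto
    finally show False using big by simp
  qed
  then have x0B: "x0 \<in> B" using x0 by blast
  have xM: "x0 \<in> space_form K" using x0B by (auto simp: geodesic_ball_def)
  define c where "c = f x0 / h x0"
  obtain D D2 where D: "has_jet K w x0 D D2" "jet_laplacian K x0 D D2 = n * (n - 2) * K / 4 * w x0"
    using w x0B unfolding conformal_solution_B by blast
  obtain E E2 where E: "has_jet K g x0 E E2" "jet_laplacian K x0 E E2 > n * (n - 2) * K / 4 * g x0"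
    using g_jet[OF x0B] by blast
  obtain H H2 where H: "has_jet K h x0 H H2" "jet_laplacian K x0 H H2 = n * (n - 2) * K / 4 * h x0"
    using h_jet[OF x0B] by blast
  \<comment> \<open>Subtracting c h, where c is the maximal quotient, gives a function with an
    interior maximum and the value 0 at x0. The zero-order terms cancel there whatever the sign of
    K, and the strict inequality for g contradicts the sign of the Laplacian.\<close>
  note jets = has_jet_lincomb[OF has_jet_lincomb[OF D(1) E(1), of 1 \<epsilon>] H(1), of 1 "- c"]
  have hp: "h x0 > 0" using h_pos x0 by blast
  have "jet_laplacian K x0 (\<lambda>v. 1 * (1 * D v + \<epsilon> * E v) + - c * H v) (\<lambda>v z. 1 * (1 * D2 v z + \<epsilon> * E2 v z) + - c * H2 v z) \<le> 0"
  proof (rule jet_laplacian_local_max[OF jets xM open_V])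
    show "x0 \<in> V" using x0B by (simp add: B_eq)
    fix y assume "y \<in> V" "y \<in> space_form K"
    then have y: "y \<in> B" by (simp add: B_eq)
    have "f y / h y \<le> c" using x0(2) y by (simp add: c_def)
    then have "f y \<le> c * h y" using h_pos[of y] y by (simp add: field_simps)
    moreover have "f x0 = c * h x0" using hp by (simp add: c_def)
    ultimately show "1 * (1 * w y + \<epsilon> * g y) + - c * h y \<le> 1 * (1 * w x0 + \<epsilon> * g x0) + - c * h x0"
      by (simp add: f_def)
  qed
  then have "jet_laplacian K x0 D D2 + \<epsilon> * jet_laplacian K x0 E E2 - c * jet_laplacian K x0 H H2 \<le> 0"
    unfolding jet_laplacian_lincomb by simp
  moreover have "\<epsilon> * jet_laplacian K x0 E E2 > \<epsilon> * (n * (n - 2) * K / 4 * g x0)"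
    using \<epsilon> E(2) by simp
  ultimately have "n * (n - 2) * K / 4 * w x0 + \<epsilon> * (n * (n - 2) * K / 4 * g x0) - c * (n * (n - 2) * K / 4 * h x0) < 0"
    unfolding D(2) H(2) by linarith
  moreover have "k * a + \<epsilon> * (k * b) - c * (k * d) = k * ((a + \<epsilon> * b) - c * d)" for k a b d :: real
    by (simp add: algebra_simps)
  ultimately have "n * (n - 2) * K / 4 * (f x0 - c * h x0) < 0" by (simp only: f_def)
  then show False using hp by (simp add: c_def)
qed

lemma dirichlet_unique:
  assumes v: "conformal_solution K B v" "continuous_on (B \<union> S) v" and w: "conformal_solution K B w" "continuous_on (B \<union> S) w"
    and eq: "\<And>y. y \<in> S \<Longrightarrow> v y = w y" and x: "x \<in> B"
  shows "v x = w x"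
proof -
  have "(\<lambda>x. 1 * v x + - 1 * w x) x \<le> 0"
    by (rule maximum_principle[OF _ _ _ x])
      (use conformal_solution_lincomb[OF open_V v(1)[unfolded B_eq] w(1)[unfolded B_eq], of 1 "-1"] eq v w
        in \<open>auto simp: B_eq[symmetric] intro!: continuous_intros\<close>)
  moreover have "(\<lambda>x. 1 * w x + - 1 * v x) x \<le> 0"
    by (rule maximum_principle[OF _ _ _ x])
      (use conformal_solution_lincomb[OF open_V w(1)[unfolded B_eq] v(1)[unfolded B_eq], of 1 "-1"] eq v w
        in \<open>auto simp: B_eq[symmetric] intro!: continuous_intros\<close>)
  ultimately show ?thesis by simp
qed

section \<open>The Poisson kernel and its integral\<close>

definition kern :: "'a \<Rightarrow> real \<times> 'a \<Rightarrow> real" where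
  "kern \<omega> = chord_fun K p (ex R \<omega>) Q (-1) 0 1 (n / 2)"

definition kgrad :: "'a \<Rightarrow> real \<times> 'a \<Rightarrow> real \<times> 'a" where
  "kgrad \<omega> = chord_grad K p (ex R \<omega>) Q (-1) 0 1 (n / 2)"

definition khess :: "'a \<Rightarrow> real \<times> 'a \<Rightarrow> real \<times> 'a \<Rightarrow> real \<times> 'a" where
  "khess \<omega> = chord_hess K p (ex R \<omega>) Q (-1) 0 1 (n / 2)"

lemma kern_eq: "kern \<omega> x = (Q - chord2 K x p) * chord2 K x (ex R \<omega>) powr (- (n / 2))"
  by (simp add: kern_def chord_fun_def)

lemma chord2_pos:
  assumes "x \<in> B" "norm \<omega> = 1"
  shows "chord2 K x (ex R \<omega>) > 0"
proof -
  obtain r \<theta> where r: "x = ex r \<theta>" "0 \<le> r" "r < R" "norm \<theta> = 1" using assms B_ex_iff by blast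
  have "sn K r \<ge> 0" using r rK[of r] by (intro sn_nonneg) auto
  moreover have "sn K R \<ge> 0" using R by (intro sn_nonneg) auto
  moreover have "(R - r) / 2 \<le> R" using r R by simp
  then have "sn K ((R - r) / 2) > 0" using r R rK[of "(R - r) / 2"] by (intro sn_pos) auto
  ultimately show ?thesis using chord2_ex_ge[OF r(4) assms(2), of r R] r(1) by (smt (verit) zero_less_power)
qed

lemma chord2_nonneg:
  assumes "x \<in> B \<union> S" "norm \<omega> = 1"
  shows "chord2 K x (ex R \<omega>) \<ge> 0"
proof -
  obtain r \<theta> where r: "x = ex r \<theta>" "0 \<le> r" "r \<le> R" "norm \<theta> = 1" using assms(1) by (rule closed_ballE)
  have "sn K r \<ge> 0" using r rK[of r] by (intro sn_nonneg) auto
  moreover have "sn K R \<ge> 0" using R by (intro sn_nonneg) auto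
  ultimately show ?thesis using chord2_ex_ge[OF r(4) assms(2), of r R] r(1) by (smt (verit) zero_le_power2)
qed

lemma kern_pos: "x \<in> B \<Longrightarrow> norm \<omega> = 1 \<Longrightarrow> kern \<omega> x > 0"
  using chord2_pos[of x \<omega>] by (simp add: kern_eq B_eq V_def)

text \<open>An ambient neighbourhood of the ball on which the kernels for all boundary points are
  smooth simultaneously. It is open because the complement is a projection along the compact
  sphere.\<close>

definition U :: "(real \<times> 'a) set" where "U = {x. \<forall>\<omega> \<in> sphere 0 1. chord2 K x (ex R \<omega>) > 0}"

lemma open_U: "open U"
proof -
  let ?T = "{z. chord2 K (snd z) (ex R (fst z)) \<le> 0}"
  have "closed ?T" by (intro closed_Collect_le continuous_intros)
  then have "closed {x. \<exists>\<omega>. \<omega> \<in> sphere 0 1 \<and> (\<omega>, x) \<in> ?T}"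
    by (rule closed_compact_projection[OF compact_sphere])
  moreover have "U = - {x. \<exists>\<omega>. \<omega> \<in> sphere 0 1 \<and> (\<omega>, x) \<in> ?T}" by (force simp: U_def not_le[symmetric])
  ultimately show ?thesis by (simp add: open_Compl)
qed

lemma B_subset_U: "B \<subseteq> U"
  using chord2_pos by (auto simp: U_def)

lemma U_pos: "x \<in> U \<Longrightarrow> norm \<omega> = 1 \<Longrightarrow> 0 + 1 * chord2 K x (ex R \<omega>) > 0"
  by (simp add: U_def)

lemma continuous_on_kern:
  assumes "continuous_on T f" "continuous_on T e" "\<And>s. s \<in> T \<Longrightarrow> f s \<in> U" "\<And>s. s \<in> T \<Longrightarrow> norm (e s) = 1"
  shows "continuous_on T (\<lambda>s. kern (e s) (f s))" "continuous_on T (\<lambda>s. kgrad (e s) (f s))"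
    "continuous_on T (\<lambda>s. khess (e s) (f s) v)"
  unfolding kern_def kgrad_def khess_def
  by (intro continuous_on_chord_fun continuous_on_chord_grad continuous_on_chord_hess continuous_intros assms U_pos; simp)+

definition W :: "('a \<Rightarrow> real) \<Rightarrow> real \<times> 'a \<Rightarrow> real" where
  "W \<phi> x = sphere_integral (\<lambda>\<omega>. \<phi> \<omega> * kern \<omega> x)"

lemma W_jet:
  assumes \<phi>: "continuous_on (sphere 0 1) \<phi>" and x: "x \<in> U"
  shows "has_jet K (W \<phi>) x (\<lambda>v. sphere_integral (\<lambda>\<omega>. \<phi> \<omega> * (kgrad \<omega> x \<bullet> v)))
     (\<lambda>v w. sphere_integral (\<lambda>\<omega>. \<phi> \<omega> * (khess \<omega> x v \<bullet> w)))"
proof -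
  define G where "G x = sphere_integral (\<lambda>\<omega>. \<phi> \<omega> *\<^sub>R kgrad \<omega> x)" for x
  define H where "H x v = sphere_integral (\<lambda>\<omega>. \<phi> \<omega> *\<^sub>R khess \<omega> x v)" for x v
  have c1: "continuous_on (sphere 0 1) (\<lambda>\<omega>. kern \<omega> x)" "continuous_on (sphere 0 1) (\<lambda>\<omega>. kgrad \<omega> x)"
    "continuous_on (sphere 0 1) (\<lambda>\<omega>. khess \<omega> x v)" if "x \<in> U" for x v
    using that by (auto intro!: continuous_on_kern continuous_intros)
  have G: "G x \<bullet> v = sphere_integral (\<lambda>\<omega>. \<phi> \<omega> * (kgrad \<omega> x \<bullet> v))" if "x \<in> U" for x v
    unfolding G_def using sphere_integral_bounded_linear[OF continuous_on_scaleR[OF \<phi> c1(2)[OF that]] bounded_linear_inner_left, of v]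
    by simp
  have H: "H x v \<bullet> w = sphere_integral (\<lambda>\<omega>. \<phi> \<omega> * (khess \<omega> x v \<bullet> w))" if "x \<in> U" for x v w
    unfolding H_def using sphere_integral_bounded_linear[OF continuous_on_scaleR[OF \<phi> c1(3)[OF that, where v = v]] bounded_linear_inner_left, of w]
    by simp
  have \<phi>2: "continuous_on (U \<times> sphere 0 1) (\<lambda>z. \<phi> (snd z))"
    by (rule continuous_on_compose2[OF \<phi>]) (auto intro!: continuous_intros)
  have W': "(W \<phi> has_derivative (\<lambda>v. G x \<bullet> v)) (at x)" if x: "x \<in> U" for x
  proof -
    have "((\<lambda>x. sphere_integral (\<lambda>\<omega>. \<phi> \<omega> * kern \<omega> x)) has_derivative
       (\<lambda>v. sphere_integral (\<lambda>\<omega>. \<phi> \<omega> * (kgrad \<omega> x \<bullet> v)))) (at x)"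
    proof (rule has_derivative_sphere_integral[OF open_U x])
      fix x \<omega> assume "x \<in> U" "norm (\<omega>::'a) = 1"
      then show "((\<lambda>x. \<phi> \<omega> * kern \<omega> x) has_derivative (\<lambda>v. \<phi> \<omega> * (kgrad \<omega> x \<bullet> v))) (at x)"
        unfolding kern_def kgrad_def by (intro has_derivative_mult_right has_derivative_chord_fun U_pos)
    next
      fix x assume "x \<in> U"
      then show "continuous_on (sphere 0 1) (\<lambda>\<omega>. \<phi> \<omega> * kern \<omega> x)" using c1 \<phi> by (intro continuous_intros)
    next
      fix b :: "real \<times> 'a"
      show "continuous_on (U \<times> sphere 0 1) (\<lambda>(x, \<omega>). \<phi> \<omega> * (kgrad \<omega> x \<bullet> b))"
        unfolding split_beta by (intro continuous_intros \<phi>2 continuous_on_kern) auto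
    qed
    then show ?thesis using G[OF x] by (simp add: W_def[abs_def])
  qed
  have G': "(G has_derivative H x) (at x)" if x: "x \<in> U" for x
    unfolding G_def[abs_def] H_def[abs_def]
  proof (rule has_derivative_sphere_integral[OF open_U x])
    fix x \<omega> assume "x \<in> U" "norm (\<omega>::'a) = 1"
    then show "((\<lambda>x. \<phi> \<omega> *\<^sub>R kgrad \<omega> x) has_derivative (\<lambda>v. \<phi> \<omega> *\<^sub>R khess \<omega> x v)) (at x)"
      unfolding khess_def kgrad_def by (intro has_derivative_scaleR_right has_derivative_chord_grad U_pos)
  next
    fix x assume "x \<in> U"
    then show "continuous_on (sphere 0 1) (\<lambda>\<omega>. \<phi> \<omega> *\<^sub>R kgrad \<omega> x)" using c1 \<phi> by (intro continuous_intros)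
  next
    fix b :: "real \<times> 'a"
    show "continuous_on (U \<times> sphere 0 1) (\<lambda>(x, \<omega>). \<phi> \<omega> *\<^sub>R khess \<omega> x b)"
      unfolding split_beta by (intro continuous_intros \<phi>2 continuous_on_kern) auto
  qed
  have "continuous_on U (\<lambda>x. H x b)" for b
    unfolding H_def
    by (rule continuous_on_sphere_integral, unfold split_beta) (intro continuous_intros \<phi>2 continuous_on_kern; auto)
  from has_jetI[OF open_U x W' G' this, of K "W \<phi>"] show ?thesis
    using G[OF x] H[OF x] by simp
qed

text \<open>The Laplacian is a finite sum and passes under the integral. For the single kernel, the
  boundary point enters through \<open>chord2 K p (ex R \<omega>) = Q\<close>, after which
  \<open>kern_jet_identity\<close> applies.\<close>

lemma conformal_solution_W:
  assumes \<phi>: "continuous_on (sphere 0 1) \<phi>"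
  shows "conformal_solution K B (W \<phi>)"
  unfolding conformal_solution_B
proof
  fix x assume x: "x \<in> B"
  then have xU: "x \<in> U" and xM: "x \<in> space_form K" using B_subset_U closed_ball_subset by auto
  define E where "E = (SOME E. orthonormal_basis K x E)"
  have E: "orthonormal_basis K x E" unfolding E_def using ex_orthonormal_basis[OF xM] by (rule someI_ex)
  have c: "continuous_on (sphere 0 1) (\<lambda>\<omega>. \<phi> \<omega> * (kgrad \<omega> x \<bullet> v))" "continuous_on (sphere 0 1) (\<lambda>\<omega>. \<phi> \<omega> * (khess \<omega> x v \<bullet> w))"
    "continuous_on (sphere 0 1) (\<lambda>\<omega>. \<phi> \<omega> * kern \<omega> x)" for v w
    using xU by (intro continuous_intros \<phi> continuous_on_kern; auto)+
  have "jet_laplacian K x (\<lambda>v. sphere_integral (\<lambda>\<omega>. \<phi> \<omega> * (kgrad \<omega> x \<bullet> v)))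
     (\<lambda>v w. sphere_integral (\<lambda>\<omega>. \<phi> \<omega> * (khess \<omega> x v \<bullet> w)))
    = sphere_integral (\<lambda>\<omega>. (\<Sum>e\<in>E. \<phi> \<omega> * (khess \<omega> x e \<bullet> e)) - n * K * (\<phi> \<omega> * (kgrad \<omega> x \<bullet> x)))"
    unfolding jet_laplacian_def E_def[symmetric] n[symmetric]
    using orthonormal_basis_sum(1)[OF xM E] c
    by (simp add: sphere_integral_diff sphere_integral_sum sphere_integral_mult continuous_intros)
  also have "\<dots> = sphere_integral (\<lambda>\<omega>. (n * (n - 2) * K / 4) * (\<phi> \<omega> * kern \<omega> x))"
  proof (rule sphere_integral_cong)
    fix \<omega> :: 'a assume \<omega>: "norm \<omega> = 1"
    let ?q = "chord2 K x p" and ?y = "chord2 K x (ex R \<omega>)"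
    have y: "ex R \<omega> \<in> space_form K" by (rule ex_in_space_form[OF \<omega>])
    have pos: "?y > 0" by (rule chord2_pos[OF x \<omega>])
    let ?P = "?y powr (- (n / 2) - 2)"
    have y2: "?y powr (- (n / 2)) = ?P * ?y\<^sup>2" using powr_add[of ?y "- (n / 2) - 2" 2] pos by simp
    have py: "chord2 K p (ex R \<omega>) = Q" using chord2_ex_p[OF \<omega>, of R] by (simp add: Q_def chord2_sym)
    have "jet_laplacian K x (\<lambda>v. kgrad \<omega> x \<bullet> v) (\<lambda>v w. khess \<omega> x v \<bullet> w)
      = ?P * (- n * ?y\<^sup>2 * (2 - K * ?q) - n * (n / 2) * (Q - ?q) * ?y * (2 - K * ?y)
         + n * ?y * (2 * (?q + ?y - Q) - K * ?q * ?y) + (n / 2) * (n / 2 + 1) * (Q - ?q) * (4 * ?y - K * ?y\<^sup>2))"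
      unfolding kgrad_def khess_def jet_laplacian_chord_fun[OF xM p y U_pos[OF xU \<omega>] refl] n[symmetric] py by simp
    also have "- n * ?y\<^sup>2 * (2 - K * ?q) - n * (n / 2) * (Q - ?q) * ?y * (2 - K * ?y)
         + n * ?y * (2 * (?q + ?y - Q) - K * ?q * ?y) + (n / 2) * (n / 2 + 1) * (Q - ?q) * (4 * ?y - K * ?y\<^sup>2)
       = n * (n - 2) * K / 4 * ((Q - ?q) * ?y\<^sup>2)"
      by (rule kern_jet_identity) simp
    finally have "jet_laplacian K x (\<lambda>v. kgrad \<omega> x \<bullet> v) (\<lambda>v w. khess \<omega> x v \<bullet> w) = n * (n - 2) * K / 4 * kern \<omega> x"
      by (simp add: kern_eq y2)
    moreover have "(\<Sum>e\<in>E. \<phi> \<omega> * (khess \<omega> x e \<bullet> e)) - n * K * (\<phi> \<omega> * (kgrad \<omega> x \<bullet> x))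
       = \<phi> \<omega> * jet_laplacian K x (\<lambda>v. kgrad \<omega> x \<bullet> v) (\<lambda>v w. khess \<omega> x v \<bullet> w)"
      by (simp add: jet_laplacian_def E_def[symmetric] n[symmetric] sum_distrib_left algebra_simps)
    ultimately show "(\<Sum>e\<in>E. \<phi> \<omega> * (khess \<omega> x e \<bullet> e)) - n * K * (\<phi> \<omega> * (kgrad \<omega> x \<bullet> x))
       = (n * (n - 2) * K / 4) * (\<phi> \<omega> * kern \<omega> x)" by simp
  qed
  also have "\<dots> = n * (n - 2) * K / 4 * W \<phi> x" unfolding W_def using c(3) by (rule sphere_integral_mult)
  finally show "\<exists>D D2. has_jet K (W \<phi>) x D D2 \<and> jet_laplacian K x D D2 = n * (n - 2) * K / 4 * W \<phi> x"
    using W_jet[OF \<phi> xU] by blast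
qed

end

text \<open>On the compact set where f >= \<epsilon> the function \<psi> has a positive minimum, and
  M is the maximum of f divided by it. The lemma replaces splitting the sphere into a part near a
  point and its complement.\<close>

lemma compact_eps_bound:
  fixes f \<psi> :: "'a::t2_space \<Rightarrow> real"
  assumes D: "compact D" and f: "continuous_on D f" and \<psi>: "continuous_on D \<psi>"
    and pos: "\<And>d. d \<in> D \<Longrightarrow> 0 \<le> \<psi> d" and zero: "\<And>d. d \<in> D \<Longrightarrow> \<psi> d = 0 \<Longrightarrow> f d \<le> 0" and \<epsilon>: "\<epsilon> > 0"
  shows "\<exists>M\<ge>0. \<forall>d \<in> D. f d \<le> \<epsilon> + M * \<psi> d"
proof -
  define A where "A = {d \<in> D. \<epsilon> \<le> f d}"
  show ?thesis
  proof (cases "A = {}")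
    case True
    then show ?thesis by (intro exI[of _ 0]) (force simp: A_def)
  next
    case False
    have "closedin (top_of_set D) (D \<inter> f -` {\<epsilon>..})"
      by (rule continuous_closedin_preimage[OF f]) simp
    also have "D \<inter> f -` {\<epsilon>..} = A" by (auto simp: A_def)
    finally have "compact A" using D by (rule closedin_compact[rotated])
    moreover have "continuous_on A \<psi>" by (rule continuous_on_subset[OF \<psi>]) (auto simp: A_def)
    ultimately obtain a where a: "a \<in> A" "\<And>d. d \<in> A \<Longrightarrow> \<psi> a \<le> \<psi> d"
      using continuous_attains_inf[OF _ False] by blast
    have "D \<noteq> {}" using a by (auto simp: A_def)
    then obtain b where b: "b \<in> D" "\<And>d. d \<in> D \<Longrightarrow> f d \<le> f b"
      using continuous_attains_sup[OF D _ f] by blast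
    have "\<psi> a \<noteq> 0" using zero[of a] a \<epsilon> by (auto simp: A_def)
    then have \<psi>a: "\<psi> a > 0" using pos[of a] a by (auto simp: A_def)
    have fb: "f b \<ge> 0" using b(2)[of a] a \<epsilon> by (auto simp: A_def)
    show ?thesis
    proof (intro exI[of _ "f b / \<psi> a"] conjI ballI)
      show "f b / \<psi> a \<ge> 0" using \<psi>a fb by simp
      fix d assume d: "d \<in> D"
      show "f d \<le> \<epsilon> + f b / \<psi> a * \<psi> d"
      proof (cases "d \<in> A")
        case True
        have "f d \<le> f b / \<psi> a * \<psi> a" using b(2)[OF d] \<psi>a by simp
        also have "\<dots> \<le> f b / \<psi> a * \<psi> d" using a(2)[OF True] \<psi>a fb by (intro mult_left_mono) auto
        finally show ?thesis using \<epsilon> by simp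
      next
        case False
        then have "f d < \<epsilon>" using d by (auto simp: A_def)
        moreover have "f b / \<psi> a * \<psi> d \<ge> 0" using \<psi>a fb pos[OF d] by simp
        ultimately show ?thesis by simp
      qed
    qed
  qed
qed

context space_form_ball begin

lemma continuous_on_kern_sphere:
  "x \<in> U \<Longrightarrow> continuous_on (sphere 0 1) (\<lambda>\<omega>. kern \<omega> x)"
  by (rule continuous_on_kern) (auto intro: continuous_intros)

lemma continuous_on_W:
  assumes \<phi>: "continuous_on (sphere 0 1) \<phi>"
  shows "continuous_on U (W \<phi>)"
proof -
  have \<phi>2: "continuous_on (U \<times> sphere 0 1) (\<lambda>z. \<phi> (snd z))"
    by (rule continuous_on_compose2[OF \<phi>]) (auto intro!: continuous_intros)
  show ?thesis unfolding W_def
    by (rule continuous_on_sphere_integral, unfold split_beta) (intro continuous_intros \<phi>2 continuous_on_kern; auto)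
qed

lemma smaller_ball:
  assumes "0 < r" "r \<le> R"
  shows "space_form_ball K p r n"
  using assms R dim n by unfold_locales auto

lemma smaller_ball_subset:
  assumes "0 < r" "r < R"
  shows "geodesic_ball K p r \<union> geodesic_sphere K p r \<subseteq> B"
  using assms by (auto simp: geodesic_ball_def geodesic_sphere_def)

lemma W_1_radial:
  assumes "norm \<theta> = 1" "norm \<theta>' = 1" "ex r \<theta> \<in> B" "ex r \<theta>' \<in> B"
  shows "W (\<lambda>_. 1) (ex r \<theta>) = W (\<lambda>_. 1) (ex r \<theta>')"
proof -
  obtain T where T: "orthogonal_transformation T" "T \<theta> = \<theta>'"
    using ex_orthogonal_transformation[of \<theta> \<theta>'] assms by auto
  have lin: "linear T" using T(1) by (rule orthogonal_transformation_linear)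
  have "chord2 K (ex r \<theta>') (ex R (T \<omega>)) = chord2 K (ex r \<theta>) (ex R \<omega>)" for \<omega>
  proof -
    have "sn K r *\<^sub>R \<theta>' - sn K R *\<^sub>R T \<omega> = T (sn K r *\<^sub>R \<theta> - sn K R *\<^sub>R \<omega>)"
      by (simp add: linear_diff[OF lin] linear_scale[OF lin] T(2))
    then show ?thesis using T(1) by (simp add: chord2_ex orthogonal_transformation_norm)
  qed
  then have k: "kern (T \<omega>) (ex r \<theta>') = kern \<omega> (ex r \<theta>)" for \<omega>
    using assms by (simp add: kern_eq chord2_ex_p)
  have "continuous_on (sphere 0 1) (\<lambda>\<omega>. kern \<omega> (ex r \<theta>'))"
    using continuous_on_kern_sphere B_subset_U assms by blast
  from sphere_integral_orthogonal[OF this T(1)] show ?thesis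
    unfolding W_def by (simp add: k)
qed

section \<open>Normalisation of the kernel\<close>

definition N :: real where "N = W (\<lambda>_. 1) p"

lemma kern_p: "norm \<omega> = 1 \<Longrightarrow> kern \<omega> p = Q * Q powr (- (n / 2))"
  using chord2_ex_p[of \<omega> R] by (simp add: kern_eq chord2_sym[of K p] Q_def)

lemma N_pos: "N > 0"
proof -
  have "p \<in> U" using B_subset_U p_in_B by blast
  then have "continuous_on (sphere 0 1) (\<lambda>\<omega>. kern \<omega> p)" by (rule continuous_on_kern_sphere)
  then show ?thesis unfolding N_def W_def using kern_pos[OF p_in_B] by (simp add: sphere_integral_pos)
qed

text \<open>By symmetry the integral is constant on each smaller sphere, so it agrees with a multiple of
  the radial solution \<open>h\<close> on each smaller ball; the factor is read off at the centre.\<close>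

lemma W_1:
  assumes x: "x \<in> B"
  shows "W (\<lambda>_. 1) x = N * h x"
proof -
  obtain r \<theta> where r: "x = ex r \<theta>" "0 \<le> r" "r < R" "norm \<theta> = 1" using x B_ex_iff by blast
  show ?thesis
  proof (cases "r = 0")
    case True
    then show ?thesis by (simp add: r N_def)
  next
    case False
    then have r0: "0 < r" using r by simp
    interpret B1: space_form_ball K p r n by (rule smaller_ball) (use r r0 in auto)
    have sub: "B1.B \<union> B1.S \<subseteq> B" using smaller_ball_subset r0 r by blast
    define k where "k = W (\<lambda>_. 1) x / h x"
    have hx: "h x \<noteq> 0" using h_pos[of x] x by simp
    have 1: "conformal_solution K B1.B (W (\<lambda>_. 1))"
      using conformal_solution_W[of "\<lambda>_. 1"] sub unfolding conformal_solution_B B1.conformal_solution_B by auto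
    have 2: "conformal_solution K B1.B (\<lambda>x. k * h x + 0 * h x)"
      using conformal_solution_lincomb[OF open_V conformal_solution_h[unfolded B_eq] conformal_solution_h[unfolded B_eq], of k 0] sub
      unfolding B_eq[symmetric] conformal_solution_B B1.conformal_solution_B by auto
    have "W (\<lambda>_. 1) p = (\<lambda>x. k * h x + 0 * h x) p"
    proof (rule B1.dirichlet_unique[OF 1 _ 2 _ _ B1.p_in_B])
      show "continuous_on (B1.B \<union> B1.S) (W (\<lambda>_. 1))"
        by (rule continuous_on_subset[OF continuous_on_W]) (use sub B_subset_U in auto)
      show "continuous_on (B1.B \<union> B1.S) (\<lambda>x. k * h x + 0 * h x)"
        by (intro continuous_intros continuous_on_subset[OF continuous_on_h]) (use sub in auto)
      fix y assume y: "y \<in> B1.S"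
      then obtain \<theta>' where \<theta>': "y = ex r \<theta>'" "norm \<theta>' = 1" unfolding B1.S_ex by auto
      have "y \<in> B" using y sub by blast
      then have "W (\<lambda>_. 1) y = W (\<lambda>_. 1) x" using W_1_radial[of \<theta>' \<theta> r] \<theta>' r x by auto
      moreover have "h y = h x" using r \<theta>' by (simp add: h_eq chord2_ex_p)
      ultimately show "W (\<lambda>_. 1) y = k * h y + 0 * h y" using hx by (simp add: k_def)
    qed
    then have "N = k" by (simp add: N_def)
    then show ?thesis using hx by (simp add: k_def)
  qed
qed

definition hR :: real where "hR = (1 - K / 4 * Q) powr (- m)"

lemma chord2_S: "y \<in> S \<Longrightarrow> chord2 K y p = Q"
  using chord2_ex_p by (auto simp: S_ex Q_def)

lemma h_S: "y \<in> S \<Longrightarrow> h y = hR"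
  by (simp add: h_eq hR_def chord2_S)

lemma hR_pos: "hR > 0"
proof -
  obtain b :: 'a where "b \<in> Basis" using nonempty_Basis by blast
  then have "ex R b \<in> S" by (intro ex_R_in_S) simp
  then show ?thesis using h_S[of "ex R b"] h_pos[of "ex R b"] by simp
qed

text \<open>Chosen so that the constant datum 1 gives h / hR, which has boundary value 1. The total
  mass of the normalised kernel is therefore h x / hR, not 1 in general, since constants need not be
  solutions.\<close>

definition cP :: real where "cP = 1 / (hR * N)"

lemma cP_pos: "cP > 0"
  using hR_pos N_pos by (simp add: cP_def)

lemma cP_W_1: "x \<in> B \<Longrightarrow> cP * W (\<lambda>_. 1) x = h x / hR"
  using hR_pos N_pos by (simp add: cP_def W_1)

section \<open>Solution of the Dirichlet problem\<close>

definition dirichlet :: "(real \<times> 'a \<Rightarrow> real) \<Rightarrow> real \<times> 'a \<Rightarrow> real" where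
  "dirichlet \<phi> x = (if x \<in> B then cP * W (\<lambda>\<omega>. \<phi> (ex R \<omega>)) x else \<phi> x)"

lemma B_S_disjoint: "B \<inter> S = {}"
  by (auto simp: geodesic_ball_def geodesic_sphere_def)

lemma continuous_on_ex_R: "continuous_on S \<phi> \<Longrightarrow> continuous_on (sphere 0 1) (\<lambda>\<omega>. \<phi> (ex R \<omega>))"
  by (erule continuous_on_compose2) (auto intro!: continuous_intros ex_R_in_S)

lemma conformal_solution_dirichlet:
  assumes \<phi>: "continuous_on S \<phi>"
  shows "conformal_solution K B (dirichlet \<phi>)"
  unfolding B_eq
proof (rule conformal_solution_cong[OF open_V])
  \<comment> \<open>The vanishing second summand lets the rule for linear combinations serve for
    scalar multiples.\<close>
  show "conformal_solution K (space_form K \<inter> V) (\<lambda>x. cP * W (\<lambda>\<omega>. \<phi> (ex R \<omega>)) x + 0 * W (\<lambda>\<omega>. \<phi> (ex R \<omega>)) x)"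
    using conformal_solution_W[OF continuous_on_ex_R[OF \<phi>]] unfolding B_eq
    by (intro conformal_solution_lincomb[OF open_V])
qed (simp add: dirichlet_def B_eq)

text \<open>The oscillation of the datum is bounded by \<epsilon> plus M times the sum of
  \<open>chord2 K x y0\<close> and the power n / 2 of the chord to the boundary point. That power
  cancels the singularity of the kernel exactly, leaving \<open>Q - chord2 K x p\<close>, which is 0
  on the boundary.\<close>

lemma dirichlet_boundary_bound:
  assumes \<phi>: "continuous_on S \<phi>" and y0: "y0 \<in> S" and \<epsilon>: "\<epsilon> > 0"
  shows "\<exists>M M'. \<forall>x \<in> B \<union> S. \<bar>dirichlet \<phi> x - \<phi> y0 * (h x / hR)\<bar>
     \<le> (\<epsilon> + M * chord2 K x y0) * (h x / hR) + M' * (Q - chord2 K x p)"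
proof -
  obtain \<omega>0 where \<omega>0: "y0 = ex R \<omega>0" "norm \<omega>0 = 1" using y0 unfolding S_ex by auto
  let ?\<Phi> = "\<lambda>\<omega>. \<phi> (ex R \<omega>)" and ?q = "\<lambda>x \<omega>. chord2 K x (ex R \<omega>)"
  have \<Phi>: "continuous_on (sphere 0 1) ?\<Phi>" by (rule continuous_on_ex_R[OF \<phi>])
  have \<Phi>2: "continuous_on ((B \<union> S) \<times> sphere 0 1) (\<lambda>z. ?\<Phi> (snd z))"
    by (rule continuous_on_compose2[OF \<Phi>]) (auto intro!: continuous_intros)
  have qpos: "?q x \<omega> \<ge> 0" if "x \<in> B \<union> S" "norm \<omega> = 1" for x \<omega> using that by (rule chord2_nonneg)
  \<comment> \<open>The comparison function vanishes only if x, the boundary point of \<omega> and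
    y0 all coincide, and then the oscillation is 0. The closed ball is used for the sake of
    compactness.\<close>
  have "\<exists>M\<ge>0. \<forall>d \<in> (B \<union> S) \<times> sphere 0 1. \<bar>?\<Phi> (snd d) - \<phi> y0\<bar> \<le> \<epsilon> + M * (?q (fst d) (snd d) powr (n / 2) + chord2 K (fst d) y0)"
  proof (rule compact_eps_bound[OF _ _ _ _ _ \<epsilon>])
    show "compact ((B \<union> S) \<times> sphere 0 1 :: ((real \<times> 'a) \<times> 'a) set)"
      by (intro compact_Times compact_closed_ball) simp
    show "continuous_on ((B \<union> S) \<times> sphere 0 1) (\<lambda>d. \<bar>?\<Phi> (snd d) - \<phi> y0\<bar>)"
      by (intro continuous_intros \<Phi>2)
    show "continuous_on ((B \<union> S) \<times> sphere 0 1) (\<lambda>d. ?q (fst d) (snd d) powr (n / 2) + chord2 K (fst d) y0)"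
      using n_ge_2 by (intro continuous_on_add continuous_on_powr' continuous_intros) (auto intro: qpos)
    fix d assume "d \<in> (B \<union> S) \<times> sphere (0::'a) 1"
    then obtain x \<omega> where d: "d = (x, \<omega>)" "x \<in> B \<union> S" "norm \<omega> = 1" by auto
    have q0: "chord2 K x y0 \<ge> 0" using qpos[OF d(2) \<omega>0(2)] \<omega>0 by simp
    show "0 \<le> ?q (fst d) (snd d) powr (n / 2) + chord2 K (fst d) y0"
      using q0 d by simp
    assume "?q (fst d) (snd d) powr (n / 2) + chord2 K (fst d) y0 = 0"
    then have "?q x \<omega> powr (n / 2) + chord2 K x y0 = 0" by (simp add: d)
    moreover have "?q x \<omega> powr (n / 2) \<ge> 0" by simp
    ultimately have "?q x \<omega> powr (n / 2) = 0" "chord2 K x y0 = 0" using q0 by linarith+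
    then have "?q x \<omega> = 0" "chord2 K x y0 = 0" by simp_all
    then have "x = ex R \<omega>" "x = y0"
      using chord2_eq_0_iff closed_ball_subset d ex_in_space_form y0 by blast+
    then show "\<bar>?\<Phi> (snd d) - \<phi> y0\<bar> \<le> 0" using d by simp
  qed
  then obtain M where M: "M \<ge> 0" "\<And>x \<omega>. x \<in> B \<union> S \<Longrightarrow> norm \<omega> = 1 \<Longrightarrow>
      \<bar>?\<Phi> \<omega> - \<phi> y0\<bar> \<le> \<epsilon> + M * (?q x \<omega> powr (n / 2) + chord2 K x y0)" by fastforce
  define M' where "M' = cP * M * sphere_integral (\<lambda>\<omega>::'a. 1 :: real)"
  have "\<bar>dirichlet \<phi> x - \<phi> y0 * (h x / hR)\<bar>
     \<le> (\<epsilon> + M * chord2 K x y0) * (h x / hR) + M' * (Q - chord2 K x p)" if x: "x \<in> B \<union> S" for x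
  proof (cases "x \<in> B")
    case True
    then have xU: "x \<in> U" using B_subset_U by blast
    have kc: "continuous_on (sphere 0 1) (\<lambda>\<omega>. kern \<omega> x)" by (rule continuous_on_kern_sphere[OF xU])
    have kp: "kern \<omega> x > 0" if "norm \<omega> = 1" for \<omega> by (rule kern_pos[OF True that])
    have kq: "kern \<omega> x * ?q x \<omega> powr (n / 2) = Q - chord2 K x p" if "norm \<omega> = 1" for \<omega>
    proof -
      have "?q x \<omega> powr (- (n / 2)) * ?q x \<omega> powr (n / 2) = 1"
        using chord2_pos[OF True that] by (simp add: powr_add[symmetric])
      then show ?thesis by (simp add: kern_eq)
    qed
    have "W ?\<Phi> x - \<phi> y0 * W (\<lambda>_. 1) x = sphere_integral (\<lambda>\<omega>. ?\<Phi> \<omega> * kern \<omega> x) - sphere_integral (\<lambda>\<omega>. \<phi> y0 * kern \<omega> x)"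
      using kc by (simp add: W_def sphere_integral_mult)
    also have "\<dots> = sphere_integral (\<lambda>\<omega>. ?\<Phi> \<omega> * kern \<omega> x - \<phi> y0 * kern \<omega> x)"
      using kc \<Phi> by (intro sphere_integral_diff[symmetric] continuous_intros)
    finally have "\<bar>W ?\<Phi> x - \<phi> y0 * W (\<lambda>_. 1) x\<bar> \<le> sphere_integral (\<lambda>\<omega>. \<bar>?\<Phi> \<omega> * kern \<omega> x - \<phi> y0 * kern \<omega> x\<bar>)"
      using norm_sphere_integral_le[of "\<lambda>\<omega>. ?\<Phi> \<omega> * kern \<omega> x - \<phi> y0 * kern \<omega> x"] kc \<Phi>
      by (simp add: continuous_intros)
    also have "\<dots> \<le> sphere_integral (\<lambda>\<omega>. (\<epsilon> + M * chord2 K x y0) * kern \<omega> x + M * (Q - chord2 K x p) * 1)"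
    proof (rule sphere_integral_mono)
      fix \<omega> :: 'a assume \<omega>: "norm \<omega> = 1"
      have "\<bar>?\<Phi> \<omega> * kern \<omega> x - \<phi> y0 * kern \<omega> x\<bar> = \<bar>?\<Phi> \<omega> - \<phi> y0\<bar> * kern \<omega> x"
        using kp[OF \<omega>] by (simp add: left_diff_distrib[symmetric] abs_mult)
      also have "\<dots> \<le> (\<epsilon> + M * (?q x \<omega> powr (n / 2) + chord2 K x y0)) * kern \<omega> x"
        using M(2)[OF x \<omega>] kp[OF \<omega>] by (intro mult_right_mono) auto
      also have "\<dots> = (\<epsilon> + M * chord2 K x y0) * kern \<omega> x + M * (kern \<omega> x * ?q x \<omega> powr (n / 2))"
        by (simp add: algebra_simps)
      finally show "\<bar>?\<Phi> \<omega> * kern \<omega> x - \<phi> y0 * kern \<omega> x\<bar> \<le> (\<epsilon> + M * chord2 K x y0) * kern \<omega> x + M * (Q - chord2 K x p) * 1"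
        by (simp add: kq[OF \<omega>])
    qed (use kc \<Phi> in \<open>auto intro!: continuous_intros\<close>)
    also have "\<dots> = (\<epsilon> + M * chord2 K x y0) * W (\<lambda>_. 1) x + M * (Q - chord2 K x p) * sphere_integral (\<lambda>\<omega>::'a. 1)"
    proof -
      have "sphere_integral (\<lambda>\<omega>. (\<epsilon> + M * chord2 K x y0) * kern \<omega> x + M * (Q - chord2 K x p) * 1)
        = sphere_integral (\<lambda>\<omega>. (\<epsilon> + M * chord2 K x y0) * kern \<omega> x) + sphere_integral (\<lambda>\<omega>::'a. M * (Q - chord2 K x p) * 1)"
        using kc by (intro sphere_integral_add continuous_intros)
      also have "sphere_integral (\<lambda>\<omega>. (\<epsilon> + M * chord2 K x y0) * kern \<omega> x) = (\<epsilon> + M * chord2 K x y0) * W (\<lambda>_. 1) x"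
        using kc by (simp add: W_def sphere_integral_mult)
      also have "sphere_integral (\<lambda>\<omega>::'a. M * (Q - chord2 K x p) * 1) = M * (Q - chord2 K x p) * sphere_integral (\<lambda>\<omega>::'a. 1)"
        by (rule sphere_integral_mult) simp
      finally show ?thesis .
    qed
    finally have "cP * \<bar>W ?\<Phi> x - \<phi> y0 * W (\<lambda>_. 1) x\<bar>
       \<le> cP * ((\<epsilon> + M * chord2 K x y0) * W (\<lambda>_. 1) x + M * (Q - chord2 K x p) * sphere_integral (\<lambda>\<omega>::'a. 1))"
      using cP_pos by (intro mult_left_mono) auto
    also have "\<dots> = (\<epsilon> + M * chord2 K x y0) * (cP * W (\<lambda>_. 1) x) + M' * (Q - chord2 K x p)"
      by (simp add: M'_def algebra_simps)
    also have "cP * W (\<lambda>_. 1) x = h x / hR" by (rule cP_W_1[OF True])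
    also have "cP * \<bar>W ?\<Phi> x - \<phi> y0 * W (\<lambda>_. 1) x\<bar> = \<bar>cP * (W ?\<Phi> x - \<phi> y0 * W (\<lambda>_. 1) x)\<bar>"
      using cP_pos by (simp add: abs_mult)
    also have "cP * (W ?\<Phi> x - \<phi> y0 * W (\<lambda>_. 1) x) = cP * W ?\<Phi> x - \<phi> y0 * (cP * W (\<lambda>_. 1) x)"
      by (simp add: algebra_simps)
    also have "\<dots> = dirichlet \<phi> x - \<phi> y0 * (h x / hR)"
      unfolding cP_W_1[OF True] using True by (simp add: dirichlet_def)
    finally show ?thesis .
  next
    case False
    then have xS: "x \<in> S" using x by simp
    then obtain \<omega> where \<omega>: "x = ex R \<omega>" "norm \<omega> = 1" unfolding S_ex by auto
    have "\<bar>\<phi> x - \<phi> y0\<bar> \<le> \<epsilon> + M * chord2 K x y0" using M(2)[OF x \<omega>(2)] \<omega> n_ge_2 by simp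
    moreover have "h x / hR = 1" using h_S[OF xS] hR_pos by simp
    ultimately show ?thesis using False chord2_S[OF xS] by (simp add: dirichlet_def)
  qed
  then show ?thesis by blast
qed

lemma continuous_on_dirichlet:
  assumes \<phi>: "continuous_on S \<phi>"
  shows "continuous_on (B \<union> S) (dirichlet \<phi>)"
  unfolding continuous_on_def
proof
  fix y0 assume y0: "y0 \<in> B \<union> S"
  let ?\<Phi> = "\<lambda>\<omega>. \<phi> (ex R \<omega>)"
  show "(dirichlet \<phi> \<longlongrightarrow> dirichlet \<phi> y0) (at y0 within B \<union> S)"
  proof (cases "y0 \<in> B")
    case True
    have "isCont (W ?\<Phi>) y0"
      using continuous_on_W[OF continuous_on_ex_R[OF \<phi>]] continuous_on_eq_continuous_at[OF open_U] B_subset_U True by blast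
    then have "((\<lambda>x. cP * W ?\<Phi> x) \<longlongrightarrow> cP * W ?\<Phi> y0) (at y0 within B \<union> S)"
      unfolding isCont_def by (rule tendsto_mult_left[OF tendsto_within_subset]) simp
    moreover have "\<forall>\<^sub>F x in at y0 within B \<union> S. cP * W ?\<Phi> x = dirichlet \<phi> x"
      unfolding eventually_at_topological
    proof (intro exI[of _ V] conjI ballI impI open_V)
      show "y0 \<in> V" using True B_eq by blast
      fix x assume "x \<in> V" "x \<in> B \<union> S"
      then have "x \<in> B" using closed_ball_subset B_eq by blast
      then show "cP * W ?\<Phi> x = dirichlet \<phi> x" by (simp add: dirichlet_def)
    qed
    ultimately have "(dirichlet \<phi> \<longlongrightarrow> cP * W ?\<Phi> y0) (at y0 within B \<union> S)" by (rule Lim_transform_eventually)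
    then show ?thesis using True by (simp add: dirichlet_def[of \<phi> y0])
  next
    case False
    then have yS: "y0 \<in> S" using y0 by simp
    have d0: "dirichlet \<phi> y0 = \<phi> y0" using False by (simp add: dirichlet_def)
    show ?thesis unfolding d0
    proof (rule tendstoI)
      fix e :: real assume e: "e > 0"
      then have e2: "e / 2 > 0" by simp
      obtain M M' where M: "\<And>x. x \<in> B \<union> S \<Longrightarrow> \<bar>dirichlet \<phi> x - \<phi> y0 * (h x / hR)\<bar>
         \<le> (e / 2 + M * chord2 K x y0) * (h x / hR) + M' * (Q - chord2 K x p)"
        using dirichlet_boundary_bound[OF \<phi> yS e2] by blast
      define b where "b x = (e / 2 + M * chord2 K x y0) * (h x / hR) + M' * (Q - chord2 K x p) + \<bar>\<phi> y0\<bar> * \<bar>h x / hR - 1\<bar>" for x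
      have "continuous_on (B \<union> S) b"
        unfolding b_def by (intro continuous_intros continuous_on_h) (use hR_pos in auto)
      then have "(b \<longlongrightarrow> b y0) (at y0 within B \<union> S)" using y0 by (simp add: continuous_on_def)
      moreover have "b y0 < e" using h_S[OF yS] hR_pos chord2_S[OF yS] e by (simp add: b_def)
      ultimately have "\<forall>\<^sub>F x in at y0 within B \<union> S. b x < e" by (rule order_tendstoD)
      moreover have "\<forall>\<^sub>F x in at y0 within B \<union> S. x \<in> B \<union> S" by (simp add: eventually_at_filter)
      ultimately show "\<forall>\<^sub>F x in at y0 within B \<union> S. dist (dirichlet \<phi> x) (\<phi> y0) < e"
      proof eventually_elim
        case (elim x)
        have "\<bar>dirichlet \<phi> x - \<phi> y0\<bar> \<le> \<bar>dirichlet \<phi> x - \<phi> y0 * (h x / hR)\<bar> + \<bar>\<phi> y0 * (h x / hR - 1)\<bar>"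
          by (simp add: right_diff_distrib)
        also have "\<dots> \<le> b x" using M[OF elim(2)] by (simp add: b_def abs_mult)
        finally show ?case using elim by (simp add: dist_real_def)
      qed
    qed
  qed
qed

lemma dirichlet_solution_dirichlet:
  assumes "continuous_on S \<phi>"
  shows "dirichlet_solution K p R \<phi> (dirichlet \<phi>)"
  unfolding dirichlet_solution_def
  using conformal_solution_dirichlet[OF assms] continuous_on_dirichlet[OF assms] B_S_disjoint
  by (auto simp: dirichlet_def)

lemma dirichlet_solution_iff:
  assumes \<phi>: "continuous_on S \<phi>"
  shows "dirichlet_solution K p R \<phi> w \<longleftrightarrow>
    (\<forall>x \<in> B. w x = cP * W (\<lambda>\<omega>. \<phi> (ex R \<omega>)) x) \<and> (\<forall>y \<in> S. w y = \<phi> y)"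
proof -
  have dS: "dirichlet \<phi> y = \<phi> y" if "y \<in> S" for y using that B_S_disjoint by (auto simp: dirichlet_def)
  have dB: "dirichlet \<phi> x = cP * W (\<lambda>\<omega>. \<phi> (ex R \<omega>)) x" if "x \<in> B" for x using that by (simp add: dirichlet_def)
  show ?thesis
  proof
    assume w: "dirichlet_solution K p R \<phi> w"
    then have w: "conformal_solution K B w" "continuous_on (B \<union> S) w" "\<And>y. y \<in> S \<Longrightarrow> w y = \<phi> y"
      unfolding dirichlet_solution_def by blast+
    have "w x = cP * W (\<lambda>\<omega>. \<phi> (ex R \<omega>)) x" if x: "x \<in> B" for x
    proof -
      have "w x = dirichlet \<phi> x"
        by (rule dirichlet_unique[OF w(1,2) conformal_solution_dirichlet[OF \<phi>] continuous_on_dirichlet[OF \<phi>] _ x])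
          (simp add: w(3) dS)
      then show ?thesis using dB[OF x] by simp
    qed
    then show "(\<forall>x \<in> B. w x = cP * W (\<lambda>\<omega>. \<phi> (ex R \<omega>)) x) \<and> (\<forall>y \<in> S. w y = \<phi> y)"
      using w(3) by blast
  next
    assume w: "(\<forall>x \<in> B. w x = cP * W (\<lambda>\<omega>. \<phi> (ex R \<omega>)) x) \<and> (\<forall>y \<in> S. w y = \<phi> y)"
    have eq: "dirichlet \<phi> x = w x" if "x \<in> B \<union> S" for x
      using that w dS[of x] dB[of x] by (metis Un_iff)
    have "conformal_solution K B w"
      unfolding B_eq
      by (rule conformal_solution_cong[OF open_V conformal_solution_dirichlet[OF \<phi>, unfolded B_eq]])
        (simp add: eq B_eq)
    moreover have "continuous_on (B \<union> S) w"
      by (rule continuous_on_eq[OF continuous_on_dirichlet[OF \<phi>]]) (rule eq)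
    ultimately show "dirichlet_solution K p R \<phi> w" using w by (simp add: dirichlet_solution_def)
  qed
qed

section \<open>Identification with the Poisson kernel for the surface measure\<close>

definition A :: real where "A = n * sn K R powr (n - 1)"

lemma A_pos: "A > 0"
  using sn_pos[OF R] n_ge_2 by (simp add: A_def)

text \<open>Dividing by \<open>A\<close> compensates for the passage from the cone measure on the
  unit sphere to the surface measure of \<open>S\<close>.\<close>

definition P0 :: "real \<times> 'a \<Rightarrow> real \<times> 'a \<Rightarrow> real" where
  "P0 x y = cP / A * ((Q - chord2 K x p) * chord2 K x y powr (- (n / 2)))"

lemma P0_ex: "P0 x (ex R \<omega>) = cP / A * kern \<omega> x"
  by (simp add: P0_def kern_eq)

lemma continuous_on_P0:
  assumes "x \<in> B"
  shows "continuous_on S (P0 x)"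
proof -
  have pos: "chord2 K x y > 0" if "y \<in> S" for y using that chord2_pos[OF assms] by (auto simp: S_ex)
  have "continuous_on S (\<lambda>y. chord2 K x y powr (- (n / 2)))"
    by (intro continuous_intros) (use pos in force)
  then show ?thesis unfolding P0_def by (intro continuous_on_mult continuous_on_const)
qed

lemma surface_integral:
  fixes f :: "real \<times> 'a \<Rightarrow> real"
  assumes "continuous_on S f"
  shows "(LINT y:S|surface_measure K p R. f y) = A * sphere_integral (\<lambda>\<omega>. f (ex R \<omega>))"
proof -
  have "n - 1 = real (DIM('a) - 1)" using dim n by simp
  then have "sn K R powr (n - 1) = sn K R ^ (DIM('a) - 1)"
    by (simp only: powr_realpow[OF sn_pos[OF R]])
  then show ?thesis using surface_integral_eq[OF R assms] n by (simp add: A_def[unfolded n])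
qed

lemma poisson_integral:
  assumes x: "x \<in> B" and \<phi>: "continuous_on S \<phi>"
  shows "(LINT y:S|surface_measure K p R. P0 x y * \<phi> y) = cP * W (\<lambda>\<omega>. \<phi> (ex R \<omega>)) x"
proof -
  have "(LINT y:S|surface_measure K p R. P0 x y * \<phi> y) = A * sphere_integral (\<lambda>\<omega>. P0 x (ex R \<omega>) * \<phi> (ex R \<omega>))"
    by (intro surface_integral continuous_intros continuous_on_P0 x \<phi>)
  also have "(\<lambda>\<omega>. P0 x (ex R \<omega>) * \<phi> (ex R \<omega>)) = (\<lambda>\<omega>. cP / A * (\<phi> (ex R \<omega>) * kern \<omega> x))"
    by (simp add: P0_ex fun_eq_iff)
  also have "sphere_integral (\<lambda>\<omega>. cP / A * (\<phi> (ex R \<omega>) * kern \<omega> x)) = cP / A * W (\<lambda>\<omega>. \<phi> (ex R \<omega>)) x"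
    unfolding W_def using x B_subset_U
    by (intro sphere_integral_mult continuous_intros continuous_on_kern_sphere continuous_on_ex_R \<phi>) auto
  finally show ?thesis using A_pos by simp
qed

lemma poisson_kernel_P0: "poisson_kernel K p R P0"
  unfolding poisson_kernel_def using continuous_on_P0 dirichlet_solution_iff poisson_integral by auto

text \<open>Testing both kernels against their own difference at x gives the integral of a square
  equal to 0; continuity and full support of the measure then give equality at every boundary
  point.\<close>

lemma poisson_kernel_unique:
  assumes P: "poisson_kernel K p R P" and x: "x \<in> B" and y: "y \<in> S"
  shows "P x y = P0 x y"
proof -
  define \<phi> where "\<phi> y = P x y - P0 x y" for y
  have Pc: "continuous_on S (P x)" using P x by (simp add: poisson_kernel_def)
  have \<phi>: "continuous_on S \<phi>" unfolding \<phi>_def by (intro continuous_intros Pc continuous_on_P0 x)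
  have "dirichlet \<phi> x = (LINT y:S|surface_measure K p R. P x y * \<phi> y)"
    using P \<phi> x dirichlet_solution_dirichlet[OF \<phi>] unfolding poisson_kernel_def by blast
  moreover have "dirichlet \<phi> x = (LINT y:S|surface_measure K p R. P0 x y * \<phi> y)"
    using x by (simp add: dirichlet_def poisson_integral[OF x \<phi>])
  ultimately have "(LINT y:S|surface_measure K p R. P x y * \<phi> y) = (LINT y:S|surface_measure K p R. P0 x y * \<phi> y)"
    by (rule trans[OF sym])
  then have "A * sphere_integral (\<lambda>\<omega>. P x (ex R \<omega>) * \<phi> (ex R \<omega>)) = A * sphere_integral (\<lambda>\<omega>. P0 x (ex R \<omega>) * \<phi> (ex R \<omega>))"
    unfolding surface_integral[OF continuous_on_mult[OF Pc \<phi>]] surface_integral[OF continuous_on_mult[OF continuous_on_P0[OF x] \<phi>]] .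
  then have "sphere_integral (\<lambda>\<omega>. P x (ex R \<omega>) * \<phi> (ex R \<omega>)) - sphere_integral (\<lambda>\<omega>. P0 x (ex R \<omega>) * \<phi> (ex R \<omega>)) = 0"
    using A_pos by simp
  also have "sphere_integral (\<lambda>\<omega>. P x (ex R \<omega>) * \<phi> (ex R \<omega>)) - sphere_integral (\<lambda>\<omega>. P0 x (ex R \<omega>) * \<phi> (ex R \<omega>))
    = sphere_integral (\<lambda>\<omega>. P x (ex R \<omega>) * \<phi> (ex R \<omega>) - P0 x (ex R \<omega>) * \<phi> (ex R \<omega>))"
    by (intro sphere_integral_diff[symmetric] continuous_intros continuous_on_ex_R Pc \<phi> continuous_on_P0 x)
  also have "\<dots> = sphere_integral (\<lambda>\<omega>. (\<phi> (ex R \<omega>))\<^sup>2)"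
    by (rule sphere_integral_cong) (simp add: \<phi>_def power2_eq_square algebra_simps)
  finally have 0: "sphere_integral (\<lambda>\<omega>. (\<phi> (ex R \<omega>))\<^sup>2) = 0" .
  obtain \<omega> where \<omega>: "y = ex R \<omega>" "norm \<omega> = 1" using y by (auto simp: S_ex)
  have "(\<phi> (ex R \<omega>))\<^sup>2 = 0"
    by (rule sphere_integral_eq_0[OF _ _ 0 \<omega>(2)]) (auto intro!: continuous_intros continuous_on_ex_R \<phi>)
  then show ?thesis using \<omega> by (simp add: \<phi>_def)
qed

lemma multiple_of_poisson_kernel_iff:
  "multiple_of_poisson_kernel K p R u \<longleftrightarrow> (\<exists>\<omega>. norm \<omega> = 1 \<and> (\<exists>c>0. \<forall>x \<in> B. u x = c * kern \<omega> x))"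
proof
  assume "multiple_of_poisson_kernel K p R u"
  then obtain P y c where P: "poisson_kernel K p R P" "y \<in> S" "c > 0" "\<forall>x \<in> B. u x = c * P x y"
    unfolding multiple_of_poisson_kernel_def by blast
  obtain \<omega> where \<omega>: "y = ex R \<omega>" "norm \<omega> = 1" using P(2) by (auto simp: S_ex)
  have "u x = c * (cP / A) * kern \<omega> x" if x: "x \<in> B" for x
    using P x poisson_kernel_unique[OF P(1) x P(2)] \<omega> P0_ex by simp
  moreover have "c * (cP / A) > 0" using P(3) cP_pos A_pos by simp
  ultimately show "\<exists>\<omega>. norm \<omega> = 1 \<and> (\<exists>c>0. \<forall>x \<in> B. u x = c * kern \<omega> x)" using \<omega> by blast
next
  assume "\<exists>\<omega>. norm \<omega> = 1 \<and> (\<exists>c>0. \<forall>x \<in> B. u x = c * kern \<omega> x)"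
  then obtain \<omega> c where \<omega>: "norm \<omega> = 1" "c > 0" "\<forall>x \<in> B. u x = c * kern \<omega> x" by blast
  have "\<forall>x \<in> B. u x = (c * A / cP) * P0 x (ex R \<omega>)"
    using \<omega> cP_pos A_pos by (simp add: P0_ex)
  moreover have "c * A / cP > 0" using \<omega> cP_pos A_pos by simp
  ultimately show "multiple_of_poisson_kernel K p R u"
    unfolding multiple_of_poisson_kernel_def using poisson_kernel_P0 ex_R_in_S[OF \<omega>(1)] by blast
qed

end

section \<open>Logarithmic gradient of the kernel\<close>

definition grad_bound :: "real \<Rightarrow> real \<Rightarrow> real \<Rightarrow> real \<Rightarrow> real" where
  "grad_bound n K R r = cs K (R / 2) / cs K (r / 2) *
     ((n - 1) / (2 * sn K ((R - r) / 2)) + 1 / (2 * sn K ((R + r) / 2)))"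

text \<open>Here s, c and S, C stand for \<open>sn K\<close>, \<open>cs K\<close> at r / 2 and R /
  2, and q for the squared chord to the boundary point. The left side is the squared norm of the
  logarithmic gradient of kernel over \<open>h\<close>, written by
  \<open>riem_tproj_diff_diff\<close>; the right side shows it to be affine in 1 / q, equal to the
  squared bound at q = 4 (S c - C s)^2, the chord to the nearest point.\<close>

lemma grad_bound_identity:
  fixes K m n S s C c q a b T :: real
  assumes c2: "c\<^sup>2 = 1 - K * s\<^sup>2" and C2: "C\<^sup>2 = 1 - K * S\<^sup>2" and n: "n = 2 * m + 2"
    and q: "q \<noteq> 0" and c: "c \<noteq> 0" and T: "T = S\<^sup>2 - s\<^sup>2" "T \<noteq> 0"
    and a: "a = 1 / (4 * T) + m * K / (4 * c\<^sup>2)" and b: "b = n / (2 * q)"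
  shows "4 * a\<^sup>2 * (4 * s\<^sup>2 - K * (4 * s\<^sup>2)\<^sup>2 / 4) + 8 * a * b * ((4 * s\<^sup>2 + q - 4 * S\<^sup>2) / 2 - K * (4 * s\<^sup>2) * q / 4)
      + 4 * b\<^sup>2 * (q - K * q\<^sup>2 / 4)
    = (C / c * (n * S * c + 2 * m * C * s) / (2 * T))\<^sup>2 + 2 * n * m * (C\<^sup>2 / c\<^sup>2) * (1 / q - 1 / (4 * (S * c - C * s)\<^sup>2))"
proof -
  define \<alpha> where "\<alpha> = c\<^sup>2 + m * (c\<^sup>2 - C\<^sup>2)"
  have KT: "K * T = c\<^sup>2 - C\<^sup>2" by (simp add: T c2 C2 algebra_simps)
  have a': "a = \<alpha> / (4 * T * c\<^sup>2)"
    using c T(2) by (simp add: a \<alpha>_def KT[symmetric] field_simps)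
  have prod: "(S * c - C * s) * (S * c + C * s) = T"
  proof -
    have "(S * c - C * s) * (S * c + C * s) = S\<^sup>2 * c\<^sup>2 - C\<^sup>2 * s\<^sup>2" by algebra
    also have "\<dots> = T" by (simp add: c2 C2 T algebra_simps)
    finally show ?thesis .
  qed
  then have \<delta>: "S * c - C * s \<noteq> 0" using T(2) by auto
  \<comment> \<open>The part independent of q. The rest is a multiple of 1 / q, so the identity
    splits into \<open>t4\<close> for the coefficient and \<open>t7\<close> for the
    constant.\<close>
  define c0 where "c0 = 16 * a\<^sup>2 * s\<^sup>2 * c\<^sup>2 + 2 * a * n * (2 * c\<^sup>2 - 1) - n\<^sup>2 * K / 4"
  have t1: "4 * a\<^sup>2 * (4 * s\<^sup>2 - K * (4 * s\<^sup>2)\<^sup>2 / 4) = 16 * a\<^sup>2 * s\<^sup>2 * c\<^sup>2"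
  proof -
    have "4 * a\<^sup>2 * (4 * s\<^sup>2 - K * (4 * s\<^sup>2)\<^sup>2 / 4) = 16 * a\<^sup>2 * s\<^sup>2 * (1 - K * s\<^sup>2)"
      by (simp add: power2_eq_square algebra_simps)
    then show ?thesis unfolding c2 .
  qed
  have bq: "b * q = n / 2" using q by (simp add: b)
  have "8 * a * b * ((4 * s\<^sup>2 + q - 4 * S\<^sup>2) / 2 - K * (4 * s\<^sup>2) * q / 4)
     = - 16 * a * b * T + 4 * a * (b * q) * (2 * c\<^sup>2 - 1)"
    by (simp add: c2 T field_simps)
  also have "\<dots> = - (8 * n * (a * T)) / q + 2 * a * n * (2 * c\<^sup>2 - 1)"
    unfolding bq using q by (simp add: b field_simps)
  also have "a * T = \<alpha> / (4 * c\<^sup>2)" using T(2) by (simp add: a')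
  finally have t2: "8 * a * b * ((4 * s\<^sup>2 + q - 4 * S\<^sup>2) / 2 - K * (4 * s\<^sup>2) * q / 4)
     = - (8 * n * (\<alpha> / (4 * c\<^sup>2))) / q + 2 * a * n * (2 * c\<^sup>2 - 1)" .
  have t3: "4 * b\<^sup>2 * (q - K * q\<^sup>2 / 4) = n\<^sup>2 / q - n\<^sup>2 * K / 4"
    using q by (simp add: b power2_eq_square field_simps)
  have t4: "n\<^sup>2 / q - (8 * n * (\<alpha> / (4 * c\<^sup>2))) / q = 2 * n * m * (C\<^sup>2 / c\<^sup>2) / q"
  proof -
    have "n\<^sup>2 - 8 * n * (\<alpha> / (4 * c\<^sup>2)) = 2 * n * m * (C\<^sup>2 / c\<^sup>2)"
      using c by (simp add: n \<alpha>_def power2_eq_square field_simps)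
    then show ?thesis by (simp only: diff_divide_distrib[symmetric])
  qed
  have t5: "c0 = (4 * \<alpha>\<^sup>2 * s\<^sup>2 + 2 * n * \<alpha> * T * (2 * c\<^sup>2 - 1) - n\<^sup>2 * (K * T) * T * c\<^sup>2) / (4 * T\<^sup>2 * c\<^sup>2)"
  proof -
    have "16 * a\<^sup>2 * s\<^sup>2 * c\<^sup>2 = 4 * \<alpha>\<^sup>2 * s\<^sup>2 / (4 * T\<^sup>2 * c\<^sup>2)"
      using c T(2) by (simp add: a' power2_eq_square)
    moreover have "2 * a * n * w = 2 * n * \<alpha> * T * w / (4 * T\<^sup>2 * c\<^sup>2)" for w
      using c T(2) by (simp add: a' power2_eq_square)
    moreover have "n\<^sup>2 * K / 4 = n\<^sup>2 * (K * T) * T * c\<^sup>2 / (4 * T\<^sup>2 * c\<^sup>2)"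
      using c T(2) by (simp add: power2_eq_square)
    ultimately show ?thesis by (simp only: c0_def add_divide_distrib diff_divide_distrib)
  qed
  have key: "4 * \<alpha>\<^sup>2 * s\<^sup>2 + 2 * n * \<alpha> * T * (2 * c\<^sup>2 - 1) - n\<^sup>2 * (K * T) * T * c\<^sup>2
     = C\<^sup>2 * (n * S * c + 2 * m * C * s)\<^sup>2 - 2 * n * m * C\<^sup>2 * (S * c + C * s)\<^sup>2"
  proof -
    \<comment> \<open>Only squares occur, so S^2 and s^2 may be treated as free variables A and B,
      with the squares of the cosines eliminated; what remains is a polynomial identity.\<close>
    have poly: "4 * (c2 + m * (c2 - C2))\<^sup>2 * B + 2 * n * (c2 + m * (c2 - C2)) * (A - B) * (2 * c2 - 1) - n\<^sup>2 * (c2 - C2) * (A - B) * c2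
       = C2 * (n\<^sup>2 * A * c2 + 4 * m\<^sup>2 * C2 * B - 2 * n * m * (A * c2 + C2 * B))"
      if "c2 = 1 - K * B" "C2 = 1 - K * A" for A B c2 C2 :: real
      unfolding that n by algebra
    have "C\<^sup>2 * (n * S * c + 2 * m * C * s)\<^sup>2 - 2 * n * m * C\<^sup>2 * (S * c + C * s)\<^sup>2
       = C\<^sup>2 * (n\<^sup>2 * S\<^sup>2 * c\<^sup>2 + 4 * m\<^sup>2 * C\<^sup>2 * s\<^sup>2 - 2 * n * m * (S\<^sup>2 * c\<^sup>2 + C\<^sup>2 * s\<^sup>2))"
      by algebra
    then show ?thesis unfolding KT unfolding \<alpha>_def T(1) poly[OF c2 C2] by (rule sym)
  qed
  have t6: "1 / (4 * (S * c - C * s)\<^sup>2) = (S * c + C * s)\<^sup>2 / (4 * T\<^sup>2)"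
  proof -
    have "S * c + C * s \<noteq> 0" using prod T(2) by auto
    then show ?thesis unfolding prod[symmetric] power_mult_distrib using \<delta> by simp
  qed
  have t7: "c0 = (C / c * (n * S * c + 2 * m * C * s) / (2 * T))\<^sup>2 - 2 * n * m * (C\<^sup>2 / c\<^sup>2) * (1 / (4 * (S * c - C * s)\<^sup>2))"
  proof -
    have "(C\<^sup>2 * X\<^sup>2 - 2 * n * m * C\<^sup>2 * Y) / (4 * T\<^sup>2 * c\<^sup>2) = (C / c * X / (2 * T))\<^sup>2 - 2 * n * m * (C\<^sup>2 / c\<^sup>2) * (Y / (4 * T\<^sup>2))" for X Y
      by (simp add: power_divide power_mult_distrib diff_divide_distrib mult.commute)
    then show ?thesis unfolding t5 key t6 by this
  qed
  have "4 * a\<^sup>2 * (4 * s\<^sup>2 - K * (4 * s\<^sup>2)\<^sup>2 / 4) + 8 * a * b * ((4 * s\<^sup>2 + q - 4 * S\<^sup>2) / 2 - K * (4 * s\<^sup>2) * q / 4)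
      + 4 * b\<^sup>2 * (q - K * q\<^sup>2 / 4) = c0 + 2 * n * m * (C\<^sup>2 / c\<^sup>2) / q"
    unfolding t1 t2 t3 t4[symmetric] c0_def by simp
  then show ?thesis unfolding t7 by (simp add: right_diff_distrib)
qed

lemma grad_bound_eq:
  assumes "cs K (r/2) \<noteq> 0" "sn K ((R - r) / 2) \<noteq> 0" "sn K ((R + r) / 2) \<noteq> 0"
  shows "grad_bound n K R r = cs K (R/2) / cs K (r/2) * (n * sn K (R/2) * cs K (r/2) + (n - 2) * cs K (R/2) * sn K (r/2))
     / (2 * ((sn K (R/2))\<^sup>2 - (sn K (r/2))\<^sup>2))"
proof -
  have 1: "sn K ((R - r) / 2) = sn K (R/2) * cs K (r/2) - cs K (R/2) * sn K (r/2)"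
    by (simp add: diff_divide_distrib sn_diff)
  have 2: "sn K ((R + r) / 2) = sn K (R/2) * cs K (r/2) + cs K (R/2) * sn K (r/2)"
    by (simp add: add_divide_distrib sn_add)
  have "(n - 1) / (2 * sn K ((R - r) / 2)) + 1 / (2 * sn K ((R + r) / 2))
     = ((n - 1) * sn K ((R + r) / 2) + sn K ((R - r) / 2)) / (2 * (sn K ((R + r) / 2) * sn K ((R - r) / 2)))"
    using assms by (simp add: divide_simps)
  also have "(n - 1) * sn K ((R + r) / 2) + sn K ((R - r) / 2)
     = n * sn K (R/2) * cs K (r/2) + (n - 2) * cs K (R/2) * sn K (r/2)"
    unfolding 1 2 by (simp add: algebra_simps)
  finally show ?thesis unfolding grad_bound_def sn_half_square_diff by simp
qed

context space_form_ball begin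

text \<open>The derivative at x in direction e of ln (kern \<omega> / h), as
  \<open>kgrad_dirf\<close> confirms.\<close>

definition dirf :: "real \<times> 'a \<Rightarrow> real \<times> 'a \<Rightarrow> 'a \<Rightarrow> real" where
  "dirf x e \<omega> = - (2 * (1 / (Q - chord2 K x p) + m * K / (4 * (1 - K / 4 * chord2 K x p))) * riem K (x - p) e
     + n / chord2 K x (ex R \<omega>) * riem K (x - ex R \<omega>) e)"

lemma Q_minus_pos: "x \<in> B \<Longrightarrow> Q - chord2 K x p > 0"
  by (simp add: B_eq V_def)

lemma kgrad_dirf:
  assumes x: "x \<in> B" and \<omega>: "norm \<omega> = 1"
  shows "kgrad \<omega> x \<bullet> e - m * K / 2 * riem K (x - p) e / (1 - K / 4 * chord2 K x p) * kern \<omega> x = kern \<omega> x * dirf x e \<omega>"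
proof -
  let ?q = "chord2 K x (ex R \<omega>)" and ?z = "1 - K / 4 * chord2 K x p" and ?T = "Q - chord2 K x p"
  have q: "?q > 0" by (rule chord2_pos[OF x \<omega>])
  have z: "?z \<noteq> 0" using one_minus_pos[of x] x by auto
  have T: "?T \<noteq> 0" using Q_minus_pos[OF x] by simp
  have p1: "?q powr (- (n / 2) - 1) = ?q powr (- (n / 2)) / ?q"
    using powr_diff[of ?q "- (n / 2)" 1] q by simp
  have "kgrad \<omega> x \<bullet> e = - (2 * ?q powr (- (n / 2)) * riem K (x - p) e)
      - n * ?T * (?q powr (- (n / 2)) / ?q) * riem K (x - ex R \<omega>) e"
    by (simp add: kgrad_def chord_grad_def inner_diff_left riem_eq_inner[symmetric] p1)
  also have "\<dots> = kern \<omega> x * (- (2 / ?T * riem K (x - p) e + n / ?q * riem K (x - ex R \<omega>) e))"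
  proof -
    have "- (2 * a * b) - n * t * (a / q) * c = t * a * (- (2 / t * b + n / q * c))" if "t \<noteq> 0" for a b c t q :: real
      using that by (simp add: algebra_simps)
    from this[OF T] show ?thesis by (simp only: kern_eq)
  qed
  finally have k: "kgrad \<omega> x \<bullet> e = kern \<omega> x * (- (2 / ?T * riem K (x - p) e + n / ?q * riem K (x - ex R \<omega>) e))" .
  have "k * (- (2 / t * a + b)) - m * K / 2 * a / z * k = k * (- (2 * (1 / t + m * K / (4 * z)) * a + b))" for k t a b z :: real
    by (simp add: algebra_simps)
  then show ?thesis unfolding k dirf_def by this
qed

lemma radius:
  assumes "x \<in> B"
  obtains r \<theta> where "x = ex r \<theta>" "0 \<le> r" "r < R" "norm \<theta> = 1" "riem_dist K p x = r"
proof -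
  obtain r \<theta> where r: "x = ex r \<theta>" "0 \<le> r" "r < R" "norm \<theta> = 1" using assms B_ex_iff by blast
  moreover have "riem_dist K p x = r" using r rK[of r] by (auto intro!: riem_dist_ex)
  ultimately show ?thesis by (rule that)
qed

lemma radius_pos:
  assumes "0 \<le> r" "r < R"
  shows "cs K (r/2) > 0" "cs K (R/2) > 0" "sn K ((R - r) / 2) > 0" "sn K ((R + r) / 2) > 0" "sn K (R/2) > 0" "sn K (r/2) \<ge> 0"
proof -
  have h: "K > 0 \<longrightarrow> s < pi / sqrt K" if "s < R" for s using that R by auto
  show "cs K (r/2) > 0" "cs K (R/2) > 0" using assms R h by (auto intro!: cs_half_pos)
  have "(R - r) / 2 < R" "(R + r) / 2 < R" "R/2 < R" using assms by auto
  note this[THEN h]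
  then show "sn K ((R - r) / 2) > 0" "sn K ((R + r) / 2) > 0" "sn K (R/2) > 0"
    using assms by (intro sn_pos; simp)+
  show "sn K (r/2) \<ge> 0"
  proof (cases "r = 0")
    case False
    then have "sn K (r/2) > 0" using assms h[of "r/2"] by (intro sn_pos) auto
    then show ?thesis by simp
  qed simp
qed

lemma grad_bound_pos: "0 \<le> r \<Longrightarrow> r < R \<Longrightarrow> grad_bound n K R r > 0"
  using radius_pos[of r] n_ge_2 unfolding grad_bound_def
  by (intro mult_pos_pos add_pos_pos divide_pos_pos) auto

text \<open>The vector - X is the gradient of ln (kern \<omega> / h). The coefficient of 1 / q in
  its squared norm is a nonnegative multiple of n m, so the nearest point gives the bound. For n = 2
  the coefficient vanishes and all boundary points give the same norm; extremal points must then be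
  told apart by direction, not by length.\<close>

lemma dirf_tangent:
  assumes x: "x = ex r \<theta>" "0 \<le> r" "r < R" "norm \<theta> = 1" and \<omega>: "norm \<omega> = 1"
  shows "\<exists>X \<in> tangent K x. (\<forall>e \<in> tangent K x. dirf x e \<omega> = - riem K X e) \<and>
     riem K X X \<le> (grad_bound n K R r)\<^sup>2 \<and>
     X = (2 * (1 / (Q - chord2 K x p) + m * K / (4 * (1 - K / 4 * chord2 K x p)))) *\<^sub>R tproj K x (x - p)
        + (n / chord2 K x (ex R \<omega>)) *\<^sub>R tproj K x (x - ex R \<omega>) \<and>
     (chord2 K x (ex R \<omega>) = 4 * (sn K ((R - r) / 2))\<^sup>2 \<longrightarrow> riem K X X = (grad_bound n K R r)\<^sup>2)"
proof -
  note pos = radius_pos[OF x(2,3)]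
  have xB: "x \<in> B" using x B_ex_iff by blast
  have xM: "x \<in> space_form K" using xB closed_ball_subset by blast
  have yM: "ex R \<omega> \<in> space_form K" by (rule ex_in_space_form[OF \<omega>])
  let ?q = "chord2 K x (ex R \<omega>)"
  have q: "?q > 0" by (rule chord2_pos[OF xB \<omega>])
  have qp: "chord2 K x p = 4 * (sn K (r/2))\<^sup>2" using x chord2_ex_p by simp
  define T where "T = (sn K (R/2))\<^sup>2 - (sn K (r/2))\<^sup>2"
  have QT: "Q - chord2 K x p = 4 * T" by (simp add: Q_def qp T_def)
  have Tpos: "T > 0" using Q_minus_pos[OF xB] QT by simp
  have z: "1 - K / 4 * chord2 K x p = (cs K (r/2))\<^sup>2" using cs_sn_square[of K "r/2"] by (simp add: qp)
  define a where "a = 1 / (4 * T) + m * K / (4 * (cs K (r/2))\<^sup>2)"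
  define b where "b = n / (2 * ?q)"
  define P where "P = tproj K x (x - p)"
  define Y where "Y = tproj K x (x - ex R \<omega>)"
  define X where "X = (2 * a) *\<^sub>R P + (2 * b) *\<^sub>R Y"
  have t: "P \<in> tangent K x" "Y \<in> tangent K x"
    unfolding P_def Y_def by (intro tproj_tangent xM fst_diff_space_form p yM)+
  have Xt: "X \<in> tangent K x" unfolding X_def using t subspace_tangent by (intro subspace_add subspace_scale)
  have d: "dirf x e \<omega> = - riem K X e" if "e \<in> tangent K x" for e
    unfolding dirf_def QT z X_def riem.add_left riem_simps P_def Y_def riem_tproj[OF xM that]
    by (simp add: a_def b_def)
  have py: "chord2 K p (ex R \<omega>) = Q" using chord2_ex_p[OF \<omega>, of R] by (simp add: Q_def chord2_sym)
  have "riem K X X = 4 * a\<^sup>2 * riem K P P + 8 * a * b * riem K P Y + 4 * b\<^sup>2 * riem K Y Y"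
    unfolding X_def by (simp add: riem_algebra riem_sym[of K Y P] power2_eq_square algebra_simps)
  also have "\<dots> = 4 * a\<^sup>2 * (4 * (sn K (r/2))\<^sup>2 - K * (4 * (sn K (r/2))\<^sup>2)\<^sup>2 / 4)
      + 8 * a * b * ((4 * (sn K (r/2))\<^sup>2 + ?q - 4 * (sn K (R/2))\<^sup>2) / 2 - K * (4 * (sn K (r/2))\<^sup>2) * ?q / 4)
      + 4 * b\<^sup>2 * (?q - K * ?q\<^sup>2 / 4)"
    unfolding P_def Y_def riem_tproj_diff_diff[OF xM p p] riem_tproj_diff_diff[OF xM p yM] riem_tproj_diff_diff[OF xM yM yM]
    by (simp add: py qp Q_def power2_eq_square)
  also have "\<dots> = (cs K (R/2) / cs K (r/2) * (n * sn K (R/2) * cs K (r/2) + 2 * m * cs K (R/2) * sn K (r/2)) / (2 * T))\<^sup>2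
      + 2 * n * m * ((cs K (R/2))\<^sup>2 / (cs K (r/2))\<^sup>2) * (1 / ?q - 1 / (4 * (sn K (R/2) * cs K (r/2) - cs K (R/2) * sn K (r/2))\<^sup>2))"
    by (rule grad_bound_identity)
       (use cs_sn_square[of K "r/2"] cs_sn_square[of K "R/2"] n_eq q pos Tpos in \<open>auto simp: T_def a_def b_def\<close>)
  also have "sn K (R/2) * cs K (r/2) - cs K (R/2) * sn K (r/2) = sn K ((R - r) / 2)"
    by (simp add: diff_divide_distrib sn_diff)
  also have "cs K (R/2) / cs K (r/2) * (n * sn K (R/2) * cs K (r/2) + 2 * m * cs K (R/2) * sn K (r/2)) / (2 * T) = grad_bound n K R r"
    unfolding T_def using pos by (subst grad_bound_eq) (auto simp: m_def)
  finally have XX: "riem K X X = (grad_bound n K R r)\<^sup>2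
      + 2 * n * m * ((cs K (R/2))\<^sup>2 / (cs K (r/2))\<^sup>2) * (1 / ?q - 1 / (4 * (sn K ((R - r) / 2))\<^sup>2))" .
  have "?q \<ge> 4 * (sn K ((R - r) / 2))\<^sup>2"
    unfolding x(1) using x rK[of r] R by (intro chord2_ex_ge \<omega> sn_nonneg) auto
  then have "1 / ?q - 1 / (4 * (sn K ((R - r) / 2))\<^sup>2) \<le> 0"
    using pos by (simp add: frac_le)
  then have "2 * n * m * ((cs K (R/2))\<^sup>2 / (cs K (r/2))\<^sup>2) * (1 / ?q - 1 / (4 * (sn K ((R - r) / 2))\<^sup>2)) \<le> 0"
    using n_ge_2 m_nonneg by (intro mult_nonneg_nonpos) auto
  then have "riem K X X \<le> (grad_bound n K R r)\<^sup>2" unfolding XX by simp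
  moreover have "X = (2 * (1 / (Q - chord2 K x p) + m * K / (4 * (1 - K / 4 * chord2 K x p)))) *\<^sub>R tproj K x (x - p)
        + (n / ?q) *\<^sub>R tproj K x (x - ex R \<omega>)"
    unfolding QT z by (simp add: X_def a_def b_def P_def Y_def)
  moreover have "?q = 4 * (sn K ((R - r) / 2))\<^sup>2 \<longrightarrow> riem K X X = (grad_bound n K R r)\<^sup>2"
    unfolding XX by simp
  ultimately show ?thesis using Xt d by blast
qed

lemma dirf_le:
  assumes x: "x \<in> B" and \<omega>: "norm \<omega> = 1" and e: "e \<in> tangent K x" "riem K e e = 1"
  shows "dirf x e \<omega> \<le> grad_bound n K R (riem_dist K p x)"
proof -
  obtain r \<theta> where r: "x = ex r \<theta>" "0 \<le> r" "r < R" "norm \<theta> = 1" "riem_dist K p x = r" using x by (rule radius)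
  obtain X where X: "X \<in> tangent K x" "dirf x e \<omega> = - riem K X e" "riem K X X \<le> (grad_bound n K R r)\<^sup>2"
    using dirf_tangent[OF r(1-4) \<omega>] e by blast
  have xM: "x \<in> space_form K" using x closed_ball_subset by blast
  have "(dirf x e \<omega>)\<^sup>2 \<le> riem K X X" using riem_Cauchy_Schwarz[OF xM X(1) e(1)] e(2) X(2) by simp
  then have "(dirf x e \<omega>)\<^sup>2 \<le> (grad_bound n K R r)\<^sup>2" using X(3) by simp
  then show ?thesis unfolding r(5) using grad_bound_pos[OF r(2,3)] by (rule power2_le_imp_le[OF _ less_imp_le])
qed

text \<open>A boundary point is determined by the direction in which it is seen from \<open>x\<close>.\<close>

lemma dirf_eq_bound_unique:
  assumes x: "x \<in> B" and e: "e \<in> tangent K x" "riem K e e = 1"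
    and \<omega>: "norm \<omega> = 1" "dirf x e \<omega> = grad_bound n K R (riem_dist K p x)"
    and \<omega>': "norm \<omega>' = 1" "dirf x e \<omega>' = grad_bound n K R (riem_dist K p x)"
  shows "\<omega> = \<omega>'"
proof -
  obtain r \<theta> where r: "x = ex r \<theta>" "0 \<le> r" "r < R" "norm \<theta> = 1" "riem_dist K p x = r" using x by (rule radius)
  have xM: "x \<in> space_form K" using x closed_ball_subset by blast
  let ?k = "2 * (1 / (Q - chord2 K x p) + m * K / (4 * (1 - K / 4 * chord2 K x p)))"
  let ?q = "\<lambda>\<omega>. chord2 K x (ex R \<omega>)" and ?Y = "\<lambda>\<omega>. tproj K x (x - ex R \<omega>)"
  have *: "?k *\<^sub>R tproj K x (x - p) + (n / ?q \<omega>) *\<^sub>R ?Y \<omega> = - (grad_bound n K R r) *\<^sub>R e"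
    if \<omega>: "norm \<omega> = 1" "dirf x e \<omega> = grad_bound n K R r" for \<omega>
  proof -
    obtain X where X: "X \<in> tangent K x" "\<forall>e \<in> tangent K x. dirf x e \<omega> = - riem K X e"
       "riem K X X \<le> (grad_bound n K R r)\<^sup>2"
       "X = ?k *\<^sub>R tproj K x (x - p) + (n / ?q \<omega>) *\<^sub>R ?Y \<omega>"
      using dirf_tangent[OF r(1-4) \<omega>(1)] by blast
    have Xe: "riem K X e = - grad_bound n K R r" using X(2) e \<omega>(2) by force
    have t: "X + grad_bound n K R r *\<^sub>R e \<in> tangent K x"
      using X(1) e(1) subspace_tangent by (intro subspace_add subspace_scale)
    \<comment> \<open>The case of equality in Cauchy-Schwarz: X has norm at most the bound and pairs
      with the unit vector e to minus the bound, so it is minus the bound times e.\<close>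
    have "riem K (X + grad_bound n K R r *\<^sub>R e) (X + grad_bound n K R r *\<^sub>R e)
       = riem K X X + 2 * grad_bound n K R r * riem K X e + (grad_bound n K R r)\<^sup>2 * riem K e e"
      by (simp add: riem_algebra riem_sym[of K e X] power2_eq_square algebra_simps)
    also have "\<dots> = riem K X X - (grad_bound n K R r)\<^sup>2" unfolding Xe e(2) by (simp add: power2_eq_square)
    also have "\<dots> \<le> 0" using X(3) by simp
    finally have "X + grad_bound n K R r *\<^sub>R e = 0" using riem_pos[OF xM t] by fastforce
    then have "X = - (grad_bound n K R r *\<^sub>R e)" by (rule eq_neg_iff_add_eq_0[THEN iffD2])
    then show ?thesis using X(4) by simp
  qed
  have eq: "(n / ?q \<omega>) *\<^sub>R ?Y \<omega> = (n / ?q \<omega>') *\<^sub>R ?Y \<omega>'"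
    using *[of \<omega>] *[of \<omega>'] \<omega> \<omega>' r(5) by (metis add_left_cancel)
  have n0: "n \<noteq> 0" using n_ge_2 by simp
  \<comment> \<open>The length of the vector towards the boundary point determines its squared
    chord; chord and direction together determine the point.\<close>
  have YY: "riem K ((n / ?q \<omega>) *\<^sub>R ?Y \<omega>) ((n / ?q \<omega>) *\<^sub>R ?Y \<omega>) = n\<^sup>2 * (1 / ?q \<omega> - K / 4)" if \<omega>: "norm \<omega> = 1" for \<omega>
  proof -
    have yM: "ex R \<omega> \<in> space_form K" by (rule ex_in_space_form[OF \<omega>])
    have q: "?q \<omega> > 0" by (rule chord2_pos[OF x \<omega>])
    have "riem K (?Y \<omega>) (?Y \<omega>) = ?q \<omega> - K * ?q \<omega> * ?q \<omega> / 4"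
      using riem_tproj_diff_diff[OF xM yM yM] by simp
    then have "riem K ((n / ?q \<omega>) *\<^sub>R ?Y \<omega>) ((n / ?q \<omega>) *\<^sub>R ?Y \<omega>) = (n / ?q \<omega>) * ((n / ?q \<omega>) * (?q \<omega> - K * ?q \<omega> * ?q \<omega> / 4))"
      by simp
    also have "\<dots> = n\<^sup>2 * (1 / ?q \<omega> - K / 4)" using q by (simp add: power2_eq_square field_simps)
    finally show ?thesis .
  qed
  have "n\<^sup>2 * (1 / ?q \<omega> - K / 4) = n\<^sup>2 * (1 / ?q \<omega>' - K / 4)"
    using YY[OF \<omega>(1)] YY[OF \<omega>'(1)] eq by simp
  then have "1 / ?q \<omega> = 1 / ?q \<omega>'" using n0 by simp
  then have qq: "?q \<omega> = ?q \<omega>'" by (metis div_by_1 divide_divide_eq_right mult_1)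
  then have "?Y \<omega> = ?Y \<omega>'" using eq n0 chord2_pos[OF x \<omega>'(1)] by simp
  then have "ex R \<omega> = ex R \<omega>'"
    using tproj_diff[OF xM ex_in_space_form[OF \<omega>(1)]] tproj_diff[OF xM ex_in_space_form[OF \<omega>'(1)]] qq by simp
  then have "L (sn K R *\<^sub>R \<omega>) = L (sn K R *\<^sub>R \<omega>')" by (simp add: ex_def L_scaleR)
  then have "sn K R *\<^sub>R \<omega> = sn K R *\<^sub>R \<omega>'" by (rule inj_L)
  then show ?thesis using sn_pos[OF R] by simp
qed

end

section \<open>Positive solutions\<close>

locale positive_solution = space_form_ball K p R n
  for K :: real and p :: "real \<times> 'a::euclidean_space" and R n :: real +
  fixes u :: "real \<times> 'a \<Rightarrow> real"
  assumes u_pos: "\<And>x. x \<in> B \<Longrightarrow> u x > 0" and u: "conformal_solution K B u"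
begin

lemma u_has_derivative:
  assumes "x \<in> B"
  shows "\<exists>D. (u has_derivative D) (at x within space_form K)"
proof -
  obtain D D2 where "has_jet K u x D D2" using u assms unfolding conformal_solution_B by blast
  then show ?thesis using has_jet_derivative closed_ball_subset assms by blast
qed

lemma continuous_on_u: "continuous_on B u"
  unfolding continuous_on_eq_continuous_within
proof
  fix x assume x: "x \<in> B"
  obtain D where "(u has_derivative D) (at x within space_form K)" using u_has_derivative[OF x] by blast
  then have "continuous (at x within space_form K) u" by (rule has_derivative_continuous)
  then show "continuous (at x within B) u" by (rule continuous_within_subset) (use closed_ball_subset in blast)
qed

abbreviation log_u where
  "log_u \<equiv> \<lambda>z. ln (cs K (riem_dist K p z / 2) ^ (DIM('a) - 2) * u z)"

text \<open>\<open>h\<close> times the differential of \<open>u / h\<close>, where \<open>D\<close> is the differential of \<open>u\<close>.\<close>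

abbreviation twist where
  "twist D x v \<equiv> D v - m * K / 2 * riem K (x - p) v / (1 - K / 4 * chord2 K x p) * u x"

abbreviation kernS where "kernS s \<equiv> space_form_ball.kern K p s n"
abbreviation kgradS where "kgradS s \<equiv> space_form_ball.kgrad K p s n"
abbreviation dirS where "dirS s \<equiv> space_form_ball.dirf K p s n"

text \<open>Integration over the sphere of radius \<open>s\<close> against the boundary values of \<open>u\<close>, in terms of unit vectors.\<close>

definition E :: "real \<Rightarrow> ('a \<Rightarrow> real) \<Rightarrow> real" where
  "E s f = space_form_ball.cP K p s n * sphere_integral (\<lambda>\<omega>. u (ex s \<omega>) * f \<omega>)"

lemma ex_in_B: "0 < s \<Longrightarrow> s < R \<Longrightarrow> norm \<omega> = 1 \<Longrightarrow> ex s \<omega> \<in> B"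
  unfolding B_ex_iff by (intro exI[of _ s] exI[of _ \<omega>]) simp

lemma continuous_on_u_ex:
  assumes "0 < s" "s < R"
  shows "continuous_on (sphere 0 1) (\<lambda>\<omega>. u (ex s \<omega>))"
  by (rule continuous_on_compose2[OF continuous_on_u]) (auto intro!: continuous_intros ex_in_B assms)

lemma E_mono:
  fixes f g' :: "'a \<Rightarrow> real"
  assumes s: "0 < s" "s < R" and f: "continuous_on (sphere 0 1) f" and g: "continuous_on (sphere 0 1) g'"
    and le: "\<And>\<omega>. norm \<omega> = 1 \<Longrightarrow> f \<omega> \<le> g' \<omega>"
  shows "E s f \<le> E s g'"
proof -
  interpret Bs: space_form_ball K p s n by (rule smaller_ball) (use s in auto)
  note c = continuous_on_u_ex[OF s]
  have "sphere_integral (\<lambda>\<omega>. u (ex s \<omega>) * f \<omega>) \<le> sphere_integral (\<lambda>\<omega>. u (ex s \<omega>) * g' \<omega>)"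
    by (intro sphere_integral_mono continuous_on_mult c f g mult_left_mono le less_imp_le[OF u_pos] ex_in_B s)
  then show ?thesis unfolding E_def using Bs.cP_pos by simp
qed

lemma E_affine:
  assumes s: "0 < s" "s < R" and f: "continuous_on (sphere 0 1) f"
  shows "E s (\<lambda>\<omega>. a + b * f \<omega>) = a * E s (\<lambda>_. 1) + b * E s f"
proof -
  note c = continuous_on_u_ex[OF s]
  have "sphere_integral (\<lambda>\<omega>. u (ex s \<omega>) * (a + b * f \<omega>)) = sphere_integral (\<lambda>\<omega>. a * u (ex s \<omega>) + b * (u (ex s \<omega>) * f \<omega>))"
    by (rule sphere_integral_cong) (simp add: algebra_simps)
  also have "\<dots> = a * sphere_integral (\<lambda>\<omega>. u (ex s \<omega>)) + b * sphere_integral (\<lambda>\<omega>. u (ex s \<omega>) * f \<omega>)"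
    using c f by (simp add: sphere_integral_add sphere_integral_mult continuous_intros)
  finally show ?thesis by (simp add: E_def algebra_simps)
qed

lemma E_cong:
  fixes f g' :: "'a \<Rightarrow> real"
  shows "(\<And>\<omega>. norm \<omega> = 1 \<Longrightarrow> f \<omega> = g' \<omega>) \<Longrightarrow> E s f = E s g'"
  unfolding E_def by (intro arg_cong2[where f = "(*)"] refl sphere_integral_cong) simp

lemma represent:
  assumes s: "0 < s" "s < R" and x: "x \<in> geodesic_ball K p s"
  shows "u x = E s (\<lambda>\<omega>. kernS s \<omega> x)"
proof -
  interpret Bs: space_form_ball K p s n by (rule smaller_ball) (use s in auto)
  have sub: "Bs.B \<union> Bs.S \<subseteq> B" using smaller_ball_subset[OF s] .
  have "conformal_solution K Bs.B u"
    using u sub unfolding conformal_solution_B Bs.conformal_solution_B by blast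
  moreover have uc: "continuous_on (Bs.B \<union> Bs.S) u" by (rule continuous_on_subset[OF continuous_on_u sub])
  ultimately have "dirichlet_solution K p s u u" by (simp add: dirichlet_solution_def)
  moreover have "continuous_on Bs.S u" by (rule continuous_on_subset[OF uc]) simp
  ultimately have "u x = Bs.cP * Bs.W (\<lambda>\<omega>. u (ex s \<omega>)) x" using Bs.dirichlet_solution_iff x by blast
  then show ?thesis by (simp add: E_def Bs.W_def)
qed

text \<open>The given D and the derivative of the integral are both derivatives within the
  hypersurface, hence agree on the tangent vector e by \<open>deriv_along_eq\<close>. The zero-order
  correction is then absorbed into the integrand by \<open>kgrad_dirf\<close>.\<close>

lemma represent_derivative:
  assumes s: "0 < s" "s < R" and x: "x \<in> geodesic_ball K p s"
    and D: "(u has_derivative D) (at x within space_form K)" and e: "e \<in> tangent K x"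
  shows "twist D x e = E s (\<lambda>\<omega>. kernS s \<omega> x * dirS s x e \<omega>)"
proof -
  interpret Bs: space_form_ball K p s n by (rule smaller_ball) (use s in auto)
  note c = continuous_on_u_ex[OF s]
  have xM: "x \<in> space_form K" using x by (simp add: geodesic_ball_def)
  have xU: "x \<in> Bs.U" using x Bs.B_subset_U by blast
  have xV: "x \<in> Bs.V" using x Bs.B_eq by blast
  note j = has_jet_lincomb[OF Bs.W_jet[OF c xU] Bs.W_jet[OF c xU], of Bs.cP 0]
  have "Bs.cP * Bs.W (\<lambda>\<omega>. u (ex s \<omega>)) y + 0 * Bs.W (\<lambda>\<omega>. u (ex s \<omega>)) y = u y" if "y \<in> space_form K \<inter> Bs.V" for y
    using represent[OF s, of y] that by (simp add: Bs.B_eq E_def Bs.W_def)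
  from has_jet_derivative[OF has_jet_cong[OF j Bs.open_V xV this] xM] deriv_along_eq[OF D xM e]
  have De: "D e = Bs.cP * sphere_integral (\<lambda>\<omega>. u (ex s \<omega>) * (kgradS s \<omega> x \<bullet> e))"
    using deriv_along_eq[OF _ xM e, of u] by simp
  define l where "l = m * K / 2 * riem K (x - p) e / (1 - K / 4 * chord2 K x p)"
  have k: "continuous_on (sphere 0 1) (\<lambda>\<omega>. kernS s \<omega> x)" "continuous_on (sphere 0 1) (\<lambda>\<omega>. kgradS s \<omega> x)"
    using xU by (auto intro!: Bs.continuous_on_kern continuous_intros)
  have "D e - l * u x = Bs.cP * sphere_integral (\<lambda>\<omega>. u (ex s \<omega>) * (kgradS s \<omega> x \<bullet> e))
      - Bs.cP * (l * sphere_integral (\<lambda>\<omega>. u (ex s \<omega>) * kernS s \<omega> x))"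
    unfolding De represent[OF s x] E_def by simp
  also have "l * sphere_integral (\<lambda>\<omega>. u (ex s \<omega>) * kernS s \<omega> x) = sphere_integral (\<lambda>\<omega>. l * (u (ex s \<omega>) * kernS s \<omega> x))"
    by (intro sphere_integral_mult[symmetric] continuous_intros c k)
  also have "Bs.cP * sphere_integral (\<lambda>\<omega>. u (ex s \<omega>) * (kgradS s \<omega> x \<bullet> e)) - Bs.cP * sphere_integral (\<lambda>\<omega>. l * (u (ex s \<omega>) * kernS s \<omega> x))
    = Bs.cP * sphere_integral (\<lambda>\<omega>. u (ex s \<omega>) * (kgradS s \<omega> x \<bullet> e) - l * (u (ex s \<omega>) * kernS s \<omega> x))"
    using c k by (simp add: sphere_integral_diff continuous_intros right_diff_distrib)
  also have "\<dots> = E s (\<lambda>\<omega>. kernS s \<omega> x * dirS s x e \<omega>)"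
    unfolding E_def
  proof (intro arg_cong2[where f = "(*)"] refl sphere_integral_cong)
    fix \<omega> :: 'a assume \<omega>: "norm \<omega> = 1"
    show "u (ex s \<omega>) * (kgradS s \<omega> x \<bullet> e) - l * (u (ex s \<omega>) * kernS s \<omega> x) = u (ex s \<omega>) * (kernS s \<omega> x * dirS s x e \<omega>)"
      unfolding Bs.kgrad_dirf[OF x \<omega>, of e, symmetric] l_def[symmetric] by (simp add: algebra_simps)
  qed
  finally show ?thesis unfolding l_def .
qed

lemma in_smaller_ball:
  assumes "x \<in> B" "riem_dist K p x < s"
  shows "x \<in> geodesic_ball K p s"
  using assms by (simp add: geodesic_ball_def)

lemma riem_dist_nonneg: "x \<in> B \<Longrightarrow> 0 \<le> riem_dist K p x" and riem_dist_less: "x \<in> B \<Longrightarrow> riem_dist K p x < R"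
  by (auto elim!: radius)

text \<open>Kernel and \<open>dirf\<close> belong to the structure of a ball of fixed radius;
  explicit formulas are needed where the radius s becomes a variable.\<close>

lemma kern_eq_s:
  assumes "0 < s" "s \<le> R"
  shows "kernS s \<omega> x = (4 * (sn K (s/2))\<^sup>2 - chord2 K x p) * chord2 K x (ex s \<omega>) powr (- (n / 2))"
  using space_form_ball.kern_eq[OF smaller_ball[OF assms]] space_form_ball.Q_def[OF smaller_ball[OF assms]] by simp

lemma dirf_eq_s:
  assumes "0 < s" "s \<le> R"
  shows "dirS s x e \<omega> = - (2 * (1 / (4 * (sn K (s/2))\<^sup>2 - chord2 K x p) + m * K / (4 * (1 - K / 4 * chord2 K x p))) * riem K (x - p) e
     + n / chord2 K x (ex s \<omega>) * riem K (x - ex s \<omega>) e)"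
  using space_form_ball.dirf_def[OF smaller_ball[OF assms]] space_form_ball.Q_def[OF smaller_ball[OF assms]] by simp

text \<open>Radii bounded below by s0 > r(x) keep x inside all the balls, so numerators and
  denominators stay away from the singularities up to and including s = R. This closed range
  supplies the compactness for the case of equality.\<close>

lemma continuous_on_kern_dirf:
  assumes x: "x \<in> B" and s0: "riem_dist K p x < s0" "s0 \<le> R"
  shows "continuous_on ({s0..R} \<times> sphere 0 1) (\<lambda>z. kernS (fst z) (snd z) x)" (is ?th1)
    "continuous_on ({s0..R} \<times> sphere 0 1) (\<lambda>z. dirS (fst z) x e (snd z))" (is ?th2)
proof -
  let ?D = "{s0..R} \<times> sphere (0::'a) 1"
  have s: "0 < s" "s \<le> R" if "s \<in> {s0..R}" for s using that s0 riem_dist_nonneg[OF x] by auto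
  have q: "chord2 K x (ex (fst z) (snd z)) > 0" and T: "4 * (sn K (fst z/2))\<^sup>2 - chord2 K x p > 0" if "z \<in> ?D" for z
  proof -
    have sz: "fst z \<in> {s0..R}" and nz: "norm (snd z) = 1" using that by auto
    interpret Bs: space_form_ball K p "fst z" n by (rule smaller_ball) (use s[OF sz] in auto)
    have xs: "x \<in> Bs.B" by (rule in_smaller_ball[OF x]) (use sz s0 in auto)
    show "chord2 K x (ex (fst z) (snd z)) > 0" by (rule Bs.chord2_pos[OF xs nz])
    show "4 * (sn K (fst z/2))\<^sup>2 - chord2 K x p > 0" using Bs.Q_minus_pos[OF xs] by (simp add: Bs.Q_def)
  qed
  have z0: "4 * (1 - K / 4 * chord2 K x p) \<noteq> 0" using one_minus_pos[of x] x by auto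
  have "continuous_on ?D (\<lambda>z. (4 * (sn K (fst z/2))\<^sup>2 - chord2 K x p) * chord2 K x (ex (fst z) (snd z)) powr (- (n / 2)))"
    by (intro continuous_intros ballI less_imp_neq[OF q, symmetric] zero_neq_numeral[symmetric])
  then show ?th1
  proof (rule continuous_on_eq)
    fix z assume "z \<in> ?D"
    then have "fst z \<in> {s0..R}" by (simp only: mem_Times_iff)
    from kern_eq_s[OF s[OF this]] show "(4 * (sn K (fst z/2))\<^sup>2 - chord2 K x p) * chord2 K x (ex (fst z) (snd z)) powr (- (n / 2)) = kernS (fst z) (snd z) x"
      by (rule sym)
  qed
  have "continuous_on ?D (\<lambda>z. - (2 * (1 / (4 * (sn K (fst z/2))\<^sup>2 - chord2 K x p) + m * K / (4 * (1 - K / 4 * chord2 K x p))) * riem K (x - p) e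
     + n / chord2 K x (ex (fst z) (snd z)) * riem K (x - ex (fst z) (snd z)) e))"
    by (intro continuous_intros riem.continuous_on ballI less_imp_neq[OF q, symmetric] less_imp_neq[OF T, symmetric] zero_neq_numeral[symmetric] z0)
  then show ?th2
  proof (rule continuous_on_eq)
    fix z assume "z \<in> ?D"
    then have "fst z \<in> {s0..R}" by (simp only: mem_Times_iff)
    from dirf_eq_s[OF s[OF this]] show "- (2 * (1 / (4 * (sn K (fst z/2))\<^sup>2 - chord2 K x p) + m * K / (4 * (1 - K / 4 * chord2 K x p))) * riem K (x - p) e
     + n / chord2 K x (ex (fst z) (snd z)) * riem K (x - ex (fst z) (snd z)) e) = dirS (fst z) x e (snd z)"
      by (rule sym)
  qed
qed

lemma isCont_grad_bound:
  assumes "0 \<le> r" "r < R"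
  shows "isCont (\<lambda>s. grad_bound n K s r) R"
proof -
  note pos = radius_pos[OF assms]
  have sn: "isCont (\<lambda>s. sn K (f s)) a" and cs: "isCont (\<lambda>s. cs K (f s)) a" if "isCont f a" for f :: "real \<Rightarrow> real" and a
    using isCont_o2[OF that, of "sn K"] isCont_o2[OF that, of "cs K"] DERIV_isCont[OF has_derivative_sn] DERIV_isCont[OF has_derivative_cs]
    by auto
  show ?thesis unfolding grad_bound_def
    by (intro continuous_intros sn cs) (use pos in auto)
qed

lemma eventually_at_left_R:
  assumes "s0 < R"
  shows "\<forall>\<^sub>F s in at_left R. s0 < s \<and> s < R"
  using assms by (simp add: eventually_at_left_field) blast

lemma log_derivative_le:
  assumes x: "x \<in> B" and D: "(u has_derivative D) (at x within space_form K)"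
    and e: "e \<in> tangent K x" "riem K e e = 1"
  shows "twist D x e \<le> grad_bound n K R (riem_dist K p x) * u x"
proof -
  let ?r = "riem_dist K p x"
  have le: "twist D x e \<le> grad_bound n K s ?r * u x"
    if s: "?r < s" "s < R" for s
  proof -
    have s0: "0 < s" using s riem_dist_nonneg[OF x] by simp
    have xs: "x \<in> geodesic_ball K p s" by (rule in_smaller_ball[OF x s(1)])
    interpret Bs: space_form_ball K p s n by (rule smaller_ball) (use s s0 in auto)
    have xU: "x \<in> Bs.U" using xs Bs.B_subset_U by blast
    have kc: "continuous_on (sphere 0 1) (\<lambda>\<omega>. kernS s \<omega> x)" by (rule Bs.continuous_on_kern_sphere[OF xU])
    have dc: "continuous_on (sphere 0 1) (\<lambda>\<omega>. dirS s x e \<omega>)"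
    proof -
      have "continuous_on (sphere 0 1) (\<lambda>\<omega>. dirS (fst (s, \<omega>)) x e (snd (s, \<omega>)))"
        by (rule continuous_on_compose2[OF continuous_on_kern_dirf(2)[OF x s(1) less_imp_le[OF s(2)], of e]])
          (use s in \<open>auto intro!: continuous_intros\<close>)
      then show ?thesis by simp
    qed
    have "twist D x e = E s (\<lambda>\<omega>. kernS s \<omega> x * dirS s x e \<omega>)"
      by (rule represent_derivative[OF s0 s(2) xs D e(1)])
    also have "\<dots> \<le> E s (\<lambda>\<omega>. 0 + grad_bound n K s ?r * kernS s \<omega> x)"
    proof (rule E_mono[OF s0 s(2)])
      fix \<omega> :: 'a assume \<omega>: "norm \<omega> = 1"
      have "kernS s \<omega> x * dirS s x e \<omega> \<le> kernS s \<omega> x * grad_bound n K s ?r"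
        using Bs.dirf_le[OF xs \<omega> e] Bs.kern_pos[OF xs \<omega>] by (intro mult_left_mono) auto
      then show "kernS s \<omega> x * dirS s x e \<omega> \<le> 0 + grad_bound n K s ?r * kernS s \<omega> x" by (simp add: mult.commute)
    qed (use kc dc in \<open>auto intro!: continuous_intros\<close>)
    also have "\<dots> = grad_bound n K s ?r * u x"
      unfolding E_affine[OF s0 s(2) kc] represent[OF s0 s(2) xs] by simp
    finally show ?thesis .
  qed
  have "((\<lambda>s. grad_bound n K s ?r * u x) \<longlongrightarrow> grad_bound n K R ?r * u x) (at_left R)"
    using isCont_grad_bound[OF riem_dist_nonneg[OF x] riem_dist_less[OF x]]
    unfolding isCont_def by (intro tendsto_mult_right) (rule filterlim_at_split[THEN iffD1, THEN conjunct1])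
  moreover have "\<forall>\<^sub>F s in at_left R. twist D x e \<le> grad_bound n K s ?r * u x"
    by (rule eventually_mono[OF eventually_at_left_R[OF riem_dist_less[OF x]]]) (use le in blast)
  ultimately show ?thesis by (rule tendsto_lowerbound) (rule trivial_limit_at_left_real)
qed

text \<open>The total mass is read off at the centre, where the kernel takes the same value at all
  boundary points, so it equals u p divided by that value.\<close>

lemma E_1_tendsto:
  "((\<lambda>s. E s (\<lambda>_. 1)) \<longlongrightarrow> u p / (Q * Q powr (- (n / 2)))) (at_left R)"
proof -
  have Q: "Q > 0" using sn_pos[of "R/2" K] R rK[of "R/2"] by (simp add: Q_def)
  define \<kappa> where "\<kappa> s = 4 * (sn K (s/2))\<^sup>2 * (4 * (sn K (s/2))\<^sup>2) powr (- (n / 2))" for s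
  have eq: "u p / \<kappa> s = E s (\<lambda>_. 1)" if s: "0 < s" "s < R" for s
  proof -
    interpret Bs: space_form_ball K p s n by (rule smaller_ball) (use s in auto)
    have \<kappa>: "\<kappa> s > 0" using sn_pos[of "s/2" K] s rK[of "s/2"] by (simp add: \<kappa>_def)
    have "u p = E s (\<lambda>\<omega>. kernS s \<omega> p)" by (rule represent[OF s Bs.p_in_B])
    also have "\<dots> = E s (\<lambda>\<omega>. 0 + \<kappa> s * 1)" by (rule E_cong) (simp add: Bs.kern_p Bs.Q_def \<kappa>_def)
    also have "\<dots> = \<kappa> s * E s (\<lambda>_. 1)" by (subst E_affine[OF s]) auto
    finally show ?thesis using \<kappa> by simp
  qed
  have "isCont (\<lambda>s. sn K (s/2)) R"
    using isCont_o2[of R "\<lambda>s. s/2" "sn K"] DERIV_isCont[OF has_derivative_sn] by auto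
  then have "isCont (\<lambda>s. u p / \<kappa> s) R"
    unfolding \<kappa>_def using Q by (intro continuous_intros) (auto simp: Q_def)
  then have "((\<lambda>s. u p / \<kappa> s) \<longlongrightarrow> u p / (Q * Q powr (- (n / 2)))) (at_left R)"
    unfolding isCont_def by (simp add: \<kappa>_def Q_def filterlim_at_split)
  moreover have "\<forall>\<^sub>F s in at_left R. u p / \<kappa> s = E s (\<lambda>_. 1)"
    using eventually_at_left_R[OF R(1)] by eventually_elim (use eq in auto)
  ultimately show ?thesis by (rule Lim_transform_eventually)
qed

section \<open>The case of equality\<close>

text \<open>In the case of equality the boundary values of \<open>u\<close> on the spheres of radius \<open>s < R\<close> concentrate,
  as \<open>s\<close> tends to \<open>R\<close>, where the kernel attains the bound.\<close>

lemma concentration: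
  assumes x: "x \<in> B" and D: "(u has_derivative D) (at x within space_form K)"
    and e: "e \<in> tangent K x" "riem K e e = 1"
    and eq: "twist D x e = grad_bound n K R (riem_dist K p x) * u x"
    and s0: "riem_dist K p x < s0" "s0 < R"
    and F: "continuous_on ({s0..R} \<times> sphere 0 1) F"
    and F0: "\<And>\<omega>. norm \<omega> = 1 \<Longrightarrow> dirf x e \<omega> = grad_bound n K R (riem_dist K p x) \<Longrightarrow> F (R, \<omega>) \<le> 0"
    and lim: "((\<lambda>s. E s (\<lambda>\<omega>. F (s, \<omega>))) \<longlongrightarrow> l) (at_left R)"
  shows "l \<le> 0"
proof -
  let ?r = "riem_dist K p x" and ?D = "{s0..R} \<times> sphere (0::'a) 1"
  let ?g = "\<lambda>s. grad_bound n K s ?r"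
  note r = riem_dist_nonneg[OF x] riem_dist_less[OF x]
  \<comment> \<open>The deficit in the pointwise bound on the sphere of radius s. It is nonnegative,
    and the assumed equality makes its \<open>E s\<close> integral (g(s) - g(R)) u x, with g(s) the
    bound for radius s; this tends to 0.\<close>
  define \<Psi> where "\<Psi> z = kernS (fst z) (snd z) x * (?g (fst z) - dirS (fst z) x e (snd z))" for z
  have gc: "continuous_on {s0..R} ?g"
  proof -
    have sp: "sn K ((s - ?r) / 2) > 0" "sn K ((s + ?r) / 2) > 0" if "s \<in> {s0..R}" for s
    proof -
      interpret Bs: space_form_ball K p s n by (rule smaller_ball) (use that s0 r in auto)
      show "sn K ((s - ?r) / 2) > 0" "sn K ((s + ?r) / 2) > 0" using Bs.radius_pos[of ?r] that s0 r by auto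
    qed
    have cp: "cs K (?r / 2) > 0" using radius_pos[OF r] by simp
    show ?thesis unfolding grad_bound_def
      by (intro continuous_intros) (use sp cp in \<open>simp_all add: order_less_imp_not_eq2 del: mult_eq_0_iff\<close>)
  qed
  have gc2: "continuous_on ?D (\<lambda>z. ?g (fst z))"
    by (rule continuous_on_compose2[OF gc]) (auto intro!: continuous_intros)
  have \<Psi>c: "continuous_on ?D \<Psi>"
    unfolding \<Psi>_def using continuous_on_kern_dirf[OF x s0(1) less_imp_le[OF s0(2)]] gc2 by (intro continuous_intros)
  have \<Psi>0: "\<Psi> (s, \<omega>) \<ge> 0" if "s \<in> {s0..R}" "norm \<omega> = 1" for s \<omega>
  proof -
    interpret Bs: space_form_ball K p s n by (rule smaller_ball) (use that s0 r in auto)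
    have xs: "x \<in> Bs.B" by (rule in_smaller_ball[OF x]) (use that s0 in auto)
    show ?thesis using Bs.kern_pos[OF xs that(2)] Bs.dirf_le[OF xs that(2) e] by (simp add: \<Psi>_def)
  qed
  let ?\<tau> = "u p / (Q * Q powr (- (n / 2)))"
  have "l \<le> 0 + \<epsilon>" if \<epsilon>: "\<epsilon> > 0" for \<epsilon>
  proof -
    have \<tau>: "?\<tau> > 0" using u_pos[OF p_in_B] sn_pos[of "R/2" K] R rK[of "R/2"] by (simp add: Q_def)
    \<comment> \<open>The masses tend to \<tau>, so an error \<delta> under the integral contributes
      \<epsilon> in the limit.\<close>
    define \<delta> where "\<delta> = \<epsilon> / ?\<tau>"
    have \<delta>: "\<delta> > 0" unfolding \<delta>_def using \<epsilon> \<tau> by (rule divide_pos_pos)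
    \<comment> \<open>The summand R - s forces the zeros of the comparison function to lie at s = R,
      where the hypothesis on F is available; as the kernel is positive, a zero of the deficit there
      means that the bound is attained.\<close>
    have "\<exists>M\<ge>0. \<forall>z \<in> ?D. F z \<le> \<delta> + M * (\<Psi> z + (R - fst z))"
    proof (rule compact_eps_bound[OF _ F _ _ _ \<delta>])
      show "compact ?D" by (intro compact_Times) auto
      show "continuous_on ?D (\<lambda>z. \<Psi> z + (R - fst z))" by (intro continuous_intros \<Psi>c)
      fix z assume z: "z \<in> ?D"
      obtain s \<omega> where zs: "z = (s, \<omega>)" by (cases z)
      have sw: "s \<in> {s0..R}" "norm \<omega> = 1" using z zs by auto
      have ps: "\<Psi> (s, \<omega>) \<ge> 0" by (rule \<Psi>0[OF sw])
      show "0 \<le> \<Psi> z + (R - fst z)" using ps sw zs by simp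
      assume "\<Psi> z + (R - fst z) = 0"
      then have "\<Psi> (s, \<omega>) + (R - s) = 0" by (simp add: zs)
      then have "s = R" and "\<Psi> (s, \<omega>) = 0" using ps sw(1) by auto
      then have "\<Psi> (R, \<omega>) = 0" by simp
      then have "dirf x e \<omega> = ?g R" using kern_pos[OF x sw(2)] by (simp add: \<Psi>_def)
      then show "F z \<le> 0" using F0[OF sw(2)] zs \<open>s = R\<close> by simp
    qed
    then obtain M where M: "M \<ge> 0" "\<And>s \<omega>. s \<in> {s0..R} \<Longrightarrow> norm \<omega> = 1 \<Longrightarrow> F (s, \<omega>) \<le> \<delta> + M * (\<Psi> (s, \<omega>) + (R - s))"
      by fastforce
    have le: "E s (\<lambda>\<omega>. F (s, \<omega>)) \<le> (\<delta> + M * (R - s)) * E s (\<lambda>_. 1) + M * ((?g s - ?g R) * u x)" if s: "s0 < s" "s < R" for s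
    proof -
      have s1: "0 < s" "s \<in> {s0..R}" using s s0 r by auto
      interpret Bs: space_form_ball K p s n by (rule smaller_ball) (use s s1 in auto)
      have xs: "x \<in> Bs.B" by (rule in_smaller_ball[OF x]) (use s s0 in auto)
      have slice: "continuous_on (sphere 0 1) (\<lambda>\<omega>. G (s, \<omega>))" if "continuous_on ?D G" for G :: "real \<times> 'a \<Rightarrow> real"
        by (rule continuous_on_compose2[OF that]) (use s1 in \<open>auto intro!: continuous_intros\<close>)
      have kc: "continuous_on (sphere 0 1) (\<lambda>\<omega>. kernS s \<omega> x)" "continuous_on (sphere 0 1) (\<lambda>\<omega>. dirS s x e \<omega>)"
        using continuous_on_kern_dirf[OF x s0(1) less_imp_le[OF s0(2)], THEN slice] by simp_all
      have "E s (\<lambda>\<omega>. F (s, \<omega>)) \<le> E s (\<lambda>\<omega>. (\<delta> + M * (R - s)) + M * \<Psi> (s, \<omega>))"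
        using M(2)[OF s1(2)] by (intro E_mono s1 s slice F continuous_intros \<Psi>c) (simp add: algebra_simps)
      also have "\<dots> = (\<delta> + M * (R - s)) * E s (\<lambda>_. 1) + M * E s (\<lambda>\<omega>. \<Psi> (s, \<omega>))"
        by (rule E_affine[OF s1(1) s(2) slice[OF \<Psi>c]])
      also have "E s (\<lambda>\<omega>. \<Psi> (s, \<omega>)) = (?g s - ?g R) * u x"
      proof -
        have "E s (\<lambda>\<omega>. kernS s \<omega> x * dirS s x e \<omega>) = ?g R * u x"
          using represent_derivative[OF s1(1) s(2) xs D e(1)] eq by simp
        moreover have "E s (\<lambda>\<omega>. \<Psi> (s, \<omega>)) = Bs.cP * sphere_integral (\<lambda>\<omega>. ?g s * (u (ex s \<omega>) * kernS s \<omega> x) - u (ex s \<omega>) * (kernS s \<omega> x * dirS s x e \<omega>))"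
          unfolding E_def by (intro arg_cong2[where f = "(*)"] refl sphere_integral_cong) (simp add: \<Psi>_def algebra_simps)
        moreover have "\<dots> = ?g s * E s (\<lambda>\<omega>. kernS s \<omega> x) - E s (\<lambda>\<omega>. kernS s \<omega> x * dirS s x e \<omega>)"
        proof -
          note c = continuous_on_u_ex[OF s1(1) s(2)]
          have "sphere_integral (\<lambda>\<omega>. ?g s * (u (ex s \<omega>) * kernS s \<omega> x) - u (ex s \<omega>) * (kernS s \<omega> x * dirS s x e \<omega>))
            = sphere_integral (\<lambda>\<omega>. ?g s * (u (ex s \<omega>) * kernS s \<omega> x)) - sphere_integral (\<lambda>\<omega>. u (ex s \<omega>) * (kernS s \<omega> x * dirS s x e \<omega>))"
            by (intro sphere_integral_diff continuous_intros c kc)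
          also have "sphere_integral (\<lambda>\<omega>. ?g s * (u (ex s \<omega>) * kernS s \<omega> x)) = ?g s * sphere_integral (\<lambda>\<omega>. u (ex s \<omega>) * kernS s \<omega> x)"
            by (intro sphere_integral_mult continuous_intros c kc)
          finally show ?thesis by (simp add: E_def right_diff_distrib mult.left_commute)
        qed
        ultimately show ?thesis using represent[OF s1(1) s(2) xs] by (simp add: left_diff_distrib)
      qed
      finally show ?thesis .
    qed
    have "((\<lambda>s. ?g s) \<longlongrightarrow> ?g R) (at_left R)"
      using isCont_grad_bound[OF r] by (simp add: isCont_def filterlim_at_split)
    then have "((\<lambda>s. (\<delta> + M * (R - s)) * E s (\<lambda>_. 1) + M * ((?g s - ?g R) * u x)) \<longlongrightarrow>
       (\<delta> + M * (R - R)) * ?\<tau> + M * ((?g R - ?g R) * u x)) (at_left R)"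
      by (intro tendsto_intros E_1_tendsto)
    moreover have "\<forall>\<^sub>F s in at_left R. E s (\<lambda>\<omega>. F (s, \<omega>)) \<le> (\<delta> + M * (R - s)) * E s (\<lambda>_. 1) + M * ((?g s - ?g R) * u x)"
      using eventually_at_left_R[OF s0(2)] by eventually_elim (use le in auto)
    ultimately have "l \<le> (\<delta> + M * (R - R)) * ?\<tau> + M * ((?g R - ?g R) * u x)"
      using lim by (intro tendsto_le[of "at_left R"]) (auto simp: trivial_limit_at_left_real)
    also have "\<dots> = \<delta> * ?\<tau>" by simp
    also have "\<dots> = \<epsilon>" unfolding \<delta>_def using \<tau> by (metis less_irrefl nonzero_eq_divide_eq)
    finally show ?thesis by simp
  qed
  then show ?thesis by (rule field_le_epsilon)
qed

lemma E_kern_tendsto: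
  assumes "y \<in> B"
  shows "((\<lambda>s. E s (\<lambda>\<omega>. kernS s \<omega> y)) \<longlongrightarrow> u y) (at_left R)"
proof -
  have "\<forall>\<^sub>F s in at_left R. u y = E s (\<lambda>\<omega>. kernS s \<omega> y)"
    using eventually_at_left_R[OF riem_dist_less[OF assms]]
  proof eventually_elim
    case (elim s)
    then show ?case using represent[of s y] in_smaller_ball[OF assms] riem_dist_nonneg[OF assms] by simp
  qed
  then show ?thesis by (rule Lim_transform_eventually[OF tendsto_const])
qed

text \<open>Concentration is applied to test functions. With F = 1, absence of extremal points would
  force the positive limit mass to be nonpositive. With F the difference of the kernels at y for the
  unique extremal point and for \<omega>, in both signs, the limit gives u y as the limit mass times
  the kernel.\<close>

lemma equality_imp_kernel:
  assumes x: "x \<in> B" and D: "(u has_derivative D) (at x within space_form K)"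
    and e: "e \<in> tangent K x" "riem K e e = 1"
    and eq: "twist D x e = grad_bound n K R (riem_dist K p x) * u x"
  shows "\<exists>\<omega>. norm \<omega> = 1 \<and> (\<exists>c>0. \<forall>y \<in> B. u y = c * kern \<omega> y)"
proof -
  let ?g = "grad_bound n K R (riem_dist K p x)"
  let ?\<tau> = "u p / (Q * Q powr (- (n / 2)))"
  have \<tau>: "?\<tau> > 0" using u_pos[OF p_in_B] sn_pos[of "R/2" K] R rK[of "R/2"] by (simp add: Q_def)
  note conc = concentration[OF x D e eq]
  have "\<exists>\<omega>. norm \<omega> = 1 \<and> dirf x e \<omega> = ?g"
  proof (rule ccontr)
    assume no: "\<not> ?thesis"
    have "?\<tau> \<le> 0"
    proof (rule conc)
      show "riem_dist K p x < (riem_dist K p x + R) / 2" "(riem_dist K p x + R) / 2 < R"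
        using riem_dist_less[OF x] by simp_all
      show "(1::real) \<le> 0" if "norm \<omega> = 1" "dirf x e \<omega> = ?g" for \<omega> using no that by blast
    qed (rule continuous_on_const E_1_tendsto)+
    with \<tau> show False by (rule less_le_not_le[THEN iffD1, THEN conjunct2, THEN notE])
  qed
  then obtain \<omega>0 where \<omega>0: "norm \<omega>0 = 1" "dirf x e \<omega>0 = ?g" by blast
  have uniq: "\<omega> = \<omega>0" if "norm \<omega> = 1" "dirf x e \<omega> = ?g" for \<omega>
    by (rule dirf_eq_bound_unique[OF x e that \<omega>0])
  have "u y = ?\<tau> * kern \<omega>0 y" if y: "y \<in> B" for y
  proof -
    define s0 where "s0 = (max (riem_dist K p x) (riem_dist K p y) + R) / 2"
    have s0: "riem_dist K p x < s0" "riem_dist K p y < s0" "s0 < R"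
      using riem_dist_less[OF x] riem_dist_less[OF y] by (auto simp: s0_def max_def)
    have c: "continuous_on ({s0..R} \<times> sphere 0 1) (\<lambda>z. kernS (fst z) (snd z) y)"
      by (rule continuous_on_kern_dirf(1)[OF y s0(2) less_imp_le[OF s0(3)]])
    have lim: "((\<lambda>s. E s (\<lambda>\<omega>. a * kern \<omega>0 y + b * kernS s \<omega> y)) \<longlongrightarrow> a * kern \<omega>0 y * ?\<tau> + b * u y) (at_left R)" for a b
    proof -
      have "((\<lambda>s. a * kern \<omega>0 y * E s (\<lambda>_. 1) + b * E s (\<lambda>\<omega>. kernS s \<omega> y)) \<longlongrightarrow> a * kern \<omega>0 y * ?\<tau> + b * u y) (at_left R)"
        by (intro tendsto_intros E_1_tendsto E_kern_tendsto y)
      moreover have "\<forall>\<^sub>F s in at_left R. a * kern \<omega>0 y * E s (\<lambda>_. 1) + b * E s (\<lambda>\<omega>. kernS s \<omega> y) = E s (\<lambda>\<omega>. a * kern \<omega>0 y + b * kernS s \<omega> y)"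
        using eventually_at_left_R[OF s0(3)]
      proof eventually_elim
        case (elim s)
        then have "0 < s" using s0 riem_dist_nonneg[OF x] by simp
        moreover have "continuous_on (sphere 0 1) (\<lambda>\<omega>. kernS (fst (s, \<omega>)) (snd (s, \<omega>)) y)"
          by (rule continuous_on_compose2[OF c]) (use elim in \<open>auto intro!: continuous_intros\<close>)
        ultimately show ?case using elim by (simp add: E_affine)
      qed
      ultimately show ?thesis by (rule Lim_transform_eventually)
    qed
    have le: "a * kern \<omega>0 y * ?\<tau> + b * u y \<le> 0" if "a + b = 0" for a b
    proof (rule conc[OF s0(1,3)])
      show "continuous_on ({s0..R} \<times> sphere 0 1) (\<lambda>z. a * kern \<omega>0 y + b * kernS (fst z) (snd z) y)"
        by (intro continuous_intros c)
      show "a * kern \<omega>0 y + b * kernS (fst (R, \<omega>)) (snd (R, \<omega>)) y \<le> 0" if "norm \<omega> = 1" "dirf x e \<omega> = ?g" for \<omega>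
        unfolding uniq[OF that] using \<open>a + b = 0\<close> by (simp add: distrib_right[symmetric])
      show "((\<lambda>s. E s (\<lambda>\<omega>. a * kern \<omega>0 y + b * kernS (fst (s, \<omega>)) (snd (s, \<omega>)) y)) \<longlongrightarrow> a * kern \<omega>0 y * ?\<tau> + b * u y) (at_left R)"
        unfolding fst_conv snd_conv by (rule lim)
    qed
    show ?thesis using le[of 1 "-1"] le[of "-1" 1] by (simp add: mult.commute)
  qed
  then show ?thesis using \<omega>0(1) \<tau> by blast
qed

lemma cs_power_eq_h:
  assumes x: "x \<in> B"
  shows "ln (cs K (riem_dist K p x / 2) ^ (DIM('a) - 2) * u x) = m * ln (1 - K / 4 * chord2 K x p) + ln (u x)"
proof -
  obtain r \<theta> where r: "x = ex r \<theta>" "0 \<le> r" "r < R" "norm \<theta> = 1" "riem_dist K p x = r" using x by (rule radius)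
  have c: "cs K (r/2) > 0" using radius_pos[OF r(2,3)] by simp
  have z: "1 - K / 4 * chord2 K x p = (cs K (r/2))\<^sup>2"
    using cs_sn_square[of K "r/2"] r chord2_ex_p by simp
  have "real (DIM('a) - 2) = n - 2" unfolding n using dim by simp
  then have "real (DIM('a) - 2) = 2 * m" using n_eq by linarith
  then show ?thesis unfolding z r(5) using c u_pos[OF x] by (simp add: ln_mult ln_realpow)
qed

text \<open>The distance is not differentiable at p, so the logarithm is first rewritten through the
  squared chord by \<open>cs_power_eq_h\<close>; agreement on a neighbourhood inside the ball is
  enough.\<close>

lemma log_has_derivative:
  assumes x: "x \<in> B" and D: "(u has_derivative D) (at x within space_form K)"
  shows "(log_u has_derivative
     (\<lambda>v. twist D x v / u x)) (at x within space_form K)"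
proof -
  have z: "1 - K / 4 * chord2 K x p > 0" using one_minus_pos[of x] x by auto
  have xM: "x \<in> space_form K" using x closed_ball_subset by blast
  have "x \<in> V" using x B_eq by blast
  then obtain d where d: "d > 0" "ball x d \<subseteq> V" by (rule openE[OF open_V])
  have q: "((\<lambda>x. chord2 K x p) has_derivative (\<lambda>h. 2 * riem K (x - p) h)) (at x within space_form K)"
    using has_derivative_chord2 by (rule has_derivative_at_withinI)
  have "((\<lambda>z. 1 - K / 4 * chord2 K z p) has_derivative (\<lambda>v. 0 - K / 4 * (2 * riem K (x - p) v))) (at x within space_form K)"
    by (intro has_derivative_diff has_derivative_const has_derivative_mult_right q)
  note has_derivative_mult_right[OF DERIV_compose_FDERIV[OF DERIV_ln_divide[OF z] this], of m]
  moreover note DERIV_compose_FDERIV[OF DERIV_ln_divide[OF u_pos[OF x]] D]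
  ultimately have "((\<lambda>z. m * ln (1 - K / 4 * chord2 K z p) + ln (u z)) has_derivative
     (\<lambda>v. m * ((0 - K / 4 * (2 * riem K (x - p) v)) * (1 / (1 - K / 4 * chord2 K x p))) + D v * (1 / u x))) (at x within space_form K)"
    by (rule has_derivative_add)
  then have "((\<lambda>z. m * ln (1 - K / 4 * chord2 K z p) + ln (u z)) has_derivative
     (\<lambda>v. twist D x v / u x)) (at x within space_form K)"
  proof (rule has_derivative_eq_rhs, intro ext)
    fix v
    have "m * ((0 - K / 4 * (2 * a)) * (1 / c)) + b * (1 / w) = (b - m * K / 2 * a / c * w) / w" if "w \<noteq> 0" for a b c w :: real
      using that by (simp add: diff_divide_distrib)
    from this[OF less_imp_neq[OF u_pos[OF x], symmetric]]
    show "m * ((0 - K / 4 * (2 * riem K (x - p) v)) * (1 / (1 - K / 4 * chord2 K x p))) + D v * (1 / u x)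
      = twist D x v / u x" .
  qed
  then show ?thesis
  proof (rule has_derivative_transform_within[OF _ d(1) xM])
    fix z assume "z \<in> space_form K" "dist z x < d"
    then have "z \<in> B" using d(2) B_eq by (auto simp: dist_commute)
    then show "m * ln (1 - K / 4 * chord2 K z p) + ln (u z) = ln (cs K (riem_dist K p z / 2) ^ (DIM('a) - 2) * u z)"
      by (rule cs_power_eq_h[symmetric])
  qed
qed

lemma gradient_estimate:
  assumes x: "x \<in> B"
  shows "riem_norm K (grad K log_u x) \<le> grad_bound n K R (riem_dist K p x)"
proof -
  obtain D where D: "(u has_derivative D) (at x within space_form K)" using u_has_derivative[OF x] by blast
  have xM: "x \<in> space_form K" using x closed_ball_subset by blast
  show ?thesis
  proof (rule riem_norm_grad_le[OF log_has_derivative[OF x D] xM])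
    show "0 \<le> grad_bound n K R (riem_dist K p x)"
      using grad_bound_pos[OF riem_dist_nonneg[OF x] riem_dist_less[OF x]] by simp
    fix e assume "e \<in> tangent K x" "riem K e e = 1"
    then show "twist D x e / u x \<le> grad_bound n K R (riem_dist K p x)"
      using log_derivative_le[OF x D] u_pos[OF x] by (simp add: divide_le_eq)
  qed
qed

text \<open>For the converse the centre suffices: all boundary points are equally near to p, so
  every kernel attains the bound there.\<close>

lemma gradient_estimate_equality:
  "(\<exists>x \<in> B. riem_norm K (grad K log_u x) = grad_bound n K R (riem_dist K p x))
   \<longleftrightarrow> multiple_of_poisson_kernel K p R u"
  unfolding multiple_of_poisson_kernel_iff
proof
  assume "\<exists>x \<in> B. riem_norm K (grad K log_u x) = grad_bound n K R (riem_dist K p x)"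
  then obtain x where x: "x \<in> B" and eq: "riem_norm K (grad K log_u x) = grad_bound n K R (riem_dist K p x)"
    by blast
  obtain D where D: "(u has_derivative D) (at x within space_form K)" using u_has_derivative[OF x] by blast
  have xM: "x \<in> space_form K" using x closed_ball_subset by blast
  obtain e where e: "e \<in> tangent K x" "riem K e e = 1"
    "twist D x e / u x = grad_bound n K R (riem_dist K p x)"
    using riem_norm_grad_attained[OF log_has_derivative[OF x D] xM] eq
      grad_bound_pos[OF riem_dist_nonneg[OF x] riem_dist_less[OF x]] by auto
  have "twist D x e = grad_bound n K R (riem_dist K p x) * u x"
    using e(3) u_pos[OF x] by (simp add: divide_eq_eq)
  then show "\<exists>\<omega>. norm \<omega> = 1 \<and> (\<exists>c>0. \<forall>x \<in> B. u x = c * kern \<omega> x)"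
    by (rule equality_imp_kernel[OF x D e(1,2)])
next
  assume "\<exists>\<omega>. norm \<omega> = 1 \<and> (\<exists>c>0. \<forall>x \<in> B. u x = c * kern \<omega> x)"
  then obtain \<omega> c where \<omega>: "norm \<omega> = 1" and c: "c > 0" "\<And>x. x \<in> B \<Longrightarrow> u x = c * kern \<omega> x" by blast
  have r0: "riem_dist K p p = 0" using riem_dist_ex[of 0 \<omega>] \<omega> by simp
  have g0: "grad_bound n K R 0 > 0" using grad_bound_pos[of 0] R by simp
  have k: "(kern \<omega> has_derivative (\<lambda>v. kgrad \<omega> p \<bullet> v)) (at p within space_form K)"
    unfolding kern_def kgrad_def
    by (rule has_derivative_at_withinI[OF has_derivative_chord_fun]) (use chord2_pos[OF p_in_B \<omega>] in simp)
  have "p \<in> V" using p_in_B B_eq by blast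
  then obtain d where d: "d > 0" "ball p d \<subseteq> V" by (rule openE[OF open_V])
  have D: "(u has_derivative (\<lambda>v. c * (kgrad \<omega> p \<bullet> v))) (at p within space_form K)"
  proof (rule has_derivative_transform_within[OF has_derivative_mult_right[OF k] d(1) p])
    fix z assume "z \<in> space_form K" "dist z p < d"
    then have "z \<in> B" using d(2) B_eq by (auto simp: dist_commute)
    then show "c * kern \<omega> z = u z" by (rule c(2)[symmetric])
  qed
  obtain X where X: "X \<in> tangent K p" "\<forall>e \<in> tangent K p. dirf p e \<omega> = - riem K X e"
    "chord2 K p (ex R \<omega>) = 4 * (sn K ((R - 0) / 2))\<^sup>2 \<longrightarrow> riem K X X = (grad_bound n K R 0)\<^sup>2"
    using dirf_tangent[of p 0 \<omega> \<omega>, OF _ order.refl R(1) \<omega> \<omega>] ex_0[symmetric] by blast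
  have XX: "riem K X X = (grad_bound n K R 0)\<^sup>2"
    using X(3) chord2_ex_p[OF \<omega>, of R] by (simp add: chord2_sym)
  have X0: "X \<noteq> 0" using XX g0 by (auto simp: riem.zero_left)
  have nX: "riem_norm K X = grad_bound n K R 0" using XX g0 by (simp add: riem_norm_def)
  \<comment> \<open>The gradient of ln (kern \<omega> / h) at p is - X, so the extremal direction is
    opposite to X.\<close>
  define e where "e = - ((1 / riem_norm K X) *\<^sub>R X)"
  note ut = unit_tangent[OF p X(1) X0]
  have e: "e \<in> tangent K p" "riem K e e = 1"
    using subspace_neg[OF subspace_tangent ut(1)] ut(2) by (simp_all only: e_def riem.minus_left riem.minus_right minus_minus)
  have "dirf p e \<omega> = grad_bound n K R 0"
    using X(2) e(1) XX g0 nX by (simp add: e_def riem.minus_right power2_eq_square)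
  moreover have "c * (kgrad \<omega> p \<bullet> e) - m * K / 2 * riem K (p - p) e / (1 - K / 4 * chord2 K p p) * u p = c * (kern \<omega> p * dirf p e \<omega>)"
    unfolding kgrad_dirf[OF p_in_B \<omega>, symmetric] c(2)[OF p_in_B] by (simp add: algebra_simps)
  ultimately have "(c * (kgrad \<omega> p \<bullet> e) - m * K / 2 * riem K (p - p) e / (1 - K / 4 * chord2 K p p) * u p) / u p = grad_bound n K R 0"
    using less_imp_neq[OF u_pos[OF p_in_B]] c(2)[OF p_in_B] by (auto simp: divide_eq_eq)
  with riem_norm_grad_ge[OF log_has_derivative[OF p_in_B D] p e]
  have "grad_bound n K R (riem_dist K p p) \<le> riem_norm K (grad K log_u p)"
    unfolding r0 by simp
  then show "\<exists>x \<in> B. riem_norm K (grad K log_u x) = grad_bound n K R (riem_dist K p x)"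
    using gradient_estimate[OF p_in_B] p_in_B by (intro bexI[of _ p]) auto
qed

lemma grad_bound_2:
  assumes "n = 2" "x \<in> B"
  shows "grad_bound n K R (riem_dist K p x)
    = sn K R / (2 * sn K ((R + riem_dist K p x) / 2) * sn K ((R - riem_dist K p x) / 2))"
proof -
  let ?r = "riem_dist K p x"
  note pos = radius_pos[OF riem_dist_nonneg[OF assms(2)] riem_dist_less[OF assms(2)]]
  have "grad_bound n K R ?r = cs K (R/2) / cs K (?r/2) * (2 * sn K (R/2) * cs K (?r/2)) / (2 * (sn K ((R + ?r) / 2) * sn K ((R - ?r) / 2)))"
    using pos by (subst grad_bound_eq) (auto simp: assms(1) sn_half_square_diff)
  then show ?thesis using pos sn_half[of K R] by (simp add: mult.assoc)
qed

end

theorem theorem1p4: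
  fixes K R :: real and p :: "real \<times> 'a::euclidean_space" and u :: "real \<times> 'a \<Rightarrow> real"
  defines "n \<equiv> DIM('a)"
    and "r \<equiv> riem_dist K p"
    and "B \<equiv> geodesic_ball K p R"
  assumes "n \<ge> 2"
    and "p \<in> space_form K"
    and "R > 0"
    and "K > 0 \<longrightarrow> R < pi / sqrt K"
    and "\<And>x. x \<in> B \<Longrightarrow> u x > 0"
    and "conformal_solution K B u"
  shows "(\<forall>x \<in> B. riem_norm K (grad K (\<lambda>z. ln (cs K (r z / 2) ^ (n - 2) * u z)) x)
            \<le> cs K (R / 2) / cs K (r x / 2) *
                ((real n - 1) / (2 * sn K ((R - r x) / 2)) + 1 / (2 * sn K ((R + r x) / 2))))
    \<and> ((\<exists>x \<in> B. riem_norm K (grad K (\<lambda>z. ln (cs K (r z / 2) ^ (n - 2) * u z)) x)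
            = cs K (R / 2) / cs K (r x / 2) *
                ((real n - 1) / (2 * sn K ((R - r x) / 2)) + 1 / (2 * sn K ((R + r x) / 2))))
        \<longleftrightarrow> multiple_of_poisson_kernel K p R u)
    \<and> (n = 2 \<longrightarrow>
        (\<forall>x \<in> B. riem_norm K (grad K (\<lambda>z. ln (u z)) x)
            \<le> sn K R / (2 * sn K ((R + r x) / 2) * sn K ((R - r x) / 2)))
        \<and> ((\<exists>x \<in> B. riem_norm K (grad K (\<lambda>z. ln (u z)) x)
            = sn K R / (2 * sn K ((R + r x) / 2) * sn K ((R - r x) / 2)))
          \<longleftrightarrow> multiple_of_poisson_kernel K p R u))"
proof -
  interpret positive_solution K p R "real n" u
    by unfold_locales (use assms in \<open>auto simp: n_def\<close>)
  have 1: "\<forall>x \<in> B. riem_norm K (grad K (\<lambda>z. ln (cs K (r z / 2) ^ (n - 2) * u z)) x) \<le> grad_bound (real n) K R (r x)"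
    using gradient_estimate by (simp add: n_def r_def B_def)
  have 2: "(\<exists>x \<in> B. riem_norm K (grad K (\<lambda>z. ln (cs K (r z / 2) ^ (n - 2) * u z)) x) = grad_bound (real n) K R (r x))
     \<longleftrightarrow> multiple_of_poisson_kernel K p R u"
    using gradient_estimate_equality by (simp add: n_def r_def B_def)
  have 3: "grad_bound (real n) K R (r x) = sn K R / (2 * sn K ((R + r x) / 2) * sn K ((R - r x) / 2))" if "n = 2" "x \<in> B" for x
    using grad_bound_2[of x] that by (simp add: r_def B_def)
  have "(\<forall>x \<in> B. riem_norm K (grad K (\<lambda>z. ln (u z)) x) \<le> sn K R / (2 * sn K ((R + r x) / 2) * sn K ((R - r x) / 2)))
        \<and> ((\<exists>x \<in> B. riem_norm K (grad K (\<lambda>z. ln (u z)) x) = sn K R / (2 * sn K ((R + r x) / 2) * sn K ((R - r x) / 2)))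
          \<longleftrightarrow> multiple_of_poisson_kernel K p R u)" if "n = 2"
    using 1 2 3 that by simp
  with 1 2 show ?thesis unfolding grad_bound_def by blast
qed

end
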